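(* Let $n\ge 3$, $N\ge n+1$, $m\in\{2,\dots,n-1\}$, let $\gamma_1,\dots,\gamma_N$ be positive real numbers, and let $u_1,\dots,u_N\in S^{n-1}$ be unit vectors in general position. Then there exists a polytope $P\in\mathcal{K}_{(o)}^n$ such that $$\widetilde{C}_m^a(P,\cdot)=\sum_{k=1}^N\gamma_k\,\delta_{u_k}.$$
   Context: A convex body is a nonempty compact convex subset of $\mathbb{R}^n$. $\mathcal{K}_o^n$ is the set of convex bodies in $\mathbb{R}^n$ containing the origin $o$, and $\mathcal{K}_{(o)}^n$ is the set of convex bodies containing the origin in their relative interiors. $S^{n-1}$ is the unit sphere, $du$ denotes integration against $(n-1)$-dimensional Hausdorff measure on $S^{n-1}$, and $\delta_u$ is the Dirac unit mass at $u$. Unit vectors $u_1,\dots,u_N$ are in general position if they are not all contained in a closed hemisphere of $S^{n-1}$ and any $n$ of them are linearly independent. For $K\in\mathcal{K}_o^n$: the support function is $h_K(v)=\max\{x\cdot v:x\in K\}$, the radial function is $\rho_K(u)=\max\{\lambda\ge 0:\lambda u\in K\}$ for $u\in S^{n-1}$, and for $\eta\subset S^{n-1}$ the reverse radial Gauss image is $$\boldsymbol{\alpha}_K^*(\eta)=\bigcup_{v\in\eta}\{u\in S^{n-1}:\rho_K(u)\,u\cdot v=h_K(v)\}.$$ $G(n,m)$ is the Grassmannian of $m$-dimensional linear subspaces of $\mathbb{R}^n$, $\mathrm{vol}_m$ is $m$-dimensional volume, and $\omega_m$ is the volume of the unit ball of $\mathbb{R}^m$. For a function $F$ on $G(n,m)$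 the $m$-dimensional dual Radon transform is $$\mathcal{R}_m^*F(u)=\frac{m\omega_m}{n\omega_n}\int_{G_u(n-1,m-1)}F(\mathrm{span}\{u,\zeta\})\,d\nu_{m-1}(\zeta),\qquad u\in S^{n-1},$$ where $G_u(n-1,m-1)$ is the Grassmannian of $(m-1)$-dimensional subspaces of $u^\perp$ and $\nu_{m-1}$ is its Haar probability measure. The affine dual curvature measure of $K\in\mathcal{K}_o^n$ is the Borel measure on $S^{n-1}$ given, for Borel $\eta\subset S^{n-1}$, by $$\widetilde{C}_m^a(K,\eta)=\int_{\boldsymbol{\alpha}_K^*(\eta)}\rho_K(u)^m\,\mathcal{R}_m^*\big(\mathrm{vol}_m(K\cap\cdot)^{n-1}\big)(u)\,du\quad\text{if }\mathrm{int}\,K\ne\emptyset,$$ and $\widetilde{C}_m^a(K,\eta)=0$ if $\dim K\le n-1$. Here $\mathrm{vol}_m(K\cap\cdot)^{n-1}$ denotes the function $\xi\mapsto \mathrm{vol}_m(K\cap\xi)^{n-1}$ on $G(n,m)$. *)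

theory Defs
  imports "HOL-Analysis.Analysis" "HOL-Probability.Giry_Monad"
begin

section \<open>Hausdorff measure\<close>

text \<open>
  The factor \<open>unit_ball_vol s / 2 ^ s\<close> is the normalisation for which \<open>s\<close>-dimensional
  Hausdorff measure agrees with \<open>s\<close>-dimensional Lebesgue measure, so that the unit sphere of
  \<open>n\<close>-space has measure \<open>n * unit_ball_vol n\<close>. Covering sets are required to be bounded since
  \<^const>\<open>diameter\<close> is only meaningful for bounded sets; the case distinction matters only for
  \<open>s = 0\<close>.
\<close>

definition hausdorff_premeasure :: "nat \<Rightarrow> real \<Rightarrow> 'a::metric_space set \<Rightarrow> ennreal" where
  "hausdorff_premeasure s \<delta> A =
     (INF C \<in> {C :: nat \<Rightarrow> 'a set.
                A \<subseteq> (\<Union>i. C i) \<and> (\<forall>i. bounded (C i) \<and> diameter (C i) \<le> \<delta>)}.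
        \<Sum>i. if C i = {} then 0
            else ennreal (unit_ball_vol (real s) * (diameter (C i) / 2) ^ s))"

definition hausdorff_outer :: "nat \<Rightarrow> 'a::metric_space set \<Rightarrow> ennreal" where
  "hausdorff_outer s A = (SUP \<delta> \<in> {0<..}. hausdorff_premeasure s \<delta> A)"

definition hausdorff_measure :: "nat \<Rightarrow> 'a::metric_space measure" where
  "hausdorff_measure s = measure_of UNIV (sets borel) (hausdorff_outer s)"

definition sphere_measure :: "(real ^ 'n::finite) measure" where
  "sphere_measure = restrict_space (hausdorff_measure (CARD('n) - 1)) (sphere 0 1)"


section \<open>Volume on subspaces and Haar measure on Grassmannians\<close>

text \<open>
  Lebesgue measure carried by a linear subspace, built exactly as \<^const>\<open>lborel\<close> is, from an
  orthonormal basis; it does not depend on the basis chosen. If \<open>\<xi>\<close> has dimension \<open>m\<close> then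
  \<open>subspace_vol \<xi>\<close> is \<open>m\<close>-dimensional volume of Borel subsets of \<open>\<xi>\<close>.
\<close>

definition orthonormal_basis_of :: "'a::euclidean_space set \<Rightarrow> 'a set \<Rightarrow> bool" where
  "orthonormal_basis_of \<xi> B \<longleftrightarrow>
     pairwise orthogonal B \<and> (\<forall>b\<in>B. norm b = 1) \<and> span B = \<xi>"

definition subspace_lborel :: "'a::euclidean_space set \<Rightarrow> 'a measure" where
  "subspace_lborel \<xi> =
     (let B = (SOME B. orthonormal_basis_of \<xi> B)
      in distr (\<Pi>\<^sub>M b\<in>B. lborel) borel (\<lambda>c. \<Sum>b\<in>B. c b *\<^sub>R b))"

definition subspace_vol :: "'a::euclidean_space set \<Rightarrow> 'a set \<Rightarrow> real" where
  "subspace_vol \<xi> A = measure (subspace_lborel \<xi>) A"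

definition grassmannian_perp :: "real ^ 'n::finite \<Rightarrow> nat \<Rightarrow> (real ^ 'n) set set" where
  "grassmannian_perp u k = {V. subspace V \<and> dim V = k \<and> (\<forall>x\<in>V. orthogonal u x)}"

text \<open>
  The Grassmannian is topologised by identifying \<open>V\<close> with the matrix of the orthogonal projection
  onto \<open>V\<close>, which is \<open>closest_point V\<close>.
\<close>

definition grassmannian_perp_borel ::
    "real ^ 'n::finite \<Rightarrow> nat \<Rightarrow> (real ^ 'n) set measure" where
  "grassmannian_perp_borel u k =
     vimage_algebra (grassmannian_perp u k) (\<lambda>V. matrix (closest_point V)) borel"

text \<open>
  Orthogonal maps of the hyperplane \<open>u\<^sup>\<bottom>\<close> are the restrictions of the
  orthogonal maps of the whole space that fix \<open>u\<close>.
\<close>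

definition is_haar_perp ::
    "real ^ 'n::finite \<Rightarrow> nat \<Rightarrow> (real ^ 'n) set measure \<Rightarrow> bool" where
  "is_haar_perp u k \<nu> \<longleftrightarrow>
     sets \<nu> = sets (grassmannian_perp_borel u k) \<and>
     emeasure \<nu> (space \<nu>) = 1 \<and>
     (\<forall>T. orthogonal_transformation T \<and> T u = u \<longrightarrow> distr \<nu> \<nu> (\<lambda>V. T ` V) = \<nu>)"

definition haar_perp :: "real ^ 'n::finite \<Rightarrow> nat \<Rightarrow> (real ^ 'n) set measure" where
  "haar_perp u k = (THE \<nu>. is_haar_perp u k \<nu>)"

definition dual_radon ::
    "nat \<Rightarrow> ((real ^ 'n::finite) set \<Rightarrow> real) \<Rightarrow> real ^ 'n \<Rightarrow> real" where
  "dual_radon m F u =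
     (real m * unit_ball_vol (real m)) / (real CARD('n) * unit_ball_vol (real CARD('n))) *
     (LINT \<zeta>|haar_perp u (m - 1). F (span (insert u \<zeta>)))"


section \<open>Convex bodies and affine dual curvature measures\<close>

definition convex_body :: "'a::euclidean_space set \<Rightarrow> bool" where
  "convex_body K \<longleftrightarrow> K \<noteq> {} \<and> compact K \<and> convex K"

definition convex_body_o_rel_interior :: "'a::euclidean_space set \<Rightarrow> bool" where
  "convex_body_o_rel_interior K \<longleftrightarrow> convex_body K \<and> 0 \<in> rel_interior K"

text \<open>For a convex body containing the origin both suprema are attained.\<close>

definition support_fn :: "'a::euclidean_space set \<Rightarrow> 'a \<Rightarrow> real" where
  "support_fn K v = (SUP x\<in>K. x \<bullet> v)"

definition radial_fn :: "'a::euclidean_space set \<Rightarrow> 'a \<Rightarrow> real" where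
  "radial_fn K u = Sup {t. 0 \<le> t \<and> t *\<^sub>R u \<in> K}"

definition reverse_radial_gauss_image :: "'a::euclidean_space set \<Rightarrow> 'a set \<Rightarrow> 'a set" where
  "reverse_radial_gauss_image K \<eta> =
     (\<Union>v\<in>\<eta>. {u \<in> sphere 0 1. (radial_fn K u *\<^sub>R u) \<bullet> v = support_fn K v})"

text \<open>
  The reverse radial Gauss image of a Borel set need not be Borel in general, only measurable with
  respect to the completed spherical measure.
\<close>

definition affine_dual_curvature ::
    "nat \<Rightarrow> (real ^ 'n::finite) set \<Rightarrow> (real ^ 'n) set \<Rightarrow> real" where
  "affine_dual_curvature m K \<eta> =
     (if interior K \<noteq> {}
      then LINT u:reverse_radial_gauss_image K \<eta>|completion sphere_measure.
             radial_fn K u ^ m *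
             dual_radon m (\<lambda>\<xi>. subspace_vol \<xi> (K \<inter> \<xi>) ^ (CARD('n) - 1)) u
      else 0)"


section \<open>General position\<close>

text \<open>
  Linear independence is that of indexed families, hence the injectivity condition: repeated
  vectors count as dependent.
\<close>

definition general_position :: "nat \<Rightarrow> (nat \<Rightarrow> real ^ 'n::finite) \<Rightarrow> bool" where
  "general_position N u \<longleftrightarrow>
     \<not> (\<exists>v\<in>sphere 0 1. \<forall>k\<in>{1..N}. 0 \<le> u k \<bullet> v) \<and>
     (\<forall>I\<subseteq>{1..N}. card I = CARD('n) \<longrightarrow> inj_on u I \<and> independent (u ` I))"

end

theory Submission
  imports Defs
begin

text \<open>
  For a polytope whose outer unit normals are among \<open>u\<^sub>1, \<dots>, u\<^sub>N\<close> the measure is a sum of point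
  masses: the ray in almost every direction leaves the polytope through the relative interior of a
  single facet, so the reverse radial Gauss image of \<open>\<eta>\<close> is, up to a null set, the union of the cones
  over the facets with normal in \<open>\<eta>\<close>. The mass \<open>c\<^sub>k\<close> at \<open>u\<^sub>k\<close> is the integral of
  \<open>\<rho>\<^sup>m R\<close> over the \<open>k\<close>-th facet cone (\<open>\<rho>\<close> the radial function, \<open>R\<close> the dual Radon transform in the
  integrand), and the task is to find a polytope for which \<open>c\<^sub>k = \<gamma>\<^sub>k\<close> for all \<open>k\<close>.

  The candidates are parametrised as follows. Weights \<open>t\<close> are balanced if \<open>t\<^sub>k \<ge> 0\<close>,
  \<open>\<Sum> t\<^sub>k u\<^sub>k = 0\<close> and \<open>\<Sum> t\<^sub>k = 1\<close>. A balanced \<open>t\<close> and a point \<open>x\<close> of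
  \<open>P\<^sub>t = {y. t\<^sub>k (u\<^sub>k \<bullet> y) \<le> \<gamma>\<^sub>k for all k}\<close> give the translate \<open>P\<^sub>t - x\<close>, which contains the
  origin. Its masses \<open>c\<^sub>k\<close> are continuous in \<open>(t, x)\<close>, they are nonnegative and not all zero, and
  \<open>c\<^sub>k = 0\<close> if \<open>t\<^sub>k = 0\<close> (there is no \<open>k\<close>-th facet) or if \<open>x\<close> lies on the \<open>k\<close>-th facet (the cone
  over it is flat). Put \<open>\<psi>\<^sub>k = \<gamma>\<^sub>k - \<lambda> c\<^sub>k\<close> with \<open>\<lambda>\<close> such that \<open>\<Sum> t\<^sub>k \<psi>\<^sub>k = 0\<close>.

  The point \<open>(t, x)\<close> is found by Brouwer's theorem, as a common solution of a variational inequality for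
  \<open>t\<close>, \<open>\<Sum> \<psi>\<^sub>k t'\<^sub>k \<le> 0\<close> for all balanced \<open>t'\<close>, and an equation for \<open>x\<close>,
  \<open>\<Sum> t\<^sub>k \<alpha>\<^sub>k u\<^sub>k = 0\<close>. Here \<open>\<alpha>\<^sub>k = \<psi>\<^sub>k\<close> as long as \<open>x\<close> is in \<open>P\<^sub>t\<close>; outside \<open>P\<^sub>t\<close>, where \<open>\<psi>\<close> is
  extended by a radial retraction, \<open>\<alpha>\<^sub>k\<close> is a positive multiple of \<open>\<psi>\<^sub>k\<close> which makes
  \<open>\<Sum> t\<^sub>k \<alpha>\<^sub>k u\<^sub>k\<close> point outwards for large \<open>x\<close>. The equation says that the weights
  \<open>t\<^sub>k (1 + \<epsilon> \<alpha>\<^sub>k)\<close> are balanced up to normalisation, and the inequality for them yields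
  \<open>\<Sum> t\<^sub>k \<psi>\<^sub>k\<^sup>2 \<le> 0\<close>. Hence \<open>\<psi>\<^sub>k = 0\<close> where \<open>t\<^sub>k > 0\<close>, whereas \<open>\<psi>\<^sub>k = \<gamma>\<^sub>k > 0\<close> where
  \<open>t\<^sub>k = 0\<close>. By general position there are balanced weights that are all positive, and the inequality
  for these shows that \<open>\<psi>\<close> vanishes: \<open>\<lambda> c\<^sub>k = \<gamma>\<^sub>k\<close> for all \<open>k\<close> (\<open>balanced_equilibrium\<close>).
  In particular no \<open>c\<^sub>k\<close> is zero, so the origin is an interior point. The masses are homogeneous
  of degree \<open>m n\<close> under dilation, so dilating by \<open>\<lambda>\<close> to the power \<open>1/(m n)\<close> finishes the proof.

  The properties of \<open>c\<^sub>k\<close> rest on three facts. The \<open>(n-1)\<close>-dimensional Hausdorff measure of the sphere is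
  a finite Borel measure for which great subspheres are null and nonempty open sets are not
  (\<open>finite_measure_sphere_measure\<close>, \<open>AE_sphere_measure_not_orthogonal\<close>,
  \<open>hausdorff_outer_open_in_sphere_pos\<close>). The invariant probability measure on the Grassmannian of
  \<open>u\<^sup>\<bottom>\<close> exists, is unique, and is carried along by rotations (\<open>haar_perp_ex1\<close>,
  \<open>haar_perp_orthogonal_image\<close>). And the volume of a linear section of \<open>K\<close> is, up to a constant,
  the Lebesgue measure of a slab of points that project into \<open>K\<close> (\<open>subspace_vol_eq_slab\<close>), which
  reduces measurability, continuity and positivity of section volumes to Fubini's theorem and
  dominated convergence in the whole space.
\<close>

section \<open>Hausdorff measure is a Borel measure\<close>

definition hausdorff_gauge :: "nat \<Rightarrow> 'a::metric_space set \<Rightarrow> ennreal" where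
  "hausdorff_gauge s C =
     (if C = {} then 0 else ennreal (unit_ball_vol (real s) * (diameter C / 2) ^ s))"

definition fine_cover :: "real \<Rightarrow> 'a::metric_space set \<Rightarrow> (nat \<Rightarrow> 'a set) \<Rightarrow> bool" where
  "fine_cover \<delta> A C \<longleftrightarrow> A \<subseteq> (\<Union>i. C i) \<and> (\<forall>i. bounded (C i) \<and> diameter (C i) \<le> \<delta>)"

lemma hausdorff_premeasure_eq:
  "hausdorff_premeasure s \<delta> A = (INF C \<in> Collect (fine_cover \<delta> A). \<Sum>i. hausdorff_gauge s (C i))"
  unfolding hausdorff_premeasure_def fine_cover_def hausdorff_gauge_def by simp

lemma hausdorff_gauge_empty [simp]: "hausdorff_gauge s {} = 0"
  by (simp add: hausdorff_gauge_def)

lemma hausdorff_premeasure_le: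
  "fine_cover \<delta> A C \<Longrightarrow> hausdorff_premeasure s \<delta> A \<le> (\<Sum>i. hausdorff_gauge s (C i))"
  unfolding hausdorff_premeasure_eq by (intro INF_lower) auto

lemma hausdorff_premeasure_mono:
  "A \<subseteq> B \<Longrightarrow> hausdorff_premeasure s \<delta> A \<le> hausdorff_premeasure s \<delta> B"
  unfolding hausdorff_premeasure_eq fine_cover_def
  by (intro INF_superset_mono subsetI) (simp_all, meson order_trans)

lemma hausdorff_premeasure_antimono:
  "\<delta> \<le> \<delta>' \<Longrightarrow> hausdorff_premeasure s \<delta>' A \<le> hausdorff_premeasure s \<delta> A"
  unfolding hausdorff_premeasure_eq fine_cover_def
  by (intro INF_superset_mono subsetI) (simp_all, meson order_trans)

lemma hausdorff_premeasure_empty: "0 < \<delta> \<Longrightarrow> hausdorff_premeasure s \<delta> {} = 0"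
  using hausdorff_premeasure_le[of \<delta> "{}" "\<lambda>_. {}" s] by (auto simp: fine_cover_def)

lemma hausdorff_premeasure_approx:
  assumes "hausdorff_premeasure s \<delta> A < \<infinity>" "0 < e"
  obtains C where "fine_cover \<delta> A C"
    "(\<Sum>i. hausdorff_gauge s (C i)) \<le> hausdorff_premeasure s \<delta> A + e"
proof -
  have "hausdorff_premeasure s \<delta> A < hausdorff_premeasure s \<delta> A + e"
    using assms ennreal_add_left_cancel_less[of "hausdorff_premeasure s \<delta> A" 0 e] by (simp add: less_top)
  then show ?thesis
    using that unfolding hausdorff_premeasure_eq INF_less_iff by (auto intro: less_imp_le)
qed

text \<open>
  Merge the covers of the single sets into one sequence along the pairing of natural numbers.
\<close>

lemma hausdorff_premeasure_subadditive:
  "hausdorff_premeasure s \<delta> (\<Union>i. A i) \<le> (\<Sum>i::nat. hausdorff_premeasure s \<delta> (A i))"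
proof (rule ennreal_le_epsilon)
  fix e :: real assume fin: "(\<Sum>i. hausdorff_premeasure s \<delta> (A i)) < top" and e: "0 < e"
  have "hausdorff_premeasure s \<delta> (A i) < \<infinity>" for i
    using fin ennreal_suminf_lessD infinity_ennreal_def by metis
  then have "\<exists>C. fine_cover \<delta> (A i) C \<and>
     (\<Sum>j. hausdorff_gauge s (C j)) \<le> hausdorff_premeasure s \<delta> (A i) + ennreal (e * (1/2) ^ Suc i)" for i
    using e by (metis hausdorff_premeasure_approx ennreal_less_zero_iff half_gt_zero_iff mult_pos_pos
        zero_less_power zero_less_one)
  then obtain C where C: "\<And>i. fine_cover \<delta> (A i) (C i)"
     "\<And>i. (\<Sum>j. hausdorff_gauge s (C i j)) \<le> hausdorff_premeasure s \<delta> (A i) + ennreal (e * (1/2) ^ Suc i)"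
    by metis
  have "fine_cover \<delta> (\<Union>i. A i) (\<lambda>k. case prod_decode k of (i, j) \<Rightarrow> C i j)"
    unfolding fine_cover_def
  proof (intro conjI allI)
    show "\<Union> (range A) \<subseteq> (\<Union>k. case prod_decode k of (i, j) \<Rightarrow> C i j)"
    proof
      fix x assume "x \<in> \<Union> (range A)"
      then obtain i j where "x \<in> C i j" using C(1) unfolding fine_cover_def by blast
      then show "x \<in> (\<Union>k. case prod_decode k of (i, j) \<Rightarrow> C i j)"
        by (intro UN_I[of "prod_encode (i, j)"]) auto
    qed
  qed (use C(1) in \<open>auto simp: fine_cover_def split: prod.splits\<close>)
  then have "hausdorff_premeasure s \<delta> (\<Union>i. A i)
      \<le> (\<Sum>k. hausdorff_gauge s (case prod_decode k of (i, j) \<Rightarrow> C i j))"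
    by (rule hausdorff_premeasure_le)
  also have "\<dots> = (\<Sum>i. \<Sum>j. hausdorff_gauge s (C i j))"
    by (subst suminf_ennreal_2dimen[of _ "\<lambda>(i,j). hausdorff_gauge s (C i j)", symmetric])
       (auto simp: case_prod_beta)
  also have "\<dots> \<le> (\<Sum>i. hausdorff_premeasure s \<delta> (A i) + ennreal (e * (1/2) ^ Suc i))"
    by (intro suminf_le C(2)) auto
  also have "\<dots> = (\<Sum>i. hausdorff_premeasure s \<delta> (A i)) + (\<Sum>i. ennreal (e * (1/2) ^ Suc i))"
    by (intro suminf_add[symmetric]) auto
  also have "(\<Sum>i. ennreal (e * (1/2) ^ Suc i)) = ennreal e"
  proof (rule suminf_ennreal_eq)
    show "(\<lambda>i. e * (1/2) ^ Suc i) sums e"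
      using sums_mult[OF power_half_series, of e] by simp
  qed (use e in auto)
  finally show "hausdorff_premeasure s \<delta> (\<Union>i. A i) \<le> (\<Sum>i. hausdorff_premeasure s \<delta> (A i)) + ennreal e" .
qed

lemma hausdorff_outer_space:
  "outer_measure_space (Pow UNIV) (hausdorff_outer s :: 'a::metric_space set \<Rightarrow> ennreal)"
  unfolding outer_measure_space_def
proof (intro conjI)
  show "positive (Pow UNIV) (hausdorff_outer s :: 'a set \<Rightarrow> ennreal)"
    unfolding positive_def hausdorff_outer_def
    by (auto simp: hausdorff_premeasure_empty intro!: SUP_eq_const[THEN trans] exI[of _ 1])
  show "increasing (Pow UNIV) (hausdorff_outer s :: 'a set \<Rightarrow> ennreal)"
    unfolding increasing_def hausdorff_outer_def
    by (auto intro!: SUP_mono' hausdorff_premeasure_mono)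
  show "countably_subadditive (Pow UNIV) (hausdorff_outer s :: 'a set \<Rightarrow> ennreal)"
    unfolding countably_subadditive_def
  proof (intro allI impI)
    fix A :: "nat \<Rightarrow> 'a set"
    show "hausdorff_outer s (\<Union> (range A)) \<le> (\<Sum>i. hausdorff_outer s (A i))"
      unfolding hausdorff_outer_def[of s "\<Union> (range A)"]
    proof (rule SUP_least)
      fix \<delta> :: real assume \<delta>: "\<delta> \<in> {0<..}"
      have "hausdorff_premeasure s \<delta> (\<Union> (range A)) \<le> (\<Sum>i. hausdorff_premeasure s \<delta> (A i))"
        by (rule hausdorff_premeasure_subadditive)
      also have "\<dots> \<le> (\<Sum>i. hausdorff_outer s (A i))"
        unfolding hausdorff_outer_def using \<delta> by (intro suminf_le SUP_upper) auto
      finally show "hausdorff_premeasure s \<delta> (\<Union> (range A)) \<le> (\<Sum>i. hausdorff_outer s (A i))" .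
    qed
  qed
qed

text \<open>
  A set of diameter below the distance of \<open>A\<close> and \<open>B\<close> meets at most one of them, so a fine cover of the
  union splits into a cover of \<open>A\<close> and a cover of \<open>B\<close>.
\<close>

lemma hausdorff_outer_metric:
  assumes d: "0 < d" "\<And>a b. a \<in> A \<Longrightarrow> b \<in> B \<Longrightarrow> d \<le> dist a b"
  shows "hausdorff_outer s A + hausdorff_outer s B \<le> hausdorff_outer s (A \<union> B)"
proof -
  have pre: "hausdorff_premeasure s \<delta> A + hausdorff_premeasure s \<delta> B \<le> hausdorff_premeasure s \<delta> (A \<union> B)"
    if \<delta>: "0 < \<delta>" "\<delta> < d" for \<delta>
    unfolding hausdorff_premeasure_eq[of s \<delta> "A \<union> B"]
  proof (rule INF_greatest)
    fix C assume "C \<in> Collect (fine_cover \<delta> (A \<union> B))"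
    then have C: "fine_cover \<delta> (A \<union> B) C" by simp
    define CA where "CA i = (if C i \<inter> A = {} then {} else C i)" for i
    define CB where "CB i = (if C i \<inter> B = {} then {} else C i)" for i
    have "fine_cover \<delta> A CA" "fine_cover \<delta> B CB"
      using C \<delta> unfolding fine_cover_def CA_def CB_def by fastforce+
    then have "hausdorff_premeasure s \<delta> A + hausdorff_premeasure s \<delta> B
       \<le> (\<Sum>i. hausdorff_gauge s (CA i)) + (\<Sum>i. hausdorff_gauge s (CB i))"
      by (intro add_mono hausdorff_premeasure_le)
    also have "\<dots> = (\<Sum>i. hausdorff_gauge s (CA i) + hausdorff_gauge s (CB i))"
      by (intro suminf_add) auto
    also have "\<dots> \<le> (\<Sum>i. hausdorff_gauge s (C i))"
    proof (intro suminf_le)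
      fix i
      have "C i \<inter> A = {} \<or> C i \<inter> B = {}"
      proof (rule ccontr)
        assume "\<not> ?thesis"
        then obtain a b where ab: "a \<in> C i" "a \<in> A" "b \<in> C i" "b \<in> B" by auto
        have "dist a b \<le> diameter (C i)"
          using C ab by (intro diameter_bounded_bound) (auto simp: fine_cover_def)
        also have "\<dots> \<le> \<delta>" using C by (auto simp: fine_cover_def)
        finally show False using d(2)[OF ab(2,4)] \<delta> by linarith
      qed
      then show "hausdorff_gauge s (CA i) + hausdorff_gauge s (CB i) \<le> hausdorff_gauge s (C i)"
        by (auto simp: CA_def CB_def)
    qed auto
    finally show "hausdorff_premeasure s \<delta> A + hausdorff_premeasure s \<delta> B \<le> (\<Sum>i. hausdorff_gauge s (C i))" .
  qed
  have small: "hausdorff_outer s X = (SUP \<delta>\<in>{0<..<d}. hausdorff_premeasure s \<delta> X)" for X :: "'a set"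
    unfolding hausdorff_outer_def
  proof (rule antisym)
    show "(SUP \<delta>\<in>{0<..}. hausdorff_premeasure s \<delta> X) \<le> (SUP \<delta>\<in>{0<..<d}. hausdorff_premeasure s \<delta> X)"
    proof (rule SUP_mono)
      fix \<delta> :: real assume "\<delta> \<in> {0<..}"
      then show "\<exists>\<delta>'\<in>{0<..<d}. hausdorff_premeasure s \<delta> X \<le> hausdorff_premeasure s \<delta>' X"
        using d(1) by (intro bexI[of _ "min \<delta> (d/2)"] hausdorff_premeasure_antimono) auto
    qed
  qed (auto intro: SUP_subset_mono)
  have "hausdorff_outer s A + hausdorff_outer s B
      = (SUP \<delta>\<in>{0<..<d}. hausdorff_premeasure s \<delta> A + hausdorff_premeasure s \<delta> B)"
    unfolding small
  proof (rule SUP_add_directed_ennreal[symmetric])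
    fix x y assume "x \<in> {0<..<d}" "y \<in> {0<..<d}"
    then show "\<exists>k\<in>{0<..<d}. hausdorff_premeasure s x A + hausdorff_premeasure s y B
        \<le> hausdorff_premeasure s k A + hausdorff_premeasure s k B"
      by (intro bexI[of _ "min x y"] add_mono hausdorff_premeasure_antimono) auto
  qed
  also have "\<dots> \<le> hausdorff_outer s (A \<union> B)"
    unfolding small
  proof (rule SUP_mono)
    fix \<delta> :: real assume "\<delta> \<in> {0<..<d}"
    then show "\<exists>m\<in>{0<..<d}. hausdorff_premeasure s \<delta> A + hausdorff_premeasure s \<delta> B
        \<le> hausdorff_premeasure s m (A \<union> B)"
      using pre[of \<delta>] by (intro bexI[of _ \<delta>]) auto
  qed
  finally show ?thesis .
qed

lemma ennreal_tail_le:
  fixes f :: "nat \<Rightarrow> ennreal"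
  assumes "(\<Sum>i. f i) < top" "0 < (e::real)"
  obtains n where "(\<Sum>i. f (i + n)) \<le> ennreal e"
proof -
  have fin: "f i < top" for i using assms(1) ennreal_suminf_lessD by blast
  define g where "g i = enn2real (f i)" for i
  have fg: "f i = ennreal (g i)" and g0: "0 \<le> g i" for i
    using fin by (auto simp: g_def)
  have sg: "summable g"
    using assms(1) unfolding fg by (intro summable_suminf_not_top g0) auto
  obtain n where "norm (\<Sum>i. g (i + n)) < e"
    using suminf_exist_split[OF assms(2) sg] by auto
  moreover have "(\<Sum>i. f (i + n)) = ennreal (\<Sum>i. g (i + n))"
    unfolding fg using g0 sg by (intro suminf_ennreal2) (auto simp: summable_iff_shift)
  ultimately show ?thesis by (intro that[of n]) (auto intro: ennreal_leI)
qed

text \<open>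
  Caratheodory's criterion. The points of \<open>X - F\<close> are sorted into shells by their distance to \<open>F\<close>. Shells
  that are not neighbours have positive distance, so the even shells and the odd shells each have total
  outer measure at most \<open>\<mu> X\<close>. Hence the shells form a convergent series, and up to a small tail
  \<open>X - F\<close> is a set at positive distance from \<open>F\<close>, to which additivity applies.
\<close>

lemma metric_outer_measure_closed:
  fixes \<mu> :: "'a::metric_space set \<Rightarrow> ennreal"
  assumes om: "outer_measure_space (Pow UNIV) \<mu>"
    and met: "\<And>A B d. 0 < d \<Longrightarrow> (\<And>a b. a \<in> A \<Longrightarrow> b \<in> B \<Longrightarrow> d \<le> dist a b) \<Longrightarrow> \<mu> A + \<mu> B \<le> \<mu> (A \<union> B)"
    and F: "closed F"
  shows "F \<in> lambda_system UNIV (Pow UNIV) \<mu>"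
proof (cases "F = {}")
  case True
  then show ?thesis using om by (auto simp: lambda_system_def outer_measure_space_def positive_def)
next
  case ne: False
  have mono: "\<mu> A \<le> \<mu> B" if "A \<subseteq> B" for A B
    using om that by (auto simp: outer_measure_space_def increasing_def)
  have empty: "\<mu> {} = 0" using om by (auto simp: outer_measure_space_def positive_def)
  have sub: "\<mu> (\<Union>i. A i) \<le> (\<Sum>i. \<mu> (A i))" for A :: "nat \<Rightarrow> 'a set"
  proof -
    have "\<mu> (\<Union>i. A i) = \<mu> (\<Union>i. disjointed A i)" by (simp add: UN_disjointed_eq)
    also have "\<dots> \<le> (\<Sum>i. \<mu> (disjointed A i))"
      using om disjoint_family_disjointed[of A]
      by (auto simp: outer_measure_space_def countably_subadditive_def)
    also have "\<dots> \<le> (\<Sum>i. \<mu> (A i))" by (intro suminf_le mono disjointed_subset) auto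
    finally show ?thesis .
  qed
  have sub2: "\<mu> (A \<union> B) \<le> \<mu> A + \<mu> B" for A B
  proof -
    have "\<mu> (A \<union> B) = \<mu> (\<Union>i. binaryset A B i)" by (simp add: UN_binaryset_eq)
    also have "\<dots> \<le> (\<Sum>i. \<mu> (binaryset A B i))" by (rule sub)
    also have "\<dots> = \<mu> A + \<mu> B" using empty by (intro suminf_binaryset_eq) auto
    finally show ?thesis .
  qed
  have main: "\<mu> (F \<inter> X) + \<mu> (X - F) \<le> \<mu> X" for X
  proof (cases "\<mu> X = top")
    case False
    define A where "A n = {x \<in> X. 1 / (real n + 1) \<le> infdist x F}" for n :: nat
    \<comment> \<open>The shell of points at distance between 1/(n+2) and 1/(n+1) from F.\<close>
    define R where "R n = A (Suc n) - A n" for n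
    have Rsub: "R n \<subseteq> X" for n by (auto simp: R_def A_def)
    have Rlow: "1 / (real n + 2) \<le> infdist x F" and Rup: "infdist x F < 1 / (real n + 1)"
      if "x \<in> R n" for x n
      using that by (auto simp: R_def A_def algebra_simps)
    have sep: "(\<Sum>j<K. \<mu> (R (2 * j + i))) \<le> \<mu> (\<Union>j<K. R (2 * j + i))" for K i
    proof (induction K)
      case (Suc K)
      have "\<mu> (\<Union>j<K. R (2 * j + i)) + \<mu> (R (2 * K + i))
          \<le> \<mu> ((\<Union>j<K. R (2 * j + i)) \<union> R (2 * K + i))"
      proof (rule met)
        have pos: "0 < 1 / (2 * real K + real i) - 1 / (2 * real K + real i + 1)" if "0 < K"
          using that divide_strict_left_mono[of "2 * real K + real i" "2 * real K + real i + 1" 1]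
          by (simp add: add_pos_nonneg)
        \<comment> \<open>A lower bound for the distance of the last shell to the previous ones of equal parity; for
          K = 0 there are none, and any positive number serves.\<close>
        show "0 < (if K = 0 then 1 else 1 / (2 * real K + real i) - 1 / (2 * real K + real i + 1))"
          using pos by auto
        fix a b assume a: "a \<in> (\<Union>j<K. R (2 * j + i))" and b: "b \<in> R (2 * K + i)"
        then obtain j where j: "j < K" "a \<in> R (2 * j + i)" by auto
        have "1 / (2 * real K + real i) \<le> 1 / (real (2 * j + i) + 2)"
          using j(1) by (intro divide_left_mono) auto
        also have "\<dots> \<le> infdist a F" using Rlow[OF j(2)] .
        finally have "1 / (2 * real K + real i) \<le> infdist a F" .
        moreover have "infdist b F < 1 / (2 * real K + real i + 1)" using Rup[OF b] by simp
        moreover have "infdist a F \<le> infdist b F + dist a b" by (rule infdist_triangle)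
        ultimately show "(if K = 0 then 1 else 1 / (2 * real K + real i) - 1 / (2 * real K + real i + 1)) \<le> dist a b"
          using j(1) by auto
      qed
      moreover have "(\<Union>j<Suc K. R (2 * j + i)) = (\<Union>j<K. R (2 * j + i)) \<union> R (2 * K + i)"
        by (auto simp: less_Suc_eq)
      ultimately show ?case using Suc
        by simp (meson add_right_mono order_trans)
    qed (simp add: empty)
    have half: "(\<Sum>j. \<mu> (R (2 * j + i))) \<le> \<mu> X" for i
    proof (rule suminf_le_const)
      fix K
      show "(\<Sum>j<K. \<mu> (R (2 * j + i))) \<le> \<mu> X"
        using sep[where K = K and i = i] mono[of "\<Union>j<K. R (2 * j + i)" X] Rsub by (meson UN_least order_trans)
    qed auto
    have "(\<Sum>n. \<mu> (R n)) \<le> \<mu> X + \<mu> X"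
    proof (rule suminf_le_const)
      fix K
      have "(\<Sum>n<K. \<mu> (R n)) \<le> (\<Sum>n<2 * K. \<mu> (R n))" by (intro sum_mono2) auto
      also have "\<dots> = (\<Sum>j<K. \<mu> (R (2 * j + 0))) + (\<Sum>j<K. \<mu> (R (2 * j + 1)))"
        by (induction K) (auto simp: algebra_simps)
      also have "\<dots> \<le> \<mu> X + \<mu> X"
        by (intro add_mono order_trans[OF sum_le_suminf half]) auto
      finally show "(\<Sum>n<K. \<mu> (R n)) \<le> \<mu> X + \<mu> X" .
    qed auto
    then have Rfin: "(\<Sum>n. \<mu> (R n)) < top" using False by (auto simp: less_top[symmetric] top_unique)
    show ?thesis
    proof (rule ennreal_le_epsilon)
      fix e :: real assume e: "0 < e"
      obtain n where n: "(\<Sum>i. \<mu> (R (i + n))) \<le> ennreal e" by (rule ennreal_tail_le[OF Rfin e])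
      have "X - F \<subseteq> A n \<union> (\<Union>i. R (i + n))"
      proof
        fix x assume x: "x \<in> X - F"
        have "0 < infdist x F"
          using x F ne in_closed_iff_infdist_zero infdist_nonneg[of x F] by (metis DiffE less_eq_real_def)
        then obtain k :: nat where k: "1 / (real k + 1) \<le> infdist x F"
          by (metis less_imp_le nat_approx_posE of_nat_Suc add.commute)
        show "x \<in> A n \<union> (\<Union>i. R (i + n))"
        proof (cases "x \<in> A n")
          case nA: False
          define k0 where "k0 = (LEAST k. x \<in> A k)"
          have xk: "x \<in> A k" using k x by (simp add: A_def)
          then have k0: "x \<in> A k0" unfolding k0_def by (rule LeastI)
          have Amono: "A p \<subseteq> A q" if "p \<le> q" for p q
          proof -
            have le: "1 / (real q + 1) \<le> 1 / (real p + 1)" using that by (simp add: frac_le)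
            show ?thesis
            proof
              fix x assume "x \<in> A p"
              then have "x \<in> X" "1 / (real p + 1) \<le> infdist x F" by (simp_all only: A_def mem_Collect_eq)
              then show "x \<in> A q"
                unfolding A_def mem_Collect_eq using le by (blast intro: order_trans)
            qed
          qed
          have "n < k0"
          proof (rule ccontr)
            assume "\<not> n < k0"
            then show False using Amono[of k0 n] k0 nA by auto
          qed
          then obtain i where i: "k0 = Suc (i + n)" using less_imp_Suc_add[of n k0] by (auto simp: add.commute)
          have "x \<notin> A (i + n)" using i not_less_Least[of "i + n" "\<lambda>k. x \<in> A k"] unfolding k0_def by simp
          then show ?thesis using k0 i by (auto simp: R_def)
        qed auto
      qed
      then have "\<mu> (X - F) \<le> \<mu> (A n \<union> (\<Union>i. R (i + n)))" by (rule mono)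
      also have "\<dots> \<le> \<mu> (A n) + \<mu> (\<Union>i. R (i + n))" by (rule sub2)
      also have "\<dots> \<le> \<mu> (A n) + (\<Sum>i. \<mu> (R (i + n)))" by (intro add_left_mono sub)
      also have "\<dots> \<le> \<mu> (A n) + ennreal e" using n by (intro add_left_mono)
      finally have "\<mu> (F \<inter> X) + \<mu> (X - F) \<le> \<mu> (F \<inter> X) + \<mu> (A n) + ennreal e"
        by (simp add: add.assoc add_left_mono)
      also have "\<mu> (F \<inter> X) + \<mu> (A n) \<le> \<mu> (F \<inter> X \<union> A n)"
      proof (rule met[of "1 / (real n + 1)"])
        fix a b assume "a \<in> F \<inter> X" "b \<in> A n"
        then show "1 / (real n + 1) \<le> dist a b"
          using infdist_le[of a F b] by (auto simp: A_def dist_commute)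
      qed auto
      then have "\<mu> (F \<inter> X) + \<mu> (A n) \<le> \<mu> X"
        by (rule order_trans) (auto intro!: mono simp: A_def)
      then have "\<mu> (F \<inter> X) + \<mu> (A n) + ennreal e \<le> \<mu> X + ennreal e" by (rule add_right_mono)
      finally show "\<mu> (F \<inter> X) + \<mu> (X - F) \<le> \<mu> X + ennreal e" .
    qed
  qed auto
  have "\<mu> (F \<inter> X) + \<mu> ((UNIV - F) \<inter> X) = \<mu> X" for X
  proof (rule antisym)
    show "\<mu> (F \<inter> X) + \<mu> ((UNIV - F) \<inter> X) \<le> \<mu> X" using main[of X] by (simp add: Diff_Int_distrib2 Int_commute Diff_eq)
    have "X = F \<inter> X \<union> ((UNIV - F) \<inter> X)" by auto
    then show "\<mu> X \<le> \<mu> (F \<inter> X) + \<mu> ((UNIV - F) \<inter> X)" using sub2 by metis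
  qed
  then show ?thesis by (auto simp: lambda_system_def)
qed

lemma hausdorff_outer_measure_space:
  "measure_space UNIV (sets borel) (hausdorff_outer s :: 'a::metric_space set \<Rightarrow> ennreal)"
proof -
  let ?L = "lambda_system UNIV (Pow UNIV) (hausdorff_outer s :: 'a set \<Rightarrow> ennreal)"
  interpret S: sigma_algebra "UNIV :: 'a set" "Pow UNIV" by (rule sigma_algebra_Pow)
  have ms: "measure_space UNIV ?L (hausdorff_outer s)"
    by (rule S.caratheodory_lemma[OF hausdorff_outer_space])
  then have sa: "sigma_algebra UNIV ?L" by (simp add: measure_space_def)
  have "F \<in> ?L" if "closed F" for F :: "'a set"
    by (rule metric_outer_measure_closed[OF hausdorff_outer_space hausdorff_outer_metric that])
  then have "sigma_sets UNIV (Collect closed) \<subseteq> ?L"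
    by (intro sigma_algebra.sigma_sets_subset[OF sa]) auto
  then have "sets borel \<subseteq> ?L"
    by (simp add: borel_eq_closed)
  then show ?thesis
    using measure_down[OF ms, of "sets borel"] sets.sigma_algebra_axioms[of "borel :: 'a measure"] by simp
qed

lemma sets_hausdorff_measure [simp, measurable_cong]: "sets (hausdorff_measure s) = sets borel"
  unfolding hausdorff_measure_def
  using sets.sigma_sets_eq[of borel] by (simp add: sets_measure_of_conv)

lemma space_hausdorff_measure [simp]: "space (hausdorff_measure s) = UNIV"
  unfolding hausdorff_measure_def by (simp add: space_measure_of_conv)

lemma emeasure_hausdorff_measure:
  "A \<in> sets borel \<Longrightarrow> emeasure (hausdorff_measure s) A = hausdorff_outer s A"
  unfolding hausdorff_measure_def
  using hausdorff_outer_measure_space[of s]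
  by (intro emeasure_measure_of_sigma) (auto simp: measure_space_def)

section \<open>Lebesgue measure under isometries and dilations\<close>

text \<open>
  Uniqueness of translation invariant measures: integrate the indicator of
  \<open>{(x, y). x \<in> A, \<bar>x - y\<bar> < 1}\<close> for \<open>\<mu> \<otimes> lborel\<close> in both orders.
\<close>

lemma translation_invariant_eq_lborel:
  fixes \<mu> :: "'a::euclidean_space measure"
  assumes sets [measurable_cong]: "sets \<mu> = sets borel"
    and sf: "sigma_finite_measure \<mu>"
    and trans: "\<And>a. distr \<mu> borel (\<lambda>x. a + x) = \<mu>"
    and ball: "emeasure \<mu> (ball 0 1) = emeasure lborel (ball (0::'a) 1)"
  shows "\<mu> = lborel"
proof (rule measure_eqI)
  show "sets \<mu> = sets lborel" using sets by simp
  fix A assume "A \<in> sets \<mu>"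
  then have [measurable]: "A \<in> sets borel" using sets by simp
  interpret M: sigma_finite_measure \<mu> by (fact sf)
  interpret P: pair_sigma_finite \<mu> lborel ..
  let ?B = "ball (0::'a) 1"
  have lb: "(\<integral>\<^sup>+y. indicator A x * indicator ?B (x - y) \<partial>lborel)
        = indicator A x * emeasure lborel ?B" for x :: 'a
  proof -
    have "(\<integral>\<^sup>+y. indicator ?B (x - y) \<partial>lborel) = (\<integral>\<^sup>+y. indicator (ball x 1) y \<partial>lborel)"
      by (intro nn_integral_cong) (auto simp: indicator_def dist_norm norm_minus_commute)
    also have "\<dots> = emeasure lborel (ball x 1)" by simp
    also have "\<dots> = emeasure lborel ?B"
      by (simp add: emeasure_ball)
    finally have "(\<integral>\<^sup>+y. indicator ?B (x - y) \<partial>lborel) = emeasure lborel ?B" .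
    then show ?thesis by (subst nn_integral_cmult) (measurable, auto)
  qed
  have tr: "(\<integral>\<^sup>+x. f (a + x) \<partial>\<mu>) = (\<integral>\<^sup>+x. f x \<partial>\<mu>)"
    if [measurable]: "f \<in> borel_measurable borel" for f :: "'a \<Rightarrow> ennreal" and a
  proof -
    have "(\<integral>\<^sup>+x. f x \<partial>\<mu>) = (\<integral>\<^sup>+x. f x \<partial>distr \<mu> borel (\<lambda>x. a + x))" by (simp add: trans)
    also have "\<dots> = (\<integral>\<^sup>+x. f (a + x) \<partial>\<mu>)" by (subst nn_integral_distr) auto
    finally show ?thesis ..
  qed
  have "emeasure \<mu> A * emeasure lborel ?B = (\<integral>\<^sup>+x. indicator A x * emeasure lborel ?B \<partial>\<mu>)"
    by (subst nn_integral_multc) (auto simp: sets)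
  also have "\<dots> = (\<integral>\<^sup>+x. \<integral>\<^sup>+y. indicator A x * indicator ?B (x - y) \<partial>lborel \<partial>\<mu>)"
    by (simp add: lb)
  also have "\<dots> = (\<integral>\<^sup>+y. \<integral>\<^sup>+x. indicator A x * indicator ?B (x - y) \<partial>\<mu> \<partial>lborel)"
    by (subst P.Fubini') (measurable, auto)
  also have "\<dots> = (\<integral>\<^sup>+y. \<integral>\<^sup>+x. indicator A (y + x) * indicator ?B x \<partial>\<mu> \<partial>lborel)"
  proof (rule nn_integral_cong)
    fix y :: 'a
    have m: "(\<lambda>x. indicator A x * indicator ?B (x - y) :: ennreal) \<in> borel_measurable borel"
      by (measurable, auto)
    show "(\<integral>\<^sup>+x. indicator A x * indicator ?B (x - y) \<partial>\<mu>)
        = (\<integral>\<^sup>+x. indicator A (y + x) * indicator ?B x \<partial>\<mu>)"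
      using tr[OF m, of y] by simp
  qed
  also have "\<dots> = (\<integral>\<^sup>+x. \<integral>\<^sup>+y. indicator A (y + x) * indicator ?B x \<partial>lborel \<partial>\<mu>)"
    by (subst P.Fubini') (measurable, auto)
  also have "\<dots> = (\<integral>\<^sup>+x. emeasure lborel A * indicator ?B x \<partial>\<mu>)"
  proof (rule nn_integral_cong)
    fix x :: 'a
    have "(\<integral>\<^sup>+y. indicator A (y + x) \<partial>lborel) = (\<integral>\<^sup>+y. indicator A y \<partial>distr lborel borel ((+) x))"
      by (subst nn_integral_distr) (auto simp: add.commute)
    also have "\<dots> = emeasure lborel A"
      by (simp add: lborel_distr_plus)
    finally show "(\<integral>\<^sup>+y. indicator A (y + x) * indicator ?B x \<partial>lborel) = emeasure lborel A * indicator ?B x"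
      by (simp add: nn_integral_multc)
  qed
  also have "\<dots> = emeasure lborel A * emeasure \<mu> ?B"
    by (subst nn_integral_cmult_indicator) (auto simp: sets)
  finally have "emeasure \<mu> A * emeasure lborel ?B = emeasure lborel A * emeasure lborel ?B"
    by (simp add: ball)
  moreover have "emeasure lborel ?B \<noteq> 0" "emeasure lborel ?B \<noteq> \<infinity>"
    using less_imp_neq[OF unit_ball_vol_pos[of "real DIM('a)"]] by (simp_all add: emeasure_ball)
  ultimately show "emeasure \<mu> A = emeasure lborel A"
    by (metis ennreal_mult_cancel_left infinity_ennreal_def mult.commute)
qed

text \<open>
  The image measure is again translation invariant and gives the unit ball the same volume.
\<close>

lemma isometry_onto_distr_lborel:
  fixes T :: "'a::euclidean_space \<Rightarrow> 'b::euclidean_space"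
  assumes lin: "linear T" and iso: "\<And>x. norm (T x) = norm x" and surj: "surj T"
  shows "distr lborel borel T = lborel"
proof -
  have [measurable]: "T \<in> borel_measurable borel"
    using lin by (intro borel_measurable_continuous_onI linear_continuous_on linear_conv_bounded_linear[THEN iffD1])
  have inj: "inj T"
    using lin iso by (metis linear_injective_0 norm_eq_zero)
  have dim: "DIM('a) = DIM('b)"
    using lin inj surj by (metis dim_UNIV dim_image_eq inj_on_subset subset_UNIV)
  obtain S where S: "linear S" "S \<circ> T = id" using linear_injective_left_inverse[OF lin inj] by blast
  have TS: "T (S y) = y" for y using surj S(2) by (metis comp_eq_dest_lhs id_apply surjD)
  show ?thesis
  proof (rule translation_invariant_eq_lborel)
    show "sets (distr lborel borel T) = sets borel" by simp
    have "T -` ball 0 r = ball 0 r" for r using iso by auto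
    then have b: "emeasure (distr lborel borel T) (ball 0 r) = emeasure lborel (ball (0::'a) r)" for r
      by (subst emeasure_distr) auto
    show "emeasure (distr lborel borel T) (ball 0 1) = emeasure lborel (ball (0::'b) 1)"
      by (simp add: b emeasure_ball dim)
    show "sigma_finite_measure (distr lborel borel T)"
    proof
      show "\<exists>A. countable A \<and> A \<subseteq> sets (distr lborel borel T) \<and> \<Union> A = space (distr lborel borel T)
          \<and> (\<forall>a\<in>A. emeasure (distr lborel borel T) a \<noteq> \<infinity>)"
      proof (intro exI[of _ "range (\<lambda>n::nat. ball 0 (real n))"] conjI)
        show "\<Union> (range (\<lambda>n. ball 0 (real n))) = space (distr lborel borel T)"
          using reals_Archimedean2 by auto
        show "\<forall>a\<in>range (\<lambda>n. ball 0 (real n)). emeasure (distr lborel borel T) a \<noteq> \<infinity>"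
          using b emeasure_lborel_ball_finite by (auto simp: less_top[symmetric])
      qed auto
    qed
    fix a :: 'b
    have "distr (distr lborel borel T) borel (\<lambda>x. a + x) = distr lborel borel (\<lambda>x. a + T x)"
      by (subst distr_distr) (auto simp: comp_def)
    also have "(\<lambda>x. a + T x) = T \<circ> (\<lambda>x. S a + x)"
      using TS lin by (auto simp: linear_add fun_eq_iff)
    also have "distr lborel borel (T \<circ> (\<lambda>x. S a + x)) = distr (distr lborel borel (\<lambda>x. S a + x)) borel T"
      by (subst distr_distr) auto
    also have "distr lborel borel (\<lambda>x. S a + x) = lborel"
      using lborel_distr_plus[of "S a"] by simp
    finally show "distr (distr lborel borel T) borel (\<lambda>x. a + x) = distr lborel borel T" .
  qed
qed

lemma distr_lborel_orthogonal:
  fixes T :: "'a::euclidean_space \<Rightarrow> 'a"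
  assumes "orthogonal_transformation T"
  shows "distr lborel borel T = lborel"
  using assms
  by (intro isometry_onto_distr_lborel)
     (auto simp: orthogonal_transformation_surj orthogonal_transformation_norm
       orthogonal_transformation_linear)

lemma emeasure_lborel_image_scaleR:
  fixes A :: "'a::euclidean_space set"
  assumes r: "0 < r" and A: "A \<in> sets borel"
  shows "emeasure lborel ((\<lambda>x. r *\<^sub>R x) -` A) = ennreal ((1/r) ^ DIM('a)) * emeasure lborel A"
proof -
  have [measurable]: "(\<lambda>x::'a. r *\<^sub>R x) \<in> borel_measurable borel" by measurable
  have V: "(\<lambda>x. r *\<^sub>R x) -` A \<in> sets borel"
    using measurable_sets[of "\<lambda>x::'a. r *\<^sub>R x" borel borel A] A by simp
  have "emeasure lborel A = emeasure (density (distr lborel borel (\<lambda>x. 0 + r *\<^sub>R x)) (\<lambda>_. \<bar>r\<bar> ^ DIM('a))) A"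
    using lborel_affine[of r "0::'a"] r by simp
  also have "\<dots> = \<bar>r\<bar> ^ DIM('a) * emeasure (distr lborel borel (\<lambda>x. 0 + r *\<^sub>R x)) A"
    using A by (subst emeasure_density) (auto simp: nn_integral_cmult_indicator)
  also have "emeasure (distr lborel borel (\<lambda>x. 0 + r *\<^sub>R x)) A = emeasure lborel ((\<lambda>x. r *\<^sub>R x) -` A)"
    using A by (subst emeasure_distr) auto
  finally show ?thesis using r
    by (simp add: mult.assoc[symmetric] ennreal_mult[symmetric] power_mult_distrib[symmetric])
qed

lemma emeasure_cone_scale:
  fixes Q :: "'a::euclidean_space \<Rightarrow> bool"
  assumes Q: "{x. Q x} \<in> sets borel" "\<And>x r. 0 < r \<Longrightarrow> Q (r *\<^sub>R x) = Q x" and r: "0 < r"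
  shows "emeasure lborel {x. norm x < r \<and> Q x} = ennreal (r ^ DIM('a)) * emeasure lborel {x. norm x < 1 \<and> Q x}"
proof -
  have "(\<lambda>x. (1/r) *\<^sub>R x) -` {x. norm x < 1 \<and> Q x} = {x. norm x < r \<and> Q x}"
    using r Q(2)[of "1/r"] by auto
  moreover have "{x. norm x < 1 \<and> Q x} \<in> sets borel"
  proof -
    have "{x. norm x < 1 \<and> Q x} = ball 0 1 \<inter> {x. Q x}" by auto
    then show ?thesis using Q(1) by simp
  qed
  ultimately show ?thesis using emeasure_lborel_image_scaleR[of "1/r" "{x. norm x < 1 \<and> Q x}"] r by simp
qed

section \<open>Hausdorff measure of subsets of the sphere\<close>

definition thin_cone :: "'a::euclidean_space \<Rightarrow> real \<Rightarrow> 'a set" where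
  "thin_cone w \<epsilon> = {x. norm x < 1 \<and> \<bar>x \<bullet> w\<bar> \<le> \<epsilon> * norm x}"

lemma measure_thin_cone_finite: "emeasure lborel (thin_cone w \<epsilon>) < \<infinity>"
proof -
  have "emeasure lborel (thin_cone w \<epsilon>) \<le> emeasure lborel (ball (0::'a) 1)"
    by (intro emeasure_mono) (auto simp: thin_cone_def)
  also have "\<dots> < \<infinity>" by (rule emeasure_lborel_ball_finite)
  finally show ?thesis .
qed

text \<open>
  A packing bound. Balls of radius \<open>\<epsilon>/2\<close> about the points of \<open>Q\<close> are disjoint and lie in the part of the
  cone \<open>\<bar>x \<bullet> w\<bar> \<le> \<epsilon> \<bar>x\<bar>\<close> with \<open>1 - \<epsilon>/2 < \<bar>x\<bar> < 1 + \<epsilon>/2\<close>, whose volume is of order \<open>\<epsilon>\<close> times that of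
  the cone.
\<close>

lemma separated_card_bound:
  fixes w :: "'a::euclidean_space"
  assumes e: "0 < \<epsilon>" "\<epsilon> \<le> 1" and w: "norm w \<le> 1"
    and Q: "finite Q" "Q \<subseteq> {x \<in> sphere 0 1. x \<bullet> w = 0}"
      "\<And>p q. p \<in> Q \<Longrightarrow> q \<in> Q \<Longrightarrow> p \<noteq> q \<Longrightarrow> \<epsilon> \<le> dist p q"
  shows "real (card Q) * \<epsilon> ^ (DIM('a) - 1)
     \<le> (real DIM('a) * 4 ^ DIM('a) / unit_ball_vol (real DIM('a))) * measure lborel (thin_cone w \<epsilon>)"
proof -
  let ?n = "DIM('a)" and ?L = "measure lborel (thin_cone w \<epsilon>)" and ?\<omega> = "unit_ball_vol (real DIM('a))"
  have w0: "0 < ?\<omega>" and wn: "?\<omega> \<noteq> 0" using less_imp_neq[OF unit_ball_vol_pos[of "real DIM('a)"]] by simp_all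
  let ?C = "\<lambda>r. {x::'a. norm x < r \<and> \<bar>x \<bullet> w\<bar> \<le> \<epsilon> * norm x}"
  \<comment> \<open>The inner and outer radius of the shell that contains the balls.\<close>
  define a b where "a = 1 - \<epsilon>/2" and "b = 1 + \<epsilon>/2"
  have ab: "1/2 \<le> a" "a < b" "b \<le> 2" using e by (auto simp: a_def b_def)
  have meas: "?C r \<in> sets borel" for r by measurable
  have scale: "emeasure lborel (?C r) = ennreal (r ^ ?n) * emeasure lborel (thin_cone w \<epsilon>)" if "0 < r" for r
    unfolding thin_cone_def using that
    by (intro emeasure_cone_scale) (auto simp: abs_mult)
  have L: "emeasure lborel (thin_cone w \<epsilon>) = ennreal ?L"
    using measure_thin_cone_finite[of w \<epsilon>] by (intro emeasure_eq_ennreal_measure) auto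
  have scale': "emeasure lborel (?C r) = ennreal (r ^ ?n * ?L)" if "0 < r" for r
    using scale[OF that] that by (simp add: L ennreal_mult)
  have "ennreal (real (card Q) * (?\<omega> * (\<epsilon>/2) ^ ?n)) = (\<Sum>p\<in>Q. emeasure lborel (ball p (\<epsilon>/2)))"
    using e w0 by (simp add: emeasure_ball ennreal_mult' ennreal_of_nat_eq_real_of_nat)
  also have "\<dots> = emeasure lborel (\<Union>p\<in>Q. ball p (\<epsilon>/2))"
  proof (rule sum_emeasure)
    show "disjoint_family_on (\<lambda>p. ball p (\<epsilon>/2)) Q"
      unfolding disjoint_family_on_def
    proof (intro ballI impI)
      fix p q assume "p \<in> Q" "q \<in> Q" "p \<noteq> q"
      then have "\<epsilon> \<le> dist p q" by (rule Q(3))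
      then show "ball p (\<epsilon>/2) \<inter> ball q (\<epsilon>/2) = {}"
        by (intro disjoint_ballI) simp
    qed
  qed (use Q(1) in auto)
  also have "\<dots> \<le> emeasure lborel (?C b - ?C a)"
  proof (rule emeasure_mono)
    show "?C b - ?C a \<in> sets lborel" using meas by simp
    show "(\<Union>p\<in>Q. ball p (\<epsilon>/2)) \<subseteq> ?C b - ?C a"
    proof clarify
      fix p x assume p: "p \<in> Q" and x: "x \<in> ball p (\<epsilon>/2)"
      have np: "norm p = 1" "p \<bullet> w = 0" using p Q(2) by auto
      have d: "norm (x - p) < \<epsilon>/2" using x by (simp add: dist_norm norm_minus_commute)
      have n1: "norm x < b"
        using norm_triangle_sub[of x p] d np by (simp add: b_def)
      have n2: "a < norm x"
        using norm_triangle_sub[of p x] d np by (simp add: a_def norm_minus_commute)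
      have "\<bar>x \<bullet> w\<bar> = \<bar>(x - p) \<bullet> w\<bar>" using np by (simp add: inner_diff_left)
      also have "\<dots> \<le> norm (x - p) * norm w" by (rule Cauchy_Schwarz_ineq2)
      also have "\<dots> \<le> norm (x - p) * 1" using w by (intro mult_left_mono) auto
      also have "\<dots> \<le> \<epsilon> * (1/2)" using d by simp
      also have "\<dots> \<le> \<epsilon> * norm x" using n2 ab e by (intro mult_left_mono) auto
      finally show "x \<in> ?C b - ?C a" using n1 n2 by auto
    qed
  qed
  also have "\<dots> = emeasure lborel (?C b) - emeasure lborel (?C a)"
    using meas ab scale'[of a] by (intro emeasure_Diff) auto
  also have "\<dots> = ennreal (b ^ ?n * ?L - a ^ ?n * ?L)"
    using scale'[of a] scale'[of b] ab by (simp add: ennreal_minus)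
  finally have "real (card Q) * (?\<omega> * (\<epsilon>/2) ^ ?n) \<le> (b ^ ?n - a ^ ?n) * ?L"
    using ab by (subst (asm) ennreal_le_iff) (auto simp: left_diff_distrib intro!: mult_right_mono power_mono)
  also have "(b ^ ?n - a ^ ?n) * ?L \<le> (\<epsilon> * (real ?n * 2 ^ ?n)) * ?L"
  proof (rule mult_right_mono)
    have "(\<Sum>i<?n. a ^ (?n - Suc i) * b ^ i) \<le> (\<Sum>i<?n. 2 ^ ?n)"
    proof (rule sum_mono)
      fix i assume i: "i \<in> {..<?n}"
      have "a ^ (?n - Suc i) * b ^ i \<le> 2 ^ (?n - Suc i) * 2 ^ i"
        using ab by (intro mult_mono power_mono) auto
      also have "\<dots> = 2 ^ (?n - Suc i + i)" by (simp add: power_add)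
      also have "\<dots> \<le> (2::real) ^ ?n" using i by (intro power_increasing) auto
      finally show "a ^ (?n - Suc i) * b ^ i \<le> 2 ^ ?n" .
    qed
    then have "(b - a) * (\<Sum>i<?n. a ^ (?n - Suc i) * b ^ i) \<le> (b - a) * (\<Sum>i<?n. 2 ^ ?n)"
      using ab by (intro mult_left_mono) auto
    also have "(b - a) * (\<Sum>i<?n. a ^ (?n - Suc i) * b ^ i) = b ^ ?n - a ^ ?n"
      by (rule power_diff_sumr2[symmetric])
    also have "(b - a) * (\<Sum>i<?n. 2 ^ ?n) = \<epsilon> * (real ?n * 2 ^ ?n)" by (simp add: a_def b_def)
    finally show "b ^ ?n - a ^ ?n \<le> \<epsilon> * (real ?n * 2 ^ ?n)" .
  qed simp
  finally have *: "real (card Q) * (?\<omega> * (\<epsilon>/2) ^ ?n) \<le> \<epsilon> * (real ?n * 2 ^ ?n) * ?L" .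
  have en: "\<epsilon> ^ ?n = \<epsilon> * \<epsilon> ^ (?n - 1)" by (simp add: power_eq_if)
  have "real (card Q) * \<epsilon> ^ (?n - 1) = (real (card Q) * (?\<omega> * (\<epsilon>/2) ^ ?n)) * (2 ^ ?n / (?\<omega> * \<epsilon>))"
    using wn e by (simp add: power_divide en)
  also have "\<dots> \<le> (\<epsilon> * (real ?n * 2 ^ ?n) * ?L) * (2 ^ ?n / (?\<omega> * \<epsilon>))"
    using w0 e by (intro mult_right_mono[OF *]) auto
  also have "\<dots> = (real ?n * 4 ^ ?n / ?\<omega>) * ?L"
    using wn e by (simp add: power_mult_distrib[symmetric])
  finally show ?thesis .
qed

text \<open>
  Cover by balls of radius \<open>e\<close> about a maximal \<open>e\<close>-separated set; its cardinality is controlled by the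
  packing bound. For \<open>w = 0\<close> the set is the whole sphere and the cone is the unit ball; for \<open>w \<noteq> 0\<close> the
  volume of the cone tends to zero with \<open>\<epsilon>\<close>.
\<close>

lemma hausdorff_outer_great_subsphere_le:
  fixes w :: "'a::euclidean_space"
  assumes e: "0 < \<epsilon>" "\<epsilon> \<le> 1" and w: "norm w \<le> 1"
  shows "hausdorff_outer (DIM('a) - 1) {x \<in> sphere 0 1. x \<bullet> w = 0}
     \<le> ennreal (unit_ball_vol (real (DIM('a) - 1)) * (real DIM('a) * 4 ^ DIM('a) / unit_ball_vol (real DIM('a)))
          * measure lborel (thin_cone w \<epsilon>))"
    (is "_ \<le> ennreal (?v * ?c * _)")
  unfolding hausdorff_outer_def
proof (rule SUP_least)
  fix \<delta> :: real assume "\<delta> \<in> {0<..}"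
  let ?S = "{x \<in> sphere 0 1. x \<bullet> w = 0}"
  define e where "e = min \<epsilon> (\<delta> / 2)"
  have e: "0 < e" "e \<le> \<epsilon>" "e \<le> 1" "2 * e \<le> \<delta>" using assms \<open>\<delta> \<in> {0<..}\<close> by (auto simp: e_def)
  define sep where "sep Q \<longleftrightarrow> finite Q \<and> Q \<subseteq> ?S \<and> (\<forall>p\<in>Q. \<forall>q\<in>Q. p \<noteq> q \<longrightarrow> e \<le> dist p q)" for Q
  have c0: "0 < ?c" "0 < ?v" using unit_ball_vol_pos by auto
  have bound: "real (card Q) * e ^ (DIM('a) - 1) \<le> ?c * measure lborel (thin_cone w e)" if "sep Q" for Q
    using that e w by (intro separated_card_bound) (auto simp: sep_def)
  \<comment> \<open>The packing bound makes the cardinalities bounded, so a separated set of maximal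
    cardinality exists.\<close>
  define M where "M = ?c * measure lborel (thin_cone w e) / e ^ (DIM('a) - 1)"
  have "card Q \<le> nat \<lceil>M\<rceil>" if "sep Q" for Q
  proof -
    have "real (card Q) \<le> M"
      using bound[OF that] e by (simp add: M_def field_simps)
    then show ?thesis by linarith
  qed
  moreover have "sep {}" by (simp add: sep_def)
  ultimately obtain Q where Q: "sep Q" "\<And>Q'. sep Q' \<Longrightarrow> card Q' \<le> card Q"
    using ex_has_greatest_nat[of sep "{}" card "Suc (nat \<lceil>M\<rceil>)"] by (auto simp: less_Suc_eq_le)
  have cover: "?S \<subseteq> (\<Union>p\<in>Q. cball p e)"
  proof
    fix x assume x: "x \<in> ?S"
    show "x \<in> (\<Union>p\<in>Q. cball p e)"
    proof (rule ccontr)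
      assume "x \<notin> (\<Union>p\<in>Q. cball p e)"
      then have far: "\<And>p. p \<in> Q \<Longrightarrow> e < dist p x" by auto
      then have "sep (insert x Q)" using Q(1) x
        by (auto simp: sep_def dist_commute less_imp_le)
      moreover have "x \<notin> Q" using far e(1) by fastforce
      ultimately show False using Q(2)[of "insert x Q"] Q(1) by (simp add: sep_def)
    qed
  qed
  have fQ: "finite Q" using Q(1) by (simp add: sep_def)
  then obtain f where f: "bij_betw f {..<card Q} Q"
    using ex_bij_betw_nat_finite by (metis atLeast0LessThan)
  define C where "C i = (if i < card Q then cball (f i) e else {})" for i
  have "fine_cover \<delta> ?S C"
    unfolding fine_cover_def
  proof (intro conjI allI)
    show "?S \<subseteq> (\<Union>i. C i)"
      using cover bij_betw_imp_surj_on[OF f] by (force simp: C_def)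
  qed (use e in \<open>auto simp: C_def\<close>)
  then have "hausdorff_premeasure (DIM('a) - 1) \<delta> ?S \<le> (\<Sum>i. hausdorff_gauge (DIM('a) - 1) (C i))"
    by (rule hausdorff_premeasure_le)
  also have "\<dots> = (\<Sum>i<card Q. hausdorff_gauge (DIM('a) - 1) (C i))"
    by (intro suminf_finite) (auto simp: C_def)
  also have "\<dots> = (\<Sum>i<card Q. ennreal (?v * e ^ (DIM('a) - 1)))"
    using e by (intro sum.cong) (auto simp: C_def hausdorff_gauge_def)
  also have "\<dots> = ennreal (?v * (real (card Q) * e ^ (DIM('a) - 1)))"
    using e c0 by (simp add: ennreal_of_nat_eq_real_of_nat ennreal_mult[symmetric] algebra_simps)
  also have "\<dots> \<le> ennreal (?v * (?c * measure lborel (thin_cone w e)))"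
    using bound[OF Q(1)] c0 by (intro ennreal_leI mult_left_mono) auto
  also have "\<dots> \<le> ennreal (?v * (?c * measure lborel (thin_cone w \<epsilon>)))"
  proof (intro ennreal_leI mult_left_mono)
    show "measure lborel (thin_cone w e) \<le> measure lborel (thin_cone w \<epsilon>)"
    proof (rule measure_mono_fmeasurable)
      have "e * norm x \<le> \<epsilon> * norm x" for x :: 'a using e by (intro mult_right_mono) auto
      then show "thin_cone w e \<subseteq> thin_cone w \<epsilon>"
        unfolding thin_cone_def by (auto intro: order_trans)
      show "thin_cone w e \<in> sets lborel" unfolding thin_cone_def by simp
      show "thin_cone w \<epsilon> \<in> fmeasurable lborel"
        using measure_thin_cone_finite[of w \<epsilon>] by (intro fmeasurableI) (auto simp: thin_cone_def)
    qed
  qed (use c0 in auto)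
  finally show "hausdorff_premeasure (DIM('a) - 1) \<delta> ?S
      \<le> ennreal (?v * ?c * measure lborel (thin_cone w \<epsilon>))" by (simp add: mult.assoc)
qed

lemma hausdorff_outer_sphere_finite:
  "hausdorff_outer (DIM('a) - 1) (sphere (0::'a::euclidean_space) 1) < \<infinity>"
  using hausdorff_outer_great_subsphere_le[of 1 "0::'a"]
  by (simp add: sphere_def) (metis ennreal_less_top order_le_less_trans)

lemma hausdorff_outer_great_subsphere:
  fixes w :: "'a::euclidean_space"
  assumes "w \<noteq> 0"
  shows "hausdorff_outer (DIM('a) - 1) {x \<in> sphere 0 1. x \<bullet> w = 0} = 0"
proof -
  define v where "v = w /\<^sub>R norm w"
  have nv: "norm v = 1" "v \<noteq> 0" using assms by (auto simp: v_def)
  have eq: "{x \<in> sphere 0 1. x \<bullet> w = 0} = {x \<in> sphere 0 1. x \<bullet> v = 0}"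
    using assms by (auto simp: v_def)
  let ?K = "unit_ball_vol (real (DIM('a) - 1)) * (real DIM('a) * 4 ^ DIM('a) / unit_ball_vol (real DIM('a)))"
  let ?L = "\<lambda>n::nat. thin_cone v (1 / (real n + 1))"
  have "(\<lambda>n. emeasure lborel (?L n)) \<longlonglongrightarrow> emeasure lborel (\<Inter>n. ?L n)"
  proof (rule Lim_emeasure_decseq)
    show "range ?L \<subseteq> sets lborel" unfolding thin_cone_def by auto
    show "decseq ?L"
    proof (rule decseq_SucI)
      fix n
      have "1 / (real (Suc n) + 1) * norm x \<le> 1 / (real n + 1) * norm x" for x :: 'a
        by (intro mult_right_mono frac_le) auto
      then show "?L (Suc n) \<subseteq> ?L n" unfolding thin_cone_def by (fastforce intro: order_trans)
    qed
    show "emeasure lborel (?L n) \<noteq> \<infinity>" for n using measure_thin_cone_finite by (metis less_irrefl)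
  qed
  moreover have "emeasure lborel (\<Inter>n. ?L n) = 0"
  proof -
    have "(\<Inter>n. ?L n) \<subseteq> {x. v \<bullet> x = 0}"
    proof clarify
      fix x assume x: "x \<in> (\<Inter>n. ?L n)"
      have "\<bar>x \<bullet> v\<bar> \<le> norm x / real (Suc n)" for n
        using x by (auto simp: thin_cone_def add.commute)
      moreover have "(\<lambda>n. norm x / real (Suc n)) \<longlonglongrightarrow> 0"
        by (rule LIMSEQ_Suc[OF lim_const_over_n])
      ultimately have "\<bar>x \<bullet> v\<bar> \<le> 0"
        by (intro LIMSEQ_le_const[of "\<lambda>n. norm x / real (Suc n)" 0]) auto
      then show "v \<bullet> x = 0" by (simp add: inner_commute)
    qed
    moreover have "{x. v \<bullet> x = 0} \<in> null_sets lborel"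
    proof -
      have "closed {x. v \<bullet> x = 0}" by (rule closed_hyperplane)
      then show ?thesis
        using negligible_hyperplane[of v 0] nv
        by (auto simp: negligible_iff_null_sets null_sets_completion_iff)
    qed
    ultimately show ?thesis
      by (metis (no_types, lifting) emeasure_mono le_zero_eq null_setsD1 null_setsD2)
  qed
  ultimately have lim: "(\<lambda>n. emeasure lborel (?L n)) \<longlonglongrightarrow> 0" by simp
  have "(\<lambda>n. ennreal ?K * emeasure lborel (?L n)) \<longlonglongrightarrow> ennreal ?K * 0"
    by (intro ennreal_tendsto_cmult lim) auto
  moreover have "hausdorff_outer (DIM('a) - 1) {x \<in> sphere 0 1. x \<bullet> v = 0} \<le> ennreal ?K * emeasure lborel (?L n)" for n
  proof -
    have "emeasure lborel (?L n) = ennreal (measure lborel (?L n))"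
      using measure_thin_cone_finite[of v "1 / (real n + 1)"] by (intro emeasure_eq_ennreal_measure) simp
    then show ?thesis
      using hausdorff_outer_great_subsphere_le[of "1 / (real n + 1)" v] nv unit_ball_vol_pos
      by (simp add: ennreal_mult'[symmetric] ennreal_mult''[symmetric])
  qed
  ultimately have "hausdorff_outer (DIM('a) - 1) {x \<in> sphere 0 1. x \<bullet> v = 0} \<le> ennreal ?K * 0"
    by (intro LIMSEQ_le_const) auto
  then show ?thesis unfolding eq by simp
qed

text \<open>
  A set of diameter \<open>d\<close> on the sphere spans a cone that is covered by about \<open>1/d\<close> balls of radius
  \<open>2 d\<close> with centres on one radius, so its volume is at most a constant times \<open>d\<close> to the power
  \<open>n - 1\<close>.
\<close>

lemma cone_over_small_set:
  fixes C :: "'a::euclidean_space set"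
  assumes n: "2 \<le> DIM('a)" and C: "bounded C" "diameter C \<le> 1"
  obtains B where "B \<in> sets borel" "{r *\<^sub>R x | r x. 0 \<le> r \<and> r \<le> 1 \<and> x \<in> C \<inter> sphere 0 1} \<subseteq> B"
    "emeasure lborel B \<le> ennreal (2 ^ (2 * DIM('a)) * unit_ball_vol (real DIM('a)) / unit_ball_vol (real (DIM('a) - 1)))
         * hausdorff_gauge (DIM('a) - 1) C"
proof (cases "C \<inter> sphere 0 1 = {}")
  case True
  then show ?thesis by (intro that[of "{}"]) auto
next
  case False
  then obtain p where p: "p \<in> C" "norm p = 1" by auto
  define d where "d = diameter C"
  have d0: "0 \<le> d" "d \<le> 1" using C diameter_ge_0 by (auto simp: d_def)
  have near: "dist p x \<le> d" if "x \<in> C" for x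
    unfolding d_def by (rule diameter_bounded_bound[OF C(1) p(1) that])
  let ?\<omega> = "unit_ball_vol (real DIM('a))" and ?v = "unit_ball_vol (real (DIM('a) - 1))"
  have w0: "0 < ?\<omega>" "0 < ?v" using unit_ball_vol_pos by auto
  show ?thesis
  \<comment> \<open>For d = 0 the cone is a segment, which is null in dimension at least 2.\<close>
  proof (cases "d = 0")
    case True
    have dim: "dim (span {p}) < DIM('a)"
      using dim_le_card'[of "{p}"] n by simp
    have "closed (span {p})" by (rule closed_subspace) (rule subspace_span)
    then have "span {p} \<in> null_sets lborel"
      using negligible_lowdim[OF dim] by (auto simp: negligible_iff_null_sets null_sets_completion_iff)
    then have null: "emeasure lborel (span {p}) = 0" "span {p} \<in> sets borel" by auto
    show ?thesis
    proof (rule that[OF null(2)])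
      show "{r *\<^sub>R x |r x. 0 \<le> r \<and> r \<le> 1 \<and> x \<in> C \<inter> sphere 0 1} \<subseteq> span {p}"
      proof clarify
        fix r :: real and x assume "x \<in> C"
        then have "x = p" using near True by auto
        then show "r *\<^sub>R x \<in> span {p}" by (simp add: span_base span_scale)
      qed
    qed (simp add: null)
  next
    case False
    then have d: "0 < d" using d0 by simp
    define N where "N = nat \<lfloor>1/d\<rfloor>"
    have N: "real N \<le> 1/d" "1/d < real N + 1" using d by (auto simp: N_def)
    let ?B = "\<Union>j\<le>N. cball ((real j * d) *\<^sub>R p) (2 * d)"
    show ?thesis
    proof (rule that[of ?B])
      show "{r *\<^sub>R x |r x. 0 \<le> r \<and> r \<le> 1 \<and> x \<in> C \<inter> sphere 0 1} \<subseteq> ?B"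
      proof clarify
        fix r :: real and x assume r: "0 \<le> r" "r \<le> 1" and x: "x \<in> C"
        define j where "j = nat \<lfloor>r/d\<rfloor>"
        have j: "real j \<le> r/d" "r/d < real j + 1" using d r by (auto simp: j_def)
        have jd: "real j * d \<le> r" "r \<le> real j * d + d" using j d by (simp_all add: field_simps)
        have "r/d \<le> 1/d" using r d by (simp add: divide_right_mono)
        then have "j \<le> N" using floor_mono[of "r/d" "1/d"] by (auto simp: j_def N_def nat_mono)
        have "dist ((real j * d) *\<^sub>R p) (r *\<^sub>R x) \<le> dist ((real j * d) *\<^sub>R p) (r *\<^sub>R p) + dist (r *\<^sub>R p) (r *\<^sub>R x)"
          by (rule dist_triangle)
        also have "\<dots> \<le> d + d"
        proof (rule add_mono)
          have "dist ((real j * d) *\<^sub>R p) (r *\<^sub>R p) = \<bar>real j * d - r\<bar>"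
            using p by (simp add: dist_norm scaleR_left_diff_distrib[symmetric])
          then show "dist ((real j * d) *\<^sub>R p) (r *\<^sub>R p) \<le> d" using jd by linarith
          have "dist (r *\<^sub>R p) (r *\<^sub>R x) = r * dist p x"
            using r by (simp add: dist_norm scaleR_right_diff_distrib[symmetric])
          also have "\<dots> \<le> 1 * d" using r near[OF x] by (intro mult_mono) auto
          finally show "dist (r *\<^sub>R p) (r *\<^sub>R x) \<le> d" by simp
        qed
        finally have "dist ((real j * d) *\<^sub>R p) (r *\<^sub>R x) \<le> 2 * d" by simp
        then show "r *\<^sub>R x \<in> ?B" using \<open>j \<le> N\<close> by auto
      qed
      have "emeasure lborel ?B \<le> (\<Sum>j\<le>N. emeasure lborel (cball ((real j * d) *\<^sub>R p) (2 * d)))"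
        by (intro emeasure_subadditive_finite) auto
      also have "\<dots> = ennreal (real (Suc N) * (?\<omega> * (2 * d) ^ DIM('a)))"
        using d w0 by (simp add: emeasure_cball ennreal_mult' ennreal_of_nat_eq_real_of_nat)
      also have "\<dots> \<le> ennreal (2 / d * (?\<omega> * (2 * d) ^ DIM('a)))"
      proof (intro ennreal_leI mult_right_mono)
        have "1 \<le> 1/d" using d d0 by simp
        then show "real (Suc N) \<le> 2 / d" using N by simp
      qed (use d w0 in auto)
      also have "2 / d * (?\<omega> * (2 * d) ^ DIM('a)) = 2 ^ (2 * DIM('a)) * ?\<omega> * (d / 2) ^ (DIM('a) - 1)"
      proof -
        obtain k where k: "DIM('a) = Suc k" using DIM_positive[where 'a='a] gr0_implies_Suc by blast
        have "2 * d = 2 * 2 * (d / 2)" by simp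
        then have 1: "(2 * d) ^ k = 2 ^ k * 2 ^ k * (d / 2) ^ k" by (simp only: power_mult_distrib)
        have "(2::real) ^ (2 * Suc k) = 2 ^ (2 + (k + k))" by (rule arg_cong[where f="\<lambda>i. 2 ^ i"]) simp
        also have "\<dots> = 2 ^ 2 * (2 ^ k * 2 ^ k)" by (simp only: power_add)
        finally have 2: "(2::real) ^ (2 * Suc k) = 4 * (2 ^ k * 2 ^ k)" by simp
        have "2 / d * (?\<omega> * (2 * d) ^ Suc k) = (2 / d * (2 * d)) * (?\<omega> * (2 * d) ^ k)"
          by (simp only: power_Suc mult_ac)
        also have "2 / d * (2 * d) = 4" using d by simp
        also have "4 * (?\<omega> * (2 * d) ^ k) = 2 ^ (2 * Suc k) * ?\<omega> * (d / 2) ^ k"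
          unfolding 1 2 by (simp only: mult_ac)
        finally show ?thesis by (simp only: k diff_Suc_1)
      qed
      also have "\<dots> = (2 ^ (2 * DIM('a)) * ?\<omega> / ?v) * (?v * (d / 2) ^ (DIM('a) - 1))"
      proof -
        have "A = (A' / v) * (v * Y)" if "A = A' * Y" "0 < v" for A A' Y v :: real using that by simp
        from this[OF refl w0(2)] show ?thesis .
      qed
      also have "ennreal \<dots> = ennreal (2 ^ (2 * DIM('a)) * ?\<omega> / ?v) * hausdorff_gauge (DIM('a) - 1) C"
        using p(1) w0 d unfolding hausdorff_gauge_def d_def[symmetric]
        by (subst ennreal_mult) auto
      finally show "emeasure lborel ?B \<le> \<dots>" .
    qed auto
  qed
qed

text \<open>
  The cone over an open part of the sphere has positive volume, and any cover of the part covers the cone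
  by sets whose volumes are bounded by the gauges of the covering sets.
\<close>

lemma hausdorff_outer_open_in_sphere_pos:
  fixes U :: "'a::euclidean_space set"
  assumes n: "2 \<le> DIM('a)" and U: "open U" "U \<inter> sphere 0 1 \<noteq> {}"
  shows "0 < hausdorff_outer (DIM('a) - 1) (U \<inter> sphere 0 1)"
proof -
  \<comment> \<open>The open cone over the part of the sphere, without its apex.\<close>
  define V where "V = {x. 0 < norm x \<and> norm x < 1 \<and> (1 / norm x) *\<^sub>R x \<in> U}"
  let ?k = "2 ^ (2 * DIM('a)) * unit_ball_vol (real DIM('a)) / unit_ball_vol (real (DIM('a) - 1))"
  let ?K = "ennreal ?k"
  obtain u where u: "u \<in> U" "norm u = 1" using U(2) by auto
  have "open ((ball 0 1 - {0}) \<inter> (\<lambda>x. (1 / norm x) *\<^sub>R x) -` U)"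
    by (intro continuous_open_preimage continuous_intros) (auto simp: U)
  moreover have "V = (ball 0 1 - {0}) \<inter> (\<lambda>x. (1 / norm x) *\<^sub>R x) -` U" by (auto simp: V_def)
  ultimately have oV: "open V" by simp
  moreover have "(1/2) *\<^sub>R u \<in> V" using u norm_eq_zero[of u] by (simp add: V_def del: norm_eq_zero)
  ultimately have "\<not> negligible V" using open_not_negligible by blast
  then have Vpos: "0 < emeasure lborel V"
    using oV by (auto simp: negligible_iff_null_sets null_sets_completion_iff null_sets_def zero_less_iff_neq_zero)
  have K0: "0 < ?k" using unit_ball_vol_pos by simp
  have le: "emeasure lborel V \<le> ?K * (\<Sum>i. hausdorff_gauge (DIM('a) - 1) (C i))"
      if C: "fine_cover 1 (U \<inter> sphere 0 1) C" for C
    proof -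
      define encl where "encl i B \<longleftrightarrow> B \<in> sets borel \<and> {r *\<^sub>R x | r x. 0 \<le> r \<and> r \<le> 1 \<and> x \<in> C i \<inter> sphere 0 1} \<subseteq> B \<and>
          emeasure lborel B \<le> ?K * hausdorff_gauge (DIM('a) - 1) (C i)" for i B
      have "\<exists>B. encl i B" for i
      proof -
        have "bounded (C i)" "diameter (C i) \<le> 1" using C by (auto simp: fine_cover_def)
        obtain B where "B \<in> sets borel" "{r *\<^sub>R x | r x. 0 \<le> r \<and> r \<le> 1 \<and> x \<in> C i \<inter> sphere 0 1} \<subseteq> B"
            "emeasure lborel B \<le> ?K * hausdorff_gauge (DIM('a) - 1) (C i)"
          by (rule cone_over_small_set[OF n \<open>bounded (C i)\<close> \<open>diameter (C i) \<le> 1\<close>])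
        then show ?thesis unfolding encl_def by (intro exI[of _ B] conjI)
      qed
      then obtain B where "\<And>i. encl i (B i)" by metis
      then have B: "\<And>i. B i \<in> sets borel"
          "\<And>i. {r *\<^sub>R x | r x. 0 \<le> r \<and> r \<le> 1 \<and> x \<in> C i \<inter> sphere 0 1} \<subseteq> B i"
          "\<And>i. emeasure lborel (B i) \<le> ?K * hausdorff_gauge (DIM('a) - 1) (C i)"
        unfolding encl_def by auto
      have "V \<subseteq> (\<Union>i. B i)"
      proof
        fix x assume x: "x \<in> V"
        let ?y = "(1 / norm x) *\<^sub>R x"
        have "?y \<in> U \<inter> sphere 0 1" using x by (auto simp: V_def)
        then obtain i where "?y \<in> C i \<inter> sphere 0 1" using C by (auto simp: fine_cover_def)
        moreover have "x = norm x *\<^sub>R ?y" using x by (auto simp: V_def)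
        moreover have "0 \<le> norm x" "norm x \<le> 1" using x by (auto simp: V_def)
        ultimately have "x \<in> {r *\<^sub>R x | r x. 0 \<le> r \<and> r \<le> 1 \<and> x \<in> C i \<inter> sphere 0 1}" by blast
        then show "x \<in> (\<Union>i. B i)" using B(2) by blast
      qed
      then have "emeasure lborel V \<le> emeasure lborel (\<Union>i. B i)"
        using B(1) by (intro emeasure_mono) auto
      also have "\<dots> \<le> (\<Sum>i. emeasure lborel (B i))"
        using B(1) by (intro emeasure_subadditive_countably) auto
      also have "\<dots> \<le> (\<Sum>i. ?K * hausdorff_gauge (DIM('a) - 1) (C i))"
        by (intro suminf_le B(3)) auto
      also have "\<dots> = ?K * (\<Sum>i. hausdorff_gauge (DIM('a) - 1) (C i))"
        by simp
      finally show ?thesis .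
    qed
  have "hausdorff_premeasure (DIM('a) - 1) 1 (U \<inter> sphere 0 1) \<noteq> 0"
  proof
    assume zero: "hausdorff_premeasure (DIM('a) - 1) 1 (U \<inter> sphere 0 1) = 0"
    have "emeasure lborel V \<le> 0"
    proof (rule ennreal_le_epsilon)
      fix e :: real assume e: "0 < e"
      have "0 < ennreal (e / ?k)" using e K0 by simp
      then obtain C where C: "fine_cover 1 (U \<inter> sphere 0 1) C"
          "(\<Sum>i. hausdorff_gauge (DIM('a) - 1) (C i)) \<le> ennreal (e / ?k)"
        using hausdorff_premeasure_approx[of "DIM('a) - 1" 1 "U \<inter> sphere 0 1" "ennreal (e / ?k)"] zero
        by auto
      have "emeasure lborel V \<le> ?K * ennreal (e / ?k)"
        by (rule order_trans[OF le[OF C(1)]]) (intro mult_left_mono C(2), simp)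
      also have "\<dots> = ennreal e"
      proof -
        have "ennreal k * ennreal (e / k) = ennreal e" if "0 < k" for k
          using that e by (simp add: ennreal_mult[symmetric])
        from this[OF K0] show ?thesis .
      qed
      finally show "emeasure lborel V \<le> 0 + ennreal e" by simp
    qed
    then show False using Vpos by simp
  qed
  then have "0 < hausdorff_premeasure (DIM('a) - 1) 1 (U \<inter> sphere 0 1)"
    by (simp add: zero_less_iff_neq_zero)
  also have "\<dots> \<le> hausdorff_outer (DIM('a) - 1) (U \<inter> sphere 0 1)"
    unfolding hausdorff_outer_def by (intro SUP_upper) auto
  finally show ?thesis .
qed

lemma space_sphere_measure [simp]: "space (sphere_measure :: (real^'n::finite) measure) = sphere 0 1"
  by (simp add: sphere_measure_def space_restrict_space)

lemma sets_sphere_measure [measurable_cong]: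
  "sets (sphere_measure :: (real^'n::finite) measure) = sets (restrict_space borel (sphere 0 1))"
  unfolding sphere_measure_def by (intro sets_restrict_space_cong) simp

lemma emeasure_sphere_measure:
  fixes A :: "(real^'n::finite) set"
  assumes "A \<in> sets borel" "A \<subseteq> sphere 0 1"
  shows "emeasure sphere_measure A = hausdorff_outer (CARD('n) - 1) A"
  unfolding sphere_measure_def using assms
  by (subst emeasure_restrict_space) (auto simp: emeasure_hausdorff_measure)

lemma finite_measure_sphere_measure: "finite_measure (sphere_measure :: (real^'n::finite) measure)"
proof
  show "emeasure sphere_measure (space (sphere_measure :: (real^'n) measure)) \<noteq> \<infinity>"
    using hausdorff_outer_sphere_finite[where 'a="real^'n"]
    by (simp add: emeasure_sphere_measure)
qed

lemma AE_sphere_measure_not_orthogonal: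
  fixes w :: "real^'n::finite"
  assumes "w \<noteq> 0"
  shows "AE x in sphere_measure. x \<bullet> w \<noteq> 0"
proof -
  define A where "A = {x \<in> sphere 0 1. x \<bullet> w = 0}"
  have "A = sphere 0 1 \<inter> {x. w \<bullet> x = 0}" by (auto simp: A_def inner_commute)
  also have "closed \<dots>" by (intro closed_Int closed_hyperplane) auto
  finally have A: "A \<in> sets borel" "A \<subseteq> sphere 0 1" by (auto simp: A_def)
  have "emeasure sphere_measure A = hausdorff_outer (CARD('n) - 1) A"
    by (rule emeasure_sphere_measure[OF A])
  also have "\<dots> = 0"
    using hausdorff_outer_great_subsphere[OF assms] unfolding A_def by simp
  finally have "emeasure sphere_measure A = 0" .
  then have "A \<in> null_sets sphere_measure"
    using A by (intro null_setsI) (auto simp: sets_sphere_measure sets_restrict_space_iff)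
  then show ?thesis by (rule AE_I') (auto simp: A_def)
qed

section \<open>Orthonormal frames and random rotations\<close>

definition orthonormal_seq :: "(nat \<Rightarrow> 'a::euclidean_space) \<Rightarrow> bool" where
  "orthonormal_seq b \<longleftrightarrow> (\<forall>i<DIM('a). \<forall>j<DIM('a). b i \<bullet> b j = (if i = j then 1 else 0))"

lemma orthonormal_seq_expand:
  fixes b :: "nat \<Rightarrow> 'a::euclidean_space"
  assumes b: "orthonormal_seq b"
  shows "(\<Sum>i<DIM('a). (x \<bullet> b i) *\<^sub>R b i) = x"
proof -
  have bb: "b i \<bullet> b j = (if i = j then 1 else 0)" if "i < DIM('a)" "j < DIM('a)" for i j
    using b that by (auto simp: orthonormal_seq_def)
  have inj: "inj_on b {..<DIM('a)}"
    by (intro inj_onI) (metis bb lessThan_iff zero_neq_one)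
  let ?B = "b ` {..<DIM('a)}"
  have orth: "pairwise orthogonal ?B" by (auto simp: pairwise_def orthogonal_def bb)
  have nrm: "norm y = 1" if "y \<in> ?B" for y using that bb by (auto simp: norm_eq_1)
  then have "0 \<notin> ?B" by force
  then have "independent ?B" using orth pairwise_orthogonal_independent by blast
  moreover have "card ?B = DIM('a)" using card_image[OF inj] by simp
  ultimately have "span ?B = UNIV" by (metis card_eq_dim dim_UNIV finite_imageI finite_lessThan
      independent_card_le_dim order_refl span_eq_iff subset_UNIV subspace_UNIV top.extremum_unique)
  then have "(\<Sum>y\<in>?B. (x \<bullet> y) *\<^sub>R y) = x"
    using orthonormal_basis_expand[OF orth nrm] by auto
  then show ?thesis by (simp add: sum.reindex[OF inj])
qed

lemma inner_orthonormal_sum: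
  fixes c :: "nat \<Rightarrow> 'a::euclidean_space"
  assumes "orthonormal_seq c"
  shows "(\<Sum>i<DIM('a). p i *\<^sub>R c i) \<bullet> (\<Sum>i<DIM('a). q i *\<^sub>R c i) = (\<Sum>i<DIM('a). p i * q i)"
proof -
  have "(\<Sum>i<DIM('a). p i *\<^sub>R c i) \<bullet> (\<Sum>i<DIM('a). q i *\<^sub>R c i)
      = (\<Sum>i<DIM('a). \<Sum>j<DIM('a). if i = j then p i * q j else 0)"
    unfolding inner_sum_left inner_sum_right
    using assms by (intro sum.cong) (auto simp: orthonormal_seq_def)
  then show ?thesis by (simp add: sum.delta)
qed

text \<open>
  The linear map that takes the orthonormal frame \<open>b\<close> to \<open>c\<close>; defined for every \<open>b\<close> and \<open>c\<close>, so that
  it is visibly a measurable function of the frames.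
\<close>

definition frame_map :: "(nat \<Rightarrow> 'a::euclidean_space) \<Rightarrow> (nat \<Rightarrow> 'a) \<Rightarrow> 'a \<Rightarrow> 'a" where
  "frame_map b c x = (\<Sum>i<DIM('a). (x \<bullet> b i) *\<^sub>R c i)"

lemma frame_map_orthogonal:
  assumes b: "orthonormal_seq b" and c: "orthonormal_seq c"
  shows "orthogonal_transformation (frame_map b c)"
  unfolding orthogonal_transformation_def
proof (intro conjI allI)
  show "linear (frame_map b c)"
    by (rule linearI) (auto simp: frame_map_def inner_add_left scaleR_left_distrib sum.distrib scaleR_sum_right)
  fix v w
  have "frame_map b c v \<bullet> frame_map b c w = frame_map b b v \<bullet> frame_map b b w"
    by (simp add: frame_map_def inner_orthonormal_sum b c)
  then show "frame_map b c v \<bullet> frame_map b c w = v \<bullet> w"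
    by (simp add: frame_map_def orthonormal_seq_expand[OF b])
qed

lemma frame_map_apply:
  fixes b :: "nat \<Rightarrow> 'a::euclidean_space"
  assumes b: "orthonormal_seq b" and i: "i < DIM('a)"
  shows "frame_map b c (b i) = c i"
proof -
  have "frame_map b c (b i) = (\<Sum>j<DIM('a). if j = i then c j else 0)"
    unfolding frame_map_def using b i by (intro sum.cong) (auto simp: orthonormal_seq_def)
  then show ?thesis using i by simp
qed

lemma frame_map_inverse:
  assumes b: "orthonormal_seq b" and c: "orthonormal_seq c"
  shows "frame_map c b (frame_map b c x) = x"
proof -
  have "frame_map b c x \<bullet> c i = x \<bullet> b i" if "i < DIM('a)" for i
    using frame_map_orthogonal[OF b c] frame_map_apply[OF b that, of c]
    by (metis orthogonal_transformation_def)
  then have "frame_map c b (frame_map b c x) = frame_map b b x" by (simp add: frame_map_def)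
  then show ?thesis by (simp add: frame_map_def orthonormal_seq_expand[OF b])
qed

lemma adapted_frame:
  fixes u :: "'a::euclidean_space"
  assumes u: "norm u = 1" and V: "subspace V" "dim V = k" "\<forall>x\<in>V. orthogonal u x"
  obtains b where "orthonormal_seq b" "b 0 = u" "span (b ` {1..k}) = V" "k < DIM('a)"
proof -
  obtain B where B: "B \<subseteq> V" "pairwise orthogonal B" "\<And>x. x \<in> B \<Longrightarrow> norm x = 1"
      "independent B" "card B = dim V" "span B = V"
    by (rule orthonormal_basis_subspace[OF V(1)]) blast
  let ?U = "span (insert u V)"
  define W where "W = {y \<in> UNIV. \<forall>x\<in>?U. orthogonal x y}"
  have sW: "subspace W" unfolding W_def
    by (auto simp: subspace_def orthogonal_def inner_add_right)
  have dW: "dim W + dim ?U = DIM('a)"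
    unfolding W_def using dim_subspace_orthogonal_to_vectors[of ?U UNIV] by (simp del: dim_span)
  have uV: "u \<notin> V" using V(3) u by (metis norm_eq_zero orthogonal_self zero_neq_one)
  have dU: "dim ?U = Suc k"
    using dim_insert[of u V] uV V by (simp add: span_eq_iff[THEN iffD2])
  obtain C where C: "C \<subseteq> W" "pairwise orthogonal C" "\<And>x. x \<in> C \<Longrightarrow> norm x = 1"
      "independent C" "card C = dim W" "span C = W"
    by (rule orthonormal_basis_subspace[OF sW]) blast
  have fin: "finite B" "finite C" using B(4) C(4) by (auto simp: independent_imp_finite)
  obtain xs where xs: "set xs = B" "distinct xs" using finite_distinct_list[OF fin(1)] by blast
  obtain ys where ys: "set ys = C" "distinct ys" using finite_distinct_list[OF fin(2)] by blast
  define zs where "zs = u # xs @ ys"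
  have lx: "length xs = k" using xs B V by (metis distinct_card)
  have ly: "length ys = dim W" using ys C by (metis distinct_card)
  have lz: "length zs = DIM('a)" using dW dU lx ly by (simp add: zs_def)
  have UB: "b \<in> ?U" if "b \<in> insert u B" for b using that B(1) by (auto intro: span_base)
  have oC: "orthogonal b c" if "b \<in> insert u B" "c \<in> C" for b c
    using UB[OF that(1)] C(1) that(2) by (auto simp: W_def)
  have nz: "norm x = 1" if "x \<in> insert u (B \<union> C)" for x using that u B(3) C(3) by auto
  have disj: "x \<noteq> c" if "x \<in> insert u B" "c \<in> C" for x c
    using oC[OF that] nz[of c] that by (metis norm_zero orthogonal_self zero_neq_one insertI2 UnI2)
  have dz: "distinct zs" using xs ys uV B(1) disj by (auto simp: zs_def)
  have sz: "set zs = insert u (B \<union> C)" using xs ys by (simp add: zs_def)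
  have oz: "orthogonal x y" if "x \<in> set zs" "y \<in> set zs" "x \<noteq> y" for x y
  proof -
    have oC': "orthogonal c b" if "b \<in> insert u B" "c \<in> C" for b c
      using oC[OF that] by (simp add: orthogonal_commute)
    have V3': "orthogonal x u" if "x \<in> V" for x
      using orthogonal_commute V(3) that by blast
    show ?thesis
      using that B(1,2) C(2) V(3) V3' oC oC' unfolding sz by (auto simp: pairwise_def)
  qed
  show ?thesis
  proof (rule that[of "\<lambda>i. zs ! i"])
    show "orthonormal_seq (\<lambda>i. zs ! i)"
      unfolding orthonormal_seq_def
    proof (intro allI impI)
      fix i j assume ij: "i < DIM('a)" "j < DIM('a)"
      then have m: "zs ! i \<in> set zs" "zs ! j \<in> set zs" using lz by auto
      show "zs ! i \<bullet> zs ! j = (if i = j then 1 else 0)"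
      proof (cases "i = j")
        case True
        then show ?thesis using nz m sz by (auto simp: norm_eq_1)
      next
        case False
        then have "zs ! i \<noteq> zs ! j" using dz ij lz by (simp add: nth_eq_iff_index_eq)
        then show ?thesis using oz[OF m] False by (simp add: orthogonal_def)
      qed
    qed
    show "zs ! 0 = u" by (simp add: zs_def)
    have "(\<lambda>i. zs ! i) ` {1..k} = set xs"
    proof -
      have "(\<lambda>i. zs ! i) ` {1..k} = (\<lambda>i. zs ! Suc i) ` {0..<k}"
        by (metis (no_types, lifting) One_nat_def atLeastLessThanSuc_atLeastAtMost image_Suc_atLeastLessThan image_image image_cong)
      also have "\<dots> = (\<lambda>i. xs ! i) ` {0..<k}"
        using lx by (intro image_cong) (auto simp: zs_def nth_append)
      also have "\<dots> = set xs" using lx nth_image[of k xs] by (simp add: atLeast0LessThan)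
      finally show ?thesis .
    qed
    then show "span ((\<lambda>i. zs ! i) ` {1..k}) = V" using xs B by simp
    show "k < DIM('a)" using dW dU by linarith
  qed
qed

(* The congruence rule tells the termination prover that the recursive calls in the sum are at j < i. *)
declare sum.cong [fundef_cong]

text \<open>
  As \<open>sgn 0 = 0\<close>, the process returns a zero vector exactly where linear independence fails, and it is
  defined on all sequences.
\<close>

fun gram_schmidt :: "(nat \<Rightarrow> 'a::real_inner) \<Rightarrow> nat \<Rightarrow> 'a" where
  "gram_schmidt a i = sgn (a i - (\<Sum>j<i. (a i \<bullet> gram_schmidt a j) *\<^sub>R gram_schmidt a j))"

declare gram_schmidt.simps [simp del]

text \<open>
  This equivariance is what makes the distribution of a randomly orthonormalised frame invariant.
\<close>

lemma gram_schmidt_orthogonal_map: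
  assumes T: "orthogonal_transformation T"
  shows "gram_schmidt (\<lambda>i. T (a i)) i = T (gram_schmidt a i)"
proof (induction i rule: less_induct)
  case (less i)
  have lin: "linear T" and ip: "\<And>v w. T v \<bullet> T w = v \<bullet> w" and nrm: "\<And>v. norm (T v) = norm v"
    using T by (auto simp: orthogonal_transformation_def orthogonal_transformation_norm)
  have "T (a i) - (\<Sum>j<i. (T (a i) \<bullet> gram_schmidt (\<lambda>i. T (a i)) j) *\<^sub>R gram_schmidt (\<lambda>i. T (a i)) j)
     = T (a i - (\<Sum>j<i. (a i \<bullet> gram_schmidt a j) *\<^sub>R gram_schmidt a j))"
    using less by (simp add: ip linear_diff[OF lin] linear_sum[OF lin] linear_scale[OF lin])
  then show ?case
    by (simp add: gram_schmidt.simps[of _ i] sgn_div_norm nrm linear_scale[OF lin])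
qed

lemma gram_schmidt_orthonormal:
  assumes nz: "\<And>i. i < n \<Longrightarrow> gram_schmidt a i \<noteq> 0" and "i < n" "j < n"
  shows "gram_schmidt a i \<bullet> gram_schmidt a j = (if i = j then 1 else 0)"
proof -
  let ?g = "gram_schmidt a"
  have nrm: "norm (?g i) = 1" if "i < n" for i
    using nz[OF that] by (simp add: gram_schmidt.simps[of a i] norm_sgn sgn_zero_iff split: if_splits)
  have orth: "?g i \<bullet> ?g j = 0" if "j < i" "i < n" for i j
    using that
  proof (induction i arbitrary: j rule: less_induct)
    case (less i)
    let ?r = "a i - (\<Sum>l<i. (a i \<bullet> ?g l) *\<^sub>R ?g l)"
    have gg: "?g l \<bullet> ?g j = (if l = j then 1 else 0)" if "l < i" for l
    proof (cases l j rule: linorder_cases)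
      case less
      then show ?thesis using less.IH[of j l] \<open>j < i\<close> \<open>i < n\<close> by (simp add: inner_commute)
    next
      case equal
      then show ?thesis using nrm[of j] that \<open>i < n\<close> by (simp add: norm_eq_1)
    next
      case greater
      then show ?thesis using less.IH[of l j] that \<open>i < n\<close> by simp
    qed
    have "(\<Sum>l<i. (a i \<bullet> ?g l) *\<^sub>R ?g l) \<bullet> ?g j = (\<Sum>l<i. if l = j then a i \<bullet> ?g l else 0)"
      unfolding inner_sum_left using gg by (intro sum.cong) auto
    also have "\<dots> = a i \<bullet> ?g j" using less.prems by simp
    finally have "?r \<bullet> ?g j = 0" by (simp add: inner_diff_left)
    then show ?case by (simp add: gram_schmidt.simps[of a i] sgn_div_norm)
  qed
  show ?thesis
  proof (cases i j rule: linorder_cases)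
    case less
    then show ?thesis using orth[of i j] assms by (simp add: inner_commute)
  next
    case equal
    then show ?thesis using nrm[of i] assms by (simp add: norm_eq_1)
  next
    case greater
    then show ?thesis using orth[of j i] assms by simp
  qed
qed

lemma gram_schmidt_fixes_orthonormal:
  assumes b: "\<And>i j. i < n \<Longrightarrow> j < n \<Longrightarrow> a i \<bullet> a j = (if i = j then 1 else 0)" and "i < n"
  shows "gram_schmidt a i = a i"
  using assms(2)
proof (induction i rule: less_induct)
  case (less i)
  have "(\<Sum>j<i. (a i \<bullet> gram_schmidt a j) *\<^sub>R gram_schmidt a j) = 0"
    using less b by (intro sum.neutral) auto
  moreover have "norm (a i) = 1" using b[of i i] less.prems by (simp add: norm_eq_1)
  ultimately show ?case by (simp add: gram_schmidt.simps[of a i] sgn_div_norm)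
qed

lemma gram_schmidt_isCont:
  fixes a :: "'b::t2_space \<Rightarrow> nat \<Rightarrow> 'a::real_inner"
  assumes c: "\<And>i. i < n \<Longrightarrow> isCont (\<lambda>x. a x i) x0"
    and nz: "\<And>i. i < n \<Longrightarrow> gram_schmidt (a x0) i \<noteq> 0" and "i < n"
  shows "isCont (\<lambda>x. gram_schmidt (a x) i) x0"
  using assms(3)
proof (induction i rule: less_induct)
  case (less i)
  have "a x0 i - (\<Sum>j<i. (a x0 i \<bullet> gram_schmidt (a x0) j) *\<^sub>R gram_schmidt (a x0) j) \<noteq> 0"
    using nz[OF less.prems] by (simp add: gram_schmidt.simps[of _ i] sgn_zero_iff)
  then show ?case
    unfolding gram_schmidt.simps[of _ i] using less
    by (intro continuous_intros isCont_sgn c) auto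
qed

lemma borel_measurable_gram_schmidt:
  fixes a :: "'b \<Rightarrow> nat \<Rightarrow> 'a::euclidean_space"
  assumes "\<And>i. (\<lambda>x. a x i) \<in> borel_measurable M"
  shows "(\<lambda>x. gram_schmidt (a x) i) \<in> borel_measurable M"
proof (induction i rule: less_induct)
  case (less i)
  have "(\<lambda>x. a x i - (\<Sum>j<i. (a x i \<bullet> gram_schmidt (a x) j) *\<^sub>R gram_schmidt (a x) j)) \<in> borel_measurable M"
    using less assms by (intro borel_measurable_diff borel_measurable_sum borel_measurable_scaleR borel_measurable_inner) auto
  then show ?case
    unfolding gram_schmidt.simps[of _ i] sgn_div_norm
    by (intro borel_measurable_scaleR borel_measurable_inverse measurable_compose[OF _ borel_measurable_norm])
qed

lemma row_action_orthogonal: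
  fixes T :: "real^'n \<Rightarrow> real^'n"
  assumes T: "orthogonal_transformation T"
  shows "orthogonal_transformation (\<lambda>A :: real^'n^'n. \<chi> k. T (A $ k))"
  unfolding orthogonal_transformation_def
proof (intro conjI allI)
  have lin: "linear T" using T by (simp add: orthogonal_transformation_def)
  show "linear (\<lambda>A :: real^'n^'n. \<chi> k. T (A $ k))"
    by (rule linearI) (auto simp: vec_eq_iff linear_add[OF lin] linear_scale[OF lin])
  show "(\<chi> k. T (v $ k)) \<bullet> (\<chi> k. T (w $ k)) = v \<bullet> w" for v w :: "real^'n^'n"
    using T unfolding inner_vec_def[of v] inner_vec_def[of "\<chi> k. T (v $ k)"]
    by (simp add: orthogonal_transformation_def)
qed

text \<open>
  The random orthogonal map \<open>g\<close> fixes \<open>u\<close>, has the inverse \<open>h\<close>, and its distribution is invariant under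
  composition with the orthogonal maps that fix \<open>u\<close>. Invariance is expressed on the
  probability space, by a measure preserving \<open>\<phi>\<close>, which avoids a measurable structure on the orthogonal
  group.
\<close>

definition random_rotation ::
    "real^'n \<Rightarrow> (real^'n^'n) measure \<Rightarrow> (real^'n^'n \<Rightarrow> real^'n \<Rightarrow> real^'n) \<Rightarrow> (real^'n^'n \<Rightarrow> real^'n \<Rightarrow> real^'n) \<Rightarrow> bool" where
  "random_rotation u \<mu> g h \<longleftrightarrow> prob_space \<mu> \<and>
     (\<forall>A\<in>space \<mu>. orthogonal_transformation (g A) \<and> g A u = u \<and> (\<forall>x. h A (g A x) = x) \<and> (\<forall>x. g A (h A x) = x)) \<and>
     (\<lambda>(A, x). g A x) \<in> borel_measurable (\<mu> \<Otimes>\<^sub>M borel) \<and>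
     (\<lambda>(A, x). h A x) \<in> borel_measurable (\<mu> \<Otimes>\<^sub>M borel) \<and>
     (\<forall>T. orthogonal_transformation T \<longrightarrow> T u = u \<longrightarrow>
        (\<exists>\<phi>\<in>measurable \<mu> \<mu>. distr \<mu> \<mu> \<phi> = \<mu> \<and> (\<forall>A\<in>space \<mu>. \<forall>x. g (\<phi> A) x = T (g A x))))"

text \<open>
  Take a matrix uniformly from a ball, replace its first row by \<open>u\<close>, orthonormalise, and map a fixed frame
  that starts with \<open>u\<close> to the frame obtained. Applying \<open>T\<close> to every row preserves Lebesgue measure and
  commutes with the orthonormalisation. The matrices with a degenerate frame are removed from the ball;
  what remains has positive volume since it contains a neighbourhood of a matrix with orthonormal rows.
\<close>

lemma random_rotation_exists:
  fixes u :: "real^'n"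
  assumes u: "norm u = 1"
  shows "\<exists>\<mu> g h. random_rotation u \<mu> g h"
proof -
  let ?n = "DIM(real^'n)"
  have "subspace {0 :: real^'n}" "dim {0 :: real^'n} = 0" "\<forall>x\<in>{0}. orthogonal u x"
    by (auto simp: subspace_single_0 orthogonal_def)
  then obtain b :: "nat \<Rightarrow> real^'n" where b: "orthonormal_seq b" "b 0 = u"
    using adapted_frame[OF u] by metis
  obtain e where e: "bij_betw e {..<?n} (UNIV :: 'n set)"
    using ex_bij_betw_nat_finite[OF finite[of "UNIV :: 'n set"]] by (auto simp: atLeast0LessThan)
  define a where "a A i = (if i = 0 then u else A $ e i)" for A :: "real^'n^'n" and i
  define gs where "gs A = gram_schmidt (a A)" for A
  \<comment> \<open>The matrix with rows b: orthonormalisation leaves it unchanged, so near it all frames are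
    nondegenerate.\<close>
  define A0 where "A0 = (\<chi> k. b (inv_into {..<?n} e k))"
  have aA0: "a A0 i = b i" if "i < ?n" for i
    using that b(2) bij_betw_inv_into_left[OF e] by (auto simp: a_def A0_def)
  define r where "r = norm A0 + 1"
  define W where "W = {A. norm A < r \<and> (\<forall>i<?n. gs A i \<noteq> 0)}"
  have am: "(\<lambda>A. a A i) \<in> borel_measurable borel" for i
  proof -
    have "continuous_on UNIV (\<lambda>A :: real^'n^'n. A $ e i)" by (intro continuous_intros)
    then show ?thesis by (cases "i = 0") (auto simp: a_def intro: borel_measurable_continuous_onI)
  qed
  have gsm [measurable]: "(\<lambda>A. gs A i) \<in> borel_measurable borel" for i
    unfolding gs_def by (intro borel_measurable_gram_schmidt am)
  have Wb [measurable]: "W \<in> sets borel" unfolding W_def by measurable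
  have gsA0: "gs A0 i = b i" if "i < ?n" for i
  proof -
    have "gs A0 i = a A0 i" unfolding gs_def
      by (rule gram_schmidt_fixes_orthonormal[where n = ?n])
         (use b(1) aA0 that in \<open>auto simp: orthonormal_seq_def\<close>)
    then show ?thesis using aA0[OF that] by simp
  qed
  have b0: "b i \<noteq> 0" if "i < ?n" for i
  proof -
    have "b i \<bullet> b i = 1" using b(1) that by (simp add: orthonormal_seq_def)
    then show ?thesis by auto
  qed
  have "isCont (\<lambda>A. gs A i) A0" if "i < ?n" for i
    unfolding gs_def
  proof (rule gram_schmidt_isCont[where n = ?n])
    show "isCont (\<lambda>x. a x i) A0" for i
      by (cases "i = 0") (auto simp: a_def)
    show "gram_schmidt (a A0) i \<noteq> 0" if "i < ?n" for i
      using gsA0[OF that] b0[OF that] by (simp add: gs_def)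
  qed fact
  then have "\<forall>\<^sub>F A in nhds A0. gs A i \<noteq> 0" if "i < ?n" for i
    using continuous_at_avoid[of A0 "\<lambda>A. gs A i" 0] gsA0[OF that] b0[OF that] that
    unfolding eventually_nhds_metric by (auto simp: dist_commute)
  then have "\<forall>\<^sub>F A in nhds A0. \<forall>i\<in>{..<?n}. gs A i \<noteq> 0"
    by (intro eventually_ball_finite) auto
  moreover have "\<forall>\<^sub>F A in nhds A0. norm A < r"
    by (rule order_tendstoD[OF tendsto_norm[OF filterlim_ident]]) (simp add: r_def)
  ultimately have "\<forall>\<^sub>F A in nhds A0. A \<in> W"
    by eventually_elim (auto simp: W_def)
  then obtain S where S: "open S" "A0 \<in> S" "S \<subseteq> W" unfolding eventually_nhds by blast
  have posW: "emeasure lborel W \<noteq> 0"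
  proof
    assume "emeasure lborel W = 0"
    then have "emeasure lborel S = 0"
      using S Wb by (metis emeasure_mono le_zero_eq sets_lborel)
    then have "negligible S" using S(1)
      by (auto simp: negligible_iff_null_sets null_sets_completion_iff null_sets_def)
    then show False using open_not_negligible S by blast
  qed
  have "emeasure lborel W \<le> emeasure lborel (ball (0 :: real^'n^'n) r)"
    by (intro emeasure_mono) (auto simp: W_def)
  also have "\<dots> < \<infinity>" by (rule emeasure_lborel_ball_finite)
  finally have finW: "emeasure lborel W \<noteq> \<infinity>" by simp
  let ?U = "uniform_measure lborel W"
  define \<mu> where "\<mu> = restrict_space ?U W"
  have spU: "space ?U = UNIV" "sets ?U = sets borel" by (auto simp: uniform_measure_def)
  have sp: "space \<mu> = W" by (simp add: \<mu>_def space_restrict_space spU)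
  have U1: "emeasure ?U W = 1"
    by (rule emeasure_uniform_measure_1[OF posW finW])
  have em: "emeasure \<mu> E = emeasure ?U E" if "E \<in> sets borel" "E \<subseteq> W" for E
    unfolding \<mu>_def using that by (subst emeasure_restrict_space) (auto simp: spU)
  have sets\<mu>: "sets \<mu> = sets (restrict_space borel W)"
    unfolding \<mu>_def by (intro sets_restrict_space_cong) (simp add: spU)
  have prob: "prob_space \<mu>"
    by (rule prob_spaceI) (simp add: sp em U1)
  have on: "orthonormal_seq (gs A)" if "A \<in> W" for A
    using that gram_schmidt_orthonormal[of ?n "a A"] unfolding orthonormal_seq_def gs_def W_def by blast
  have gs0: "gs A 0 = u" for A using u by (simp add: gs_def gram_schmidt.simps[of _ 0] a_def sgn_div_norm)
  define g where "g A = frame_map b (gs A)" for A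
  define h where "h A = frame_map (gs A) b" for A
  have gsm' [measurable]: "(\<lambda>p. gs (fst p) i) \<in> borel_measurable (\<mu> \<Otimes>\<^sub>M (borel :: (real^'n) measure))" for i
  proof -
    have "(\<lambda>A. gs A i) \<in> borel_measurable \<mu>"
      using measurable_restrict_space1[OF gsm] sets\<mu> by (simp cong: measurable_cong_sets)
    then show ?thesis by measurable
  qed
  have gm: "(\<lambda>(A, x). g A x) \<in> borel_measurable (\<mu> \<Otimes>\<^sub>M (borel :: (real^'n) measure))"
    unfolding g_def frame_map_def case_prod_beta by measurable
  have hm: "(\<lambda>(A, x). h A x) \<in> borel_measurable (\<mu> \<Otimes>\<^sub>M (borel :: (real^'n) measure))"
    unfolding h_def frame_map_def case_prod_beta by measurable
  have pt: "orthogonal_transformation (g A) \<and> g A u = u \<and> (\<forall>x. h A (g A x) = x) \<and> (\<forall>x. g A (h A x) = x)"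
    if "A \<in> W" for A
  proof -
    have "g A (b 0) = gs A 0" unfolding g_def by (rule frame_map_apply[OF b(1)]) simp
    then show ?thesis
      using frame_map_orthogonal[OF b(1) on[OF that]] frame_map_inverse[OF b(1) on[OF that]]
        frame_map_inverse[OF on[OF that] b(1)] gs0 b(2)
      by (auto simp: g_def h_def)
  qed
  have inv: "\<exists>\<phi>\<in>measurable \<mu> \<mu>. distr \<mu> \<mu> \<phi> = \<mu> \<and> (\<forall>A\<in>space \<mu>. \<forall>x. g (\<phi> A) x = T (g A x))"
    if T: "orthogonal_transformation T" "T u = u" for T
  proof -
    \<comment> \<open>Applying T to the rows corresponds to composing the rotation with T, as T fixes u.\<close>
    let ?\<phi> = "\<lambda>A :: real^'n^'n. \<chi> k. T (A $ k)"
    have o\<phi>: "orthogonal_transformation ?\<phi>" by (rule row_action_orthogonal[OF T(1)])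
    have lin: "linear T" using T(1) by (simp add: orthogonal_transformation_def)
    have a\<phi>: "a (?\<phi> A) = (\<lambda>i. T (a A i))" for A using T(2) by (auto simp: a_def)
    have gs\<phi>: "gs (?\<phi> A) i = T (gs A i)" for A i
      unfolding gs_def a\<phi> by (rule gram_schmidt_orthogonal_map[OF T(1)])
    have T0: "T x = 0 \<longleftrightarrow> x = 0" for x
      using orthogonal_transformation_norm[OF T(1), of x] by (metis norm_eq_zero)
    have W\<phi>: "?\<phi> A \<in> W \<longleftrightarrow> A \<in> W" for A
      using orthogonal_transformation_norm[OF o\<phi>, of A] by (simp add: W_def gs\<phi> T0)
    have "linear ?\<phi>" using o\<phi> by (simp add: orthogonal_transformation_def)
    then have m\<phi>: "?\<phi> \<in> borel_measurable borel"
      by (intro borel_measurable_continuous_onI linear_continuous_on linear_conv_bounded_linear[THEN iffD1])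
    have m\<mu>: "?\<phi> \<in> measurable \<mu> \<mu>"
    proof -
      have "?\<phi> \<in> measurable (restrict_space borel W) (restrict_space borel W)"
        by (intro measurable_restrict_space3 m\<phi>) (auto simp: W\<phi>)
      then show ?thesis using sets\<mu> by (simp cong: measurable_cong_sets)
    qed
    have "distr \<mu> \<mu> ?\<phi> = \<mu>"
    proof (rule measure_eqI)
      fix E assume "E \<in> sets (distr \<mu> \<mu> ?\<phi>)"
      then have E: "E \<in> sets \<mu>" by simp
      then have E': "E \<in> sets borel" "E \<subseteq> W" using sets\<mu> Wb by (auto simp: sets_restrict_space_iff)
      have pre: "?\<phi> -` E \<in> sets borel" "?\<phi> -` E \<subseteq> W"
        using measurable_sets[OF m\<phi> E'(1)] E'(2) W\<phi> by auto
      have "?\<phi> -` E \<inter> space \<mu> = ?\<phi> -` E" using pre(2) sp by auto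
      then have "emeasure (distr \<mu> \<mu> ?\<phi>) E = emeasure ?U (?\<phi> -` E)"
        using E m\<mu> em[OF pre] by (simp add: emeasure_distr)
      also have "\<dots> = emeasure lborel (?\<phi> -` E) / emeasure lborel W"
        using pre Wb by (subst emeasure_uniform_measure) (auto simp: Int_absorb1)
      also have "emeasure lborel (?\<phi> -` E) = emeasure (distr lborel borel ?\<phi>) E"
        using E' m\<phi> by (subst emeasure_distr) auto
      also have "distr lborel borel ?\<phi> = lborel" by (rule distr_lborel_orthogonal[OF o\<phi>])
      also have "emeasure lborel E / emeasure lborel W = emeasure ?U E"
        using E' Wb by (subst emeasure_uniform_measure) (auto simp: Int_absorb1)
      also have "\<dots> = emeasure \<mu> E" using em[OF E'] by simp
      finally show "emeasure (distr \<mu> \<mu> ?\<phi>) E = emeasure \<mu> E" .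
    qed simp
    moreover have "g (?\<phi> A) x = T (g A x)" for A x
      by (simp add: g_def frame_map_def gs\<phi> linear_sum[OF lin] linear_scale[OF lin])
    ultimately show ?thesis using m\<mu> by blast
  qed
  show ?thesis
  proof -
    have pt': "\<forall>A\<in>space \<mu>. orthogonal_transformation (g A) \<and> g A u = u \<and> (\<forall>x. h A (g A x) = x) \<and> (\<forall>x. g A (h A x) = x)"
      using pt sp by simp
    show ?thesis unfolding random_rotation_def
      by (intro exI[of _ \<mu>] exI[of _ g] exI[of _ h] conjI allI impI) (rule prob pt' gm hm inv; assumption)+
  qed
qed

section \<open>Haar measure on the Grassmannian of a hyperplane\<close>

lemma subspace_closest_point_unique:
  fixes V :: "'a::euclidean_space set"
  assumes V: "subspace V" and y: "y \<in> V" "\<And>z. z \<in> V \<Longrightarrow> (x - y) \<bullet> z = 0"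
  shows "closest_point V x = y"
proof (rule closest_point_unique[symmetric])
  show "convex V" "closed V" using V by (auto simp: subspace_imp_convex closed_subspace)
  show "y \<in> V" by fact
  show "\<forall>z\<in>V. dist x y \<le> dist x z"
  proof
    fix z assume z: "z \<in> V"
    have "(x - y) \<bullet> (y - z) = 0" using y V z by (simp add: subspace_diff)
    then have "(norm (x - z))\<^sup>2 = (norm (x - y))\<^sup>2 + (norm (y - z))\<^sup>2"
      using norm_add_Pythagorean[of "x - y" "y - z"] by (simp add: orthogonal_def)
    then show "dist x y \<le> dist x z" unfolding dist_norm
      by (metis le_add_same_cancel1 norm_ge_zero power2_le_imp_le zero_le_power2)
  qed
qed

lemma subspace_closest_point:
  fixes V :: "'a::euclidean_space set"
  assumes V: "subspace V"
  shows "closest_point V x \<in> V" "\<And>z. z \<in> V \<Longrightarrow> (x - closest_point V x) \<bullet> z = 0"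
proof -
  obtain y z where yz: "y \<in> span V" "\<And>w. w \<in> span V \<Longrightarrow> orthogonal z w" "x = y + z"
    using orthogonal_subspace_decomp_exists[of V x] by metis
  have "closest_point V x = y"
    using yz V by (intro subspace_closest_point_unique) (auto simp: orthogonal_def span_eq_iff[THEN iffD2])
  then show "closest_point V x \<in> V" "\<And>z. z \<in> V \<Longrightarrow> (x - closest_point V x) \<bullet> z = 0"
    using yz V by (auto simp: orthogonal_def span_eq_iff[THEN iffD2])
qed

lemma linear_closest_point:
  fixes V :: "'a::euclidean_space set"
  assumes V: "subspace V"
  shows "linear (closest_point V)"
proof (rule linearI)
  fix x y :: 'a and c :: real
  note p = subspace_closest_point[OF V]
  show "closest_point V (x + y) = closest_point V x + closest_point V y"
  proof (rule subspace_closest_point_unique[OF V])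
    fix z assume "z \<in> V"
    then show "(x + y - (closest_point V x + closest_point V y)) \<bullet> z = 0"
      using p(2)[of z x] p(2)[of z y] by (simp add: inner_diff_left inner_add_left)
  qed (use p V in \<open>auto intro: subspace_add\<close>)
  show "closest_point V (c *\<^sub>R x) = c *\<^sub>R closest_point V x"
  proof (rule subspace_closest_point_unique[OF V])
    fix z assume "z \<in> V"
    then show "(c *\<^sub>R x - c *\<^sub>R closest_point V x) \<bullet> z = 0"
      using p(2)[of z x] by (simp add: inner_diff_left)
  qed (use p V in \<open>auto intro: subspace_scale\<close>)
qed

lemma closest_point_orthogonal_image:
  fixes V :: "'a::euclidean_space set" and T :: "'a \<Rightarrow> 'a"
  assumes V: "subspace V" and T: "orthogonal_transformation T" and S: "\<And>x. T (S x) = x"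
  shows "closest_point (T ` V) x = T (closest_point V (S x))"
proof (rule subspace_closest_point_unique)
  have lin: "linear T" using T by (simp add: orthogonal_transformation_def)
  note p = subspace_closest_point[OF V]
  show "subspace (T ` V)" by (rule linear_subspace_image[OF lin V])
  show "T (closest_point V (S x)) \<in> T ` V" using p by auto
  fix z assume "z \<in> T ` V"
  then obtain v where v: "v \<in> V" "z = T v" by auto
  have "(x - T (closest_point V (S x))) = T (S x - closest_point V (S x))"
    by (simp add: linear_diff[OF lin] S)
  then show "(x - T (closest_point V (S x))) \<bullet> z = 0"
    using T p(2)[OF v(1)] v(2) by (simp add: orthogonal_transformation_def)
qed

lemma continuous_matrix_vector_mult:
  "continuous_on UNIV (\<lambda>p :: (real^'n^'m) \<times> (real^'n). fst p *v snd p)"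
  unfolding matrix_vector_mult_def by (intro continuous_intros)

lemma space_grassmannian_perp_borel [simp]:
  "space (grassmannian_perp_borel u k) = grassmannian_perp u k"
  by (simp add: grassmannian_perp_borel_def)

lemma measurable_closest_point_grassmannian:
  fixes u :: "real^'n"
  assumes f: "f \<in> measurable M (grassmannian_perp_borel u k)" and h: "h \<in> borel_measurable M"
  shows "(\<lambda>\<omega>. closest_point (f \<omega>) (h \<omega>)) \<in> borel_measurable M"
proof -
  have "(\<lambda>V. matrix (closest_point V)) \<in> borel_measurable (grassmannian_perp_borel u k)"
    unfolding grassmannian_perp_borel_def by (rule measurable_vimage_algebra1) auto
  from measurable_compose[OF f this]
  have m: "(\<lambda>\<omega>. matrix (closest_point (f \<omega>))) \<in> borel_measurable M" .
  have "(\<lambda>\<omega>. matrix (closest_point (f \<omega>)) *v h \<omega>) \<in> borel_measurable M"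
    using borel_measurable_continuous_Pair[OF m h continuous_matrix_vector_mult] by simp
  moreover have "matrix (closest_point (f \<omega>)) *v h \<omega> = closest_point (f \<omega>) (h \<omega>)" if "\<omega> \<in> space M" for \<omega>
  proof -
    have "f \<omega> \<in> grassmannian_perp u k" using measurable_space[OF f that] by simp
    then have "linear (closest_point (f \<omega>))" by (intro linear_closest_point) (simp add: grassmannian_perp_def)
    then show ?thesis by (metis matrix_vector_mul(2))
  qed
  ultimately show ?thesis by (simp cong: measurable_cong)
qed

text \<open>
  The Borel structure of the Grassmannian is that of the projection matrices, whose columns are the
  projections of the basis vectors.
\<close>

lemma measurable_grassmannianI:
  fixes u :: "real^'n"
  assumes f: "\<And>\<omega>. \<omega> \<in> space M \<Longrightarrow> f \<omega> \<in> grassmannian_perp u k"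
    and m: "\<And>x. (\<lambda>\<omega>. closest_point (f \<omega>) x) \<in> borel_measurable M"
  shows "f \<in> measurable M (grassmannian_perp_borel u k)"
  unfolding grassmannian_perp_borel_def
proof (rule measurable_vimage_algebra2)
  show "f \<in> space M \<rightarrow> grassmannian_perp u k" using f by auto
  show "(\<lambda>\<omega>. matrix (closest_point (f \<omega>))) \<in> borel_measurable M"
  proof (subst borel_measurable_euclidean_space, intro ballI)
    fix b :: "real^'n^'n" assume "b \<in> Basis"
    then obtain i j where b: "b = axis i (axis j 1)" by (auto simp: Basis_vec_def)
    have "(\<lambda>\<omega>. closest_point (f \<omega>) (axis j 1) \<bullet> axis i 1) \<in> borel_measurable M"
      using m[of "axis j 1"] by (intro borel_measurable_inner) auto
    then show "(\<lambda>\<omega>. matrix (closest_point (f \<omega>)) \<bullet> b) \<in> borel_measurable M"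
      by (simp add: b inner_axis matrix_def)
  qed
qed

lemma grassmannian_perp_image:
  fixes u :: "real^'n" and T :: "real^'n \<Rightarrow> real^'n"
  assumes V: "V \<in> grassmannian_perp u k" and T: "orthogonal_transformation T"
  shows "T ` V \<in> grassmannian_perp (T u) k"
proof -
  have lin: "linear T" using T by (simp add: orthogonal_transformation_def)
  have "dim (T ` V) = dim V"
    by (rule dim_image_eq[OF lin]) (meson inj_on_subset subset_UNIV orthogonal_transformation_inj T)
  then show ?thesis
    using V T linear_subspace_image[OF lin]
    by (auto simp: grassmannian_perp_def orthogonal_def orthogonal_transformation_def)
qed

lemma orthogonal_inverse:
  assumes T: "orthogonal_transformation (T :: 'a::euclidean_space \<Rightarrow> 'a)"
  shows "orthogonal_transformation (inv T)" "T (inv T x) = x" "inv T (T x) = x"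
  using orthogonal_transformation_inv[OF T] orthogonal_transformation_bij[OF T]
  by (auto simp: bij_is_surj surj_f_inv_f bij_is_inj)

lemma measurable_grassmannian_image:
  fixes u :: "real^'n" and T :: "real^'n \<Rightarrow> real^'n"
  assumes T: "orthogonal_transformation T"
  shows "(\<lambda>V. T ` V) \<in> measurable (grassmannian_perp_borel u k) (grassmannian_perp_borel (T u) k)"
proof (rule measurable_grassmannianI)
  show "T ` V \<in> grassmannian_perp (T u) k" if "V \<in> space (grassmannian_perp_borel u k)" for V
    using that grassmannian_perp_image[OF _ T] by simp
  fix x
  have lin: "linear T" using T by (simp add: orthogonal_transformation_def)
  then have Tm: "T \<in> borel_measurable borel"
    by (intro borel_measurable_continuous_onI linear_continuous_on linear_conv_bounded_linear[THEN iffD1])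
  have "(\<lambda>V. closest_point V (inv T x)) \<in> borel_measurable (grassmannian_perp_borel u k)"
    by (rule measurable_closest_point_grassmannian[OF measurable_ident_sets[OF refl]]) simp
  from measurable_compose[OF this Tm]
  have "(\<lambda>V. T (closest_point V (inv T x))) \<in> borel_measurable (grassmannian_perp_borel u k)" .
  then show "(\<lambda>V. closest_point (T ` V) x) \<in> borel_measurable (grassmannian_perp_borel u k)"
    by (rule measurable_cong[THEN iffD1, rotated])
       (auto simp: closest_point_orthogonal_image[OF _ T orthogonal_inverse(2)[OF T]] grassmannian_perp_def)
qed

lemma grassmannian_perp_nonempty:
  fixes u :: "real^'n"
  assumes u: "norm u = 1" and k: "k < CARD('n)"
  shows "grassmannian_perp u k \<noteq> {}"
proof -
  let ?H = "{x. u \<bullet> x = 0}"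
  have "u \<noteq> 0" using u by auto
  then have "dim ?H = CARD('n) - 1" by (simp add: dim_hyperplane)
  then have "k \<le> dim ?H" using k by simp
  then obtain V where "subspace V" "V \<subseteq> span ?H" "dim V = k"
    by (rule choose_subspace_of_subspace)
  moreover have "span ?H = ?H" by (simp add: subspace_hyperplane)
  ultimately have "subspace V" "V \<subseteq> ?H" "dim V = k" by auto
  then have "V \<in> grassmannian_perp u k" by (auto simp: grassmannian_perp_def orthogonal_def)
  then show ?thesis by blast
qed

text \<open>
  Choose for each of the two subspaces an orthonormal frame that starts with \<open>u\<close> and continues with a
  basis of the subspace.
\<close>

lemma grassmannian_perp_transitive:
  fixes u :: "real^'n"
  assumes u: "norm u = 1" and V: "V \<in> grassmannian_perp u k" "V' \<in> grassmannian_perp u k"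
  obtains T where "orthogonal_transformation T" "T u = u" "T ` V = V'"
proof -
  obtain b where b: "orthonormal_seq b" "b 0 = u" "span (b ` {1..k}) = V" "k < DIM(real^'n)"
    using adapted_frame[OF u, of V k] V(1) by (auto simp: grassmannian_perp_def)
  obtain c where c: "orthonormal_seq c" "c 0 = u" "span (c ` {1..k}) = V'"
    using adapted_frame[OF u, of V' k] V(2) by (auto simp: grassmannian_perp_def)
  let ?T = "frame_map b c"
  have T: "orthogonal_transformation ?T" by (rule frame_map_orthogonal[OF b(1) c(1)])
  then have lin: "linear ?T" by (simp add: orthogonal_transformation_def)
  have ap: "?T (b i) = c i" if "i < DIM(real^'n)" for i by (rule frame_map_apply[OF b(1) that])
  have "?T ` b ` {1..k} = c ` {1..k}"
    unfolding image_image using ap b(4) by (intro image_cong) auto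
  then have "?T ` V = V'" using b(3) c(3) linear_span_image[OF lin, of "b ` {1..k}"] by simp
  then show ?thesis using that[OF T] ap[of 0] b(2) c(2) by simp
qed

lemma is_haar_perpD:
  assumes "is_haar_perp u k \<nu>"
  shows "sets \<nu> = sets (grassmannian_perp_borel u k)" "space \<nu> = grassmannian_perp u k" "prob_space \<nu>"
    "\<And>T. orthogonal_transformation T \<Longrightarrow> T u = u \<Longrightarrow> distr \<nu> \<nu> (\<lambda>V. T ` V) = \<nu>"
  using assms sets_eq_imp_space_eq[of \<nu> "grassmannian_perp_borel u k"]
  by (auto simp: is_haar_perp_def intro!: prob_spaceI)

text \<open>
  Existence: the image of a fixed subspace \<open>V0\<close> under a random rotation. Uniqueness: if \<open>\<nu>\<close> is invariant,
  integrate the indicator of \<open>h A ` V \<in> E\<close> over \<open>A\<close> and \<open>V\<close>. The integral over \<open>V\<close> is \<open>\<nu> E\<close> for every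
  \<open>A\<close>; the integral over \<open>A\<close> is the same number for every \<open>V\<close>, since \<open>V = T ` V0\<close> for some rotation
  \<open>T\<close>, and \<open>h A \<circ> T\<close> is distributed like \<open>h A\<close>. So \<open>\<nu> E\<close> is expressed by \<open>V0\<close> and the random
  rotation alone.
\<close>

lemma haar_perp_ex1:
  fixes u :: "real^'n"
  assumes u: "norm u = 1" and k: "k < CARD('n)"
  shows "\<exists>!\<nu>. is_haar_perp u k \<nu>"
proof -
  obtain \<mu> :: "(real^'n^'n) measure" and g h where rr: "random_rotation u \<mu> g h"
    using random_rotation_exists[OF u] by blast
  have "prob_space \<mu>"
     and g: "\<And>A. A \<in> space \<mu> \<Longrightarrow> orthogonal_transformation (g A)" "\<And>A. A \<in> space \<mu> \<Longrightarrow> g A u = u"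
       "\<And>A x. A \<in> space \<mu> \<Longrightarrow> h A (g A x) = x" "\<And>A x. A \<in> space \<mu> \<Longrightarrow> g A (h A x) = x"
     and gm: "(\<lambda>(A, x). g A x) \<in> borel_measurable (\<mu> \<Otimes>\<^sub>M (borel :: (real^'n) measure))"
     and hm: "(\<lambda>(A, x). h A x) \<in> borel_measurable (\<mu> \<Otimes>\<^sub>M (borel :: (real^'n) measure))"
     and inv: "\<And>T. orthogonal_transformation T \<Longrightarrow> T u = u \<Longrightarrow>
        (\<exists>\<phi>\<in>measurable \<mu> \<mu>. distr \<mu> \<mu> \<phi> = \<mu> \<and> (\<forall>A\<in>space \<mu>. \<forall>x. g (\<phi> A) x = T (g A x)))"
    using rr unfolding random_rotation_def by blast+
  interpret \<mu>: prob_space \<mu> by fact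
  have gm': "(\<lambda>\<omega>. g (a \<omega>) (y \<omega>)) \<in> borel_measurable M"
    if "a \<in> measurable M \<mu>" "y \<in> borel_measurable M" for M a and y :: "_ \<Rightarrow> real^'n"
    using measurable_compose[OF measurable_Pair[OF that] gm] by simp
  have hm': "(\<lambda>\<omega>. h (a \<omega>) (y \<omega>)) \<in> borel_measurable M"
    if "a \<in> measurable M \<mu>" "y \<in> borel_measurable M" for M a and y :: "_ \<Rightarrow> real^'n"
    using measurable_compose[OF measurable_Pair[OF that] hm] by simp
  let ?G = "grassmannian_perp_borel u k"
  obtain V0 where V0: "V0 \<in> grassmannian_perp u k" using grassmannian_perp_nonempty[OF u k] by blast
  have sub: "subspace V" if "V \<in> grassmannian_perp u k" for V using that by (simp add: grassmannian_perp_def)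
  have ho: "orthogonal_transformation (h A)" "h A u = u" if A: "A \<in> space \<mu>" for A
  proof -
    have "h A = inv (g A)"
      using g(3,4)[OF A] by (metis inv_equality)
    then show "orthogonal_transformation (h A)" using orthogonal_inverse(1)[OF g(1)[OF A]] by simp
    show "h A u = u" using g(2,3)[OF A] by metis
  qed
  have gV0: "(\<lambda>A. g A ` V0) \<in> measurable \<mu> ?G"
  proof (rule measurable_grassmannianI)
    show "g A ` V0 \<in> grassmannian_perp u k" if "A \<in> space \<mu>" for A
      using grassmannian_perp_image[OF V0 g(1)[OF that]] g(2)[OF that] by simp
    fix x
    have cl: "closest_point V0 \<in> borel_measurable borel"
      using linear_closest_point[OF sub[OF V0]]
      by (intro borel_measurable_continuous_onI linear_continuous_on linear_conv_bounded_linear[THEN iffD1])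
    have "(\<lambda>A. g A (closest_point V0 (h A x))) \<in> borel_measurable \<mu>"
      by (intro gm' measurable_compose[OF _ cl] hm') auto
    then show "(\<lambda>A. closest_point (g A ` V0) x) \<in> borel_measurable \<mu>"
      by (rule measurable_cong[THEN iffD1, rotated])
         (use closest_point_orthogonal_image[OF sub[OF V0] g(1) g(4)] in auto)
  qed
  have hV: "(\<lambda>(A, V). h A ` V) \<in> measurable (\<mu> \<Otimes>\<^sub>M \<nu>) ?G" if s: "sets \<nu> = sets ?G" for \<nu>
  proof (rule measurable_grassmannianI)
    have sp: "space \<nu> = grassmannian_perp u k" using sets_eq_imp_space_eq[OF s] by simp
    show "(case p of (A, V) \<Rightarrow> h A ` V) \<in> grassmannian_perp u k" if "p \<in> space (\<mu> \<Otimes>\<^sub>M \<nu>)" for p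
      using that grassmannian_perp_image[OF _ ho(1)] ho(2) by (fastforce simp: space_pair_measure sp)
    fix x
    have snd: "snd \<in> measurable (\<mu> \<Otimes>\<^sub>M \<nu>) ?G"
      using measurable_snd[of \<mu> \<nu>] s by (simp cong: measurable_cong_sets)
    have "(\<lambda>p. h (fst p) (closest_point (snd p) (g (fst p) x))) \<in> borel_measurable (\<mu> \<Otimes>\<^sub>M \<nu>)"
      by (intro hm' measurable_closest_point_grassmannian[OF snd] gm') auto
    then show "(\<lambda>p. closest_point (case p of (A, V) \<Rightarrow> h A ` V) x) \<in> borel_measurable (\<mu> \<Otimes>\<^sub>M \<nu>)"
      by (rule measurable_cong[THEN iffD1, rotated])
         (auto simp: space_pair_measure sp closest_point_orthogonal_image[OF sub ho(1) g(3)])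
  qed
  define \<nu>0 where "\<nu>0 = distr \<mu> ?G (\<lambda>A. g A ` V0)"
  have "is_haar_perp u k \<nu>0"
    unfolding is_haar_perp_def
  proof (intro conjI allI impI)
    show "sets \<nu>0 = sets ?G" by (simp add: \<nu>0_def)
    show "emeasure \<nu>0 (space \<nu>0) = 1"
      using prob_space.emeasure_space_1[OF \<mu>.prob_space_distr[OF gV0]] by (simp add: \<nu>0_def)
    fix T assume "orthogonal_transformation T \<and> T u = u"
    then have T: "orthogonal_transformation T" "T u = u" by auto
    obtain \<phi> where \<phi>: "\<phi> \<in> measurable \<mu> \<mu>" "distr \<mu> \<mu> \<phi> = \<mu>" "\<And>A x. A \<in> space \<mu> \<Longrightarrow> g (\<phi> A) x = T (g A x)"
      using inv[OF T] by blast
    have Tm: "(\<lambda>V. T ` V) \<in> measurable ?G ?G" using measurable_grassmannian_image[OF T(1), of u k] T(2) by simp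
    have "distr \<nu>0 \<nu>0 (\<lambda>V. T ` V) = distr \<nu>0 ?G (\<lambda>V. T ` V)" by (intro distr_cong) (auto simp: \<nu>0_def)
    also have "\<dots> = distr \<mu> ?G (\<lambda>A. T ` (g A ` V0))"
      unfolding \<nu>0_def by (subst distr_distr[OF Tm gV0]) (simp add: comp_def)
    also have "\<dots> = distr \<mu> ?G (\<lambda>A. g (\<phi> A) ` V0)"
      by (intro distr_cong) (auto simp: \<phi>(3) image_image)
    also have "\<dots> = distr (distr \<mu> \<mu> \<phi>) ?G (\<lambda>A. g A ` V0)"
      by (subst distr_distr[OF gV0 \<phi>(1)]) (simp add: comp_def)
    also have "\<dots> = \<nu>0" by (simp add: \<phi>(2) \<nu>0_def)
    finally show "distr \<nu>0 \<nu>0 (\<lambda>V. T ` V) = \<nu>0" .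
  qed
  moreover have "emeasure \<nu> E = emeasure \<mu> {A \<in> space \<mu>. h A ` V0 \<in> E}"
    if \<nu>: "is_haar_perp u k \<nu>" and E: "E \<in> sets ?G" for \<nu> E
  proof -
    note \<nu>D = is_haar_perpD[OF \<nu>]
    interpret \<nu>: prob_space \<nu> by (rule \<nu>D(3))
    interpret P: pair_sigma_finite \<mu> \<nu> ..
    have ind: "(\<lambda>(A, V). indicator E (h A ` V) :: ennreal) \<in> borel_measurable (\<mu> \<Otimes>\<^sub>M \<nu>)"
      using measurable_compose[OF hV[OF \<nu>D(1)] borel_measurable_indicator[OF E]]
      by (rule back_subst[of "\<lambda>f. f \<in> borel_measurable _"]) auto
    \<comment> \<open>Integration over V first: each h A is a rotation about u and preserves the invariant measure.\<close>
    have 1: "(\<integral>\<^sup>+V. indicator E (h A ` V) \<partial>\<nu>) = emeasure \<nu> E" if A: "A \<in> space \<mu>" for A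
    proof -
      have m: "(\<lambda>V. h A ` V) \<in> measurable \<nu> \<nu>"
        using measurable_grassmannian_image[OF ho(1)[OF A], of u k] ho(2)[OF A] \<nu>D(1)
        by (simp cong: measurable_cong_sets)
      have "emeasure \<nu> E = (\<integral>\<^sup>+V. indicator E V \<partial>distr \<nu> \<nu> (\<lambda>V. h A ` V))"
        using \<nu>D(4)[OF ho[OF A]] E \<nu>D(1) by simp
      also have "\<dots> = (\<integral>\<^sup>+V. indicator E (h A ` V) \<partial>\<nu>)"
        using E \<nu>D(1) by (subst nn_integral_distr[OF m]) auto
      finally show ?thesis ..
    qed
    \<comment> \<open>Integration over A first: the value does not depend on V.\<close>
    have 2: "(\<integral>\<^sup>+A. indicator E (h A ` V) \<partial>\<mu>) = emeasure \<mu> {A \<in> space \<mu>. h A ` V0 \<in> E}"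
      if V: "V \<in> space \<nu>" for V
    proof -
      obtain T where T: "orthogonal_transformation T" "T u = u" "T ` V0 = V"
        using grassmannian_perp_transitive[OF u V0, of V] V \<nu>D(2) by auto
      have iT: "orthogonal_transformation (inv T)" "inv T u = u"
        using orthogonal_inverse[OF T(1)] T(2) by (auto, metis)
      obtain \<phi> where \<phi>: "\<phi> \<in> measurable \<mu> \<mu>" "distr \<mu> \<mu> \<phi> = \<mu>" "\<And>A x. A \<in> space \<mu> \<Longrightarrow> g (\<phi> A) x = inv T (g A x)"
        using inv[OF iT] by blast
      have hT: "h A (T x) = h (\<phi> A) x" if A: "A \<in> space \<mu>" for A x
      proof -
        have \<phi>A: "\<phi> A \<in> space \<mu>" using measurable_space[OF \<phi>(1) A] .
        have "g (\<phi> A) (h A (T x)) = x" using \<phi>(3)[OF A] g(4)[OF A] orthogonal_inverse(3)[OF T(1)] by simp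
        then show ?thesis using g(3)[OF \<phi>A] by metis
      qed
      have hV0: "(\<lambda>A. h A ` V0) \<in> measurable \<mu> ?G"
        using measurable_compose[OF measurable_Pair2'[of V0 \<nu> \<mu>] hV[OF \<nu>D(1)]] V0 \<nu>D(2) by simp
      have "(\<integral>\<^sup>+A. indicator E (h A ` V) \<partial>\<mu>) = (\<integral>\<^sup>+A. indicator E (h (\<phi> A) ` V0) \<partial>\<mu>)"
        by (intro nn_integral_cong) (simp add: T(3)[symmetric] image_image hT)
      also have "\<dots> = (\<integral>\<^sup>+A. indicator E (h A ` V0) \<partial>distr \<mu> \<mu> \<phi>)"
        by (subst nn_integral_distr[OF \<phi>(1)]) (use measurable_compose[OF hV0 borel_measurable_indicator[OF E]] in auto)
      also have "\<dots> = (\<integral>\<^sup>+A. indicator {A \<in> space \<mu>. h A ` V0 \<in> E} A \<partial>\<mu>)"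
        unfolding \<phi>(2) by (intro nn_integral_cong) (auto simp: indicator_def)
      also have "\<dots> = emeasure \<mu> {A \<in> space \<mu>. h A ` V0 \<in> E}"
        using measurable_sets[OF hV0 E] by (intro nn_integral_indicator) (simp add: vimage_def Int_def conj_commute)
      finally show ?thesis .
    qed
    have "emeasure \<nu> E = (\<integral>\<^sup>+A. emeasure \<nu> E \<partial>\<mu>)" by (simp add: \<mu>.emeasure_space_1)
    also have "\<dots> = (\<integral>\<^sup>+A. \<integral>\<^sup>+V. indicator E (h A ` V) \<partial>\<nu> \<partial>\<mu>)"
      by (intro nn_integral_cong) (simp add: 1)
    also have "\<dots> = (\<integral>\<^sup>+V. \<integral>\<^sup>+A. indicator E (h A ` V) \<partial>\<mu> \<partial>\<nu>)"
      using P.Fubini'[OF ind] by simp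
    also have "\<dots> = (\<integral>\<^sup>+V. emeasure \<mu> {A \<in> space \<mu>. h A ` V0 \<in> E} \<partial>\<nu>)"
      by (intro nn_integral_cong) (simp add: 2)
    also have "\<dots> = emeasure \<mu> {A \<in> space \<mu>. h A ` V0 \<in> E}" by (simp add: \<nu>.emeasure_space_1)
    finally show ?thesis .
  qed
  then have "\<nu> = \<nu>'" if "is_haar_perp u k \<nu>" "is_haar_perp u k \<nu>'" for \<nu> \<nu>'
    using that by (intro measure_eqI) (auto simp: is_haar_perpD(1))
  ultimately show ?thesis by blast
qed

lemma is_haar_perp_haar_perp:
  fixes u :: "real^'n"
  assumes "norm u = 1" "k < CARD('n)"
  shows "is_haar_perp u k (haar_perp u k)"
  unfolding haar_perp_def by (rule theI'[OF haar_perp_ex1[OF assms]])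

text \<open>
  The image measure is invariant under the conjugate group, so uniqueness identifies it.
\<close>

lemma haar_perp_orthogonal_image:
  fixes u :: "real^'n" and T :: "real^'n \<Rightarrow> real^'n"
  assumes u: "norm u = 1" and k: "k < CARD('n)" and T: "orthogonal_transformation T"
  shows "haar_perp (T u) k = distr (haar_perp u k) (grassmannian_perp_borel (T u) k) (\<lambda>V. T ` V)"
proof -
  let ?\<nu> = "haar_perp u k" and ?G = "grassmannian_perp_borel u k" and ?G' = "grassmannian_perp_borel (T u) k"
  note \<nu>D = is_haar_perpD[OF is_haar_perp_haar_perp[OF u k]]
  interpret prob_space ?\<nu> by (rule \<nu>D(3))
  have lin: "linear T" using T by (simp add: orthogonal_transformation_def)
  note Ti = orthogonal_inverse[OF T]
  have Tm: "(\<lambda>V. T ` V) \<in> measurable ?\<nu> ?G'"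
    using measurable_grassmannian_image[OF T, of u k] \<nu>D(1) by (simp cong: measurable_cong_sets)
  let ?D = "distr ?\<nu> ?G' (\<lambda>V. T ` V)"
  have "is_haar_perp (T u) k ?D"
    unfolding is_haar_perp_def
  proof (intro conjI allI impI)
    show "emeasure ?D (space ?D) = 1"
      using prob_space.emeasure_space_1[OF prob_space_distr[OF Tm]] .
    fix S assume "orthogonal_transformation S \<and> S (T u) = T u"
    then have S: "orthogonal_transformation S" "S (T u) = T u" by auto
    \<comment> \<open>Conjugating by T turns a rotation about T u into one about u.\<close>
    let ?R = "inv T \<circ> S \<circ> T"
    have R: "orthogonal_transformation ?R" "?R u = u"
      using S T Ti by (auto intro!: orthogonal_transformation_compose)
    have Sm: "(\<lambda>V. S ` V) \<in> measurable ?G' ?G'" using measurable_grassmannian_image[OF S(1), of "T u" k] S(2) by simp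
    have Rm: "(\<lambda>V. ?R ` V) \<in> measurable ?\<nu> ?\<nu>"
      using measurable_grassmannian_image[OF R(1), of u k] R(2) \<nu>D(1) by (simp cong: measurable_cong_sets)
    have "distr ?D ?D (\<lambda>V. S ` V) = distr ?D ?G' (\<lambda>V. S ` V)" by (intro distr_cong) auto
    also have "\<dots> = distr ?\<nu> ?G' (\<lambda>V. S ` T ` V)" by (subst distr_distr[OF Sm Tm]) (simp add: comp_def)
    also have "\<dots> = distr ?\<nu> ?G' (\<lambda>V. T ` (?R ` V))"
      by (intro distr_cong) (auto simp: image_image Ti comp_def)
    also have "\<dots> = distr (distr ?\<nu> ?\<nu> (\<lambda>V. ?R ` V)) ?G' (\<lambda>V. T ` V)"
      by (subst distr_distr[OF Tm Rm]) (simp add: comp_def)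
    also have "\<dots> = ?D" by (simp only: \<nu>D(4)[OF R])
    finally show "distr ?D ?D (\<lambda>V. S ` V) = ?D" .
  qed simp
  moreover have "norm (T u) = 1" using u orthogonal_transformation_norm[OF T] by simp
  ultimately show ?thesis using haar_perp_ex1[of "T u" k] is_haar_perp_haar_perp[of "T u" k] k by blast
qed

section \<open>Volumes of linear sections\<close>

lemma pairwise_orthonormal_inner:
  assumes "pairwise orthogonal D" "\<forall>b\<in>D. norm b = 1" "b \<in> D" "c \<in> D"
  shows "b \<bullet> c = (if b = c then 1 else 0)"
  using assms by (auto simp: pairwise_def orthogonal_def norm_eq_1)

lemma distr_PiM_lborel_reindex:
  assumes \<beta>: "bij_betw \<beta> I D" and fin: "finite I"
  shows "distr (\<Pi>\<^sub>M b\<in>D. (lborel :: real measure)) (\<Pi>\<^sub>M i\<in>I. lborel) (\<lambda>f. \<lambda>i\<in>I. f (\<beta> i)) = (\<Pi>\<^sub>M i\<in>I. lborel)"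
proof -
  interpret D: product_sigma_finite "\<lambda>_. lborel :: real measure" ..
  show ?thesis
  proof (rule D.PiM_eqI)
    have fD: "finite D" using \<beta> fin bij_betw_finite by blast
    have \<beta>D: "\<And>i. i \<in> I \<Longrightarrow> \<beta> i \<in> D" using \<beta> by (auto simp: bij_betw_def)
    interpret DD: finite_product_sigma_finite "\<lambda>_. lborel :: real measure" D by standard (fact fD)
    show "finite I" by fact
    show "sets (distr (\<Pi>\<^sub>M b\<in>D. (lborel :: real measure)) (\<Pi>\<^sub>M i\<in>I. lborel) (\<lambda>f. \<lambda>i\<in>I. f (\<beta> i)))
       = sets (\<Pi>\<^sub>M i\<in>I. (lborel :: real measure))" by simp
    have m: "(\<lambda>f. \<lambda>i\<in>I. f (\<beta> i)) \<in> measurable (\<Pi>\<^sub>M b\<in>D. (lborel :: real measure)) (\<Pi>\<^sub>M i\<in>I. lborel)"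
      by (intro measurable_restrict measurable_component_singleton \<beta>D)
    fix A :: "_ \<Rightarrow> real set" assume A: "\<And>i. i \<in> I \<Longrightarrow> A i \<in> sets lborel"
    let ?inv = "inv_into I \<beta>"
    have inv: "?inv (\<beta> i) = i" if "i \<in> I" for i using bij_betw_inv_into_left[OF \<beta> that] .
    have inv': "?inv b \<in> I" "\<beta> (?inv b) = b" if "b \<in> D" for b
      using bij_betw_inv_into_right[OF \<beta> that] bij_betw_inv_into[OF \<beta>] that by (auto simp: bij_betw_def)
    have pre: "(\<lambda>f. \<lambda>i\<in>I. f (\<beta> i)) -` Pi\<^sub>E I A \<inter> space (\<Pi>\<^sub>M b\<in>D. (lborel :: real measure)) = Pi\<^sub>E D (\<lambda>b. A (?inv b))"
    proof (intro equalityI subsetI)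
      fix f assume f: "f \<in> (\<lambda>f. \<lambda>i\<in>I. f (\<beta> i)) -` Pi\<^sub>E I A \<inter> space (\<Pi>\<^sub>M b\<in>D. (lborel :: real measure))"
      then have 1: "f (\<beta> i) \<in> A i" if "i \<in> I" for i using that by (auto simp: PiE_iff)
      have "f b \<in> A (?inv b)" if "b \<in> D" for b using 1[of "?inv b"] inv'[OF that] by simp
      then show "f \<in> Pi\<^sub>E D (\<lambda>b. A (?inv b))" using f by (auto simp: space_PiM PiE_iff)
    next
      fix f assume f: "f \<in> Pi\<^sub>E D (\<lambda>b. A (?inv b))"
      then have "f (\<beta> i) \<in> A i" if "i \<in> I" for i
        using \<beta>D[OF that] inv[OF that] by (metis PiE_mem)
      then show "f \<in> (\<lambda>f. \<lambda>i\<in>I. f (\<beta> i)) -` Pi\<^sub>E I A \<inter> space (\<Pi>\<^sub>M b\<in>D. (lborel :: real measure))"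
        using f by (auto simp: space_PiM PiE_iff)
    qed
    have "emeasure (distr (\<Pi>\<^sub>M b\<in>D. (lborel :: real measure)) (\<Pi>\<^sub>M i\<in>I. lborel) (\<lambda>f. \<lambda>i\<in>I. f (\<beta> i))) (Pi\<^sub>E I A)
       = emeasure (\<Pi>\<^sub>M b\<in>D. (lborel :: real measure)) (Pi\<^sub>E D (\<lambda>b. A (?inv b)))"
      using A fin by (subst emeasure_distr[OF m]) (auto simp: pre intro!: sets_PiM_I_finite)
    also have "\<dots> = (\<Prod>b\<in>D. emeasure lborel (A (?inv b)))"
      using A inv' by (intro DD.measure_times) auto
    also have "\<dots> = (\<Prod>i\<in>I. emeasure lborel (A i))"
      using prod.reindex_bij_betw[OF \<beta>, of "\<lambda>b. emeasure lborel (A (?inv b))"] inv by simp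
    finally show "emeasure (distr (\<Pi>\<^sub>M b\<in>D. (lborel :: real measure)) (\<Pi>\<^sub>M i\<in>I. lborel) (\<lambda>f. \<lambda>i\<in>I. f (\<beta> i))) (Pi\<^sub>E I A)
       = (\<Prod>i\<in>I. emeasure lborel (A i))" .
  qed
qed

lemma measurable_basis_combination:
  fixes D :: "'a::euclidean_space set"
  shows "(\<lambda>f. \<Sum>b\<in>D. f b *\<^sub>R b) \<in> borel_measurable (\<Pi>\<^sub>M b\<in>D. (lborel :: real measure))"
proof (intro borel_measurable_sum borel_measurable_scaleR measurable_const)
  fix b assume "b \<in> D"
  then have "(\<lambda>f. f b) \<in> measurable (\<Pi>\<^sub>M b\<in>D. (lborel :: real measure)) lborel"
    by (rule measurable_component_singleton)
  then show "(\<lambda>f. f b) \<in> borel_measurable (\<Pi>\<^sub>M b\<in>D. (lborel :: real measure))" by simp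
qed simp

text \<open>
  The product measure over the standard basis is carried to the product over \<open>D\<close> by the orthogonal map
  that takes one basis to the other.
\<close>

lemma lborel_eq_orthonormal:
  fixes D :: "'a::euclidean_space set"
  assumes D: "pairwise orthogonal D" "\<forall>b\<in>D. norm b = 1" "finite D" "card D = DIM('a)"
  shows "lborel = distr (\<Pi>\<^sub>M b\<in>D. lborel) borel (\<lambda>f. \<Sum>b\<in>D. f b *\<^sub>R b)"
proof -
  obtain \<beta> where \<beta>: "bij_betw \<beta> (Basis :: 'a set) D"
    using finite_same_card_bij[of "Basis :: 'a set" D] D(3,4) by auto
  have \<beta>D: "\<And>i. i \<in> Basis \<Longrightarrow> \<beta> i \<in> D" using \<beta> by (auto simp: bij_betw_def)
  define T where "T x = (\<Sum>i\<in>Basis. (x \<bullet> i) *\<^sub>R \<beta> i)" for x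
  have T: "orthogonal_transformation T"
    unfolding orthogonal_transformation_def
  proof (intro conjI allI)
    show "linear T"
      by (rule linearI) (auto simp: T_def inner_add_left scaleR_left_distrib sum.distrib scaleR_sum_right)
    fix v w
    have "T v \<bullet> T w = (\<Sum>i\<in>Basis. \<Sum>j\<in>Basis. if i = j then (v \<bullet> i) * (w \<bullet> j) else 0)"
      unfolding T_def unfolding inner_sum_left unfolding inner_sum_right
    proof (intro sum.cong refl)
      fix i j :: 'a assume ij: "i \<in> Basis" "j \<in> Basis"
      then have "\<beta> i = \<beta> j \<longleftrightarrow> i = j" using \<beta> by (auto simp: bij_betw_def inj_on_eq_iff)
      then show "(v \<bullet> i) *\<^sub>R \<beta> i \<bullet> (w \<bullet> j) *\<^sub>R \<beta> j = (if i = j then (v \<bullet> i) * (w \<bullet> j) else 0)"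
        using pairwise_orthonormal_inner[OF D(1,2) \<beta>D[OF ij(1)] \<beta>D[OF ij(2)]] by simp
    qed
    also have "\<dots> = v \<bullet> w" by (simp add: sum.delta euclidean_inner[of v w])
    finally show "T v \<bullet> T w = v \<bullet> w" .
  qed
  let ?S = "\<lambda>f. \<Sum>i\<in>(Basis :: 'a set). f i *\<^sub>R i"
  have lin: "linear T" using T by (simp add: orthogonal_transformation_def)
  then have Tm: "T \<in> borel_measurable borel"
    by (intro borel_measurable_continuous_onI linear_continuous_on linear_conv_bounded_linear[THEN iffD1])
  have Tb: "T i = \<beta> i" if "i \<in> Basis" for i
  proof -
    have "T i = (\<Sum>j\<in>Basis. if j = i then \<beta> j else 0)"
      unfolding T_def using that by (intro sum.cong) (auto simp: inner_Basis)
    then show ?thesis using that by simp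
  qed
  let ?r = "\<lambda>f. \<lambda>i\<in>(Basis :: 'a set). f (\<beta> i) :: real"
  have rm: "?r \<in> measurable (\<Pi>\<^sub>M b\<in>D. (lborel :: real measure)) (\<Pi>\<^sub>M i\<in>Basis. lborel)"
    by (intro measurable_restrict measurable_component_singleton \<beta>D)
  have Sm: "?S \<in> borel_measurable (\<Pi>\<^sub>M b\<in>Basis. lborel)" by (rule measurable_basis_combination)
  have "lborel = distr (lborel :: 'a measure) borel T" by (rule distr_lborel_orthogonal[OF T, symmetric])
  also have "\<dots> = distr (distr (\<Pi>\<^sub>M b\<in>Basis. lborel) borel ?S) borel T" by (simp add: lborel_eq[symmetric])
  also have "\<dots> = distr (\<Pi>\<^sub>M b\<in>Basis. lborel) borel (T \<circ> ?S)" by (rule distr_distr[OF Tm Sm])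
  also have "\<dots> = distr (distr (\<Pi>\<^sub>M b\<in>D. lborel) (\<Pi>\<^sub>M i\<in>Basis. lborel) ?r) borel (T \<circ> ?S)"
    by (simp add: distr_PiM_lborel_reindex[OF \<beta>])
  also have "\<dots> = distr (\<Pi>\<^sub>M b\<in>D. lborel) borel ((T \<circ> ?S) \<circ> ?r)"
    by (rule distr_distr[OF measurable_comp[OF Sm Tm] rm])
  also have "(T \<circ> ?S) \<circ> ?r = (\<lambda>f. \<Sum>b\<in>D. f b *\<^sub>R b)"
  proof
    fix f
    have "((T \<circ> ?S) \<circ> ?r) f = (\<Sum>i\<in>Basis. f (\<beta> i) *\<^sub>R \<beta> i)"
      by (simp add: linear_sum[OF lin] linear_scale[OF lin] Tb)
    then show "((T \<circ> ?S) \<circ> ?r) f = (\<Sum>b\<in>D. f b *\<^sub>R b)"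
      using sum.reindex_bij_betw[OF \<beta>, of "\<lambda>b. f b *\<^sub>R b"] by simp
  qed
  finally show ?thesis .
qed

text \<open>
  For the orthogonal projection \<open>p\<close> onto \<open>\<xi>\<close>: the points within distance \<open>r\<close> of \<open>\<xi>\<close> that project
  into \<open>A\<close>.
\<close>

definition slab :: "('a::euclidean_space \<Rightarrow> 'a) \<Rightarrow> 'a set \<Rightarrow> real \<Rightarrow> 'a set" where
  "slab p A r = {x. p x \<in> A \<and> norm (x - p x) \<le> r}"

lemma linear_slab_borel:
  assumes "linear p" "A \<in> sets borel"
  shows "slab p A r \<in> sets borel"
proof -
  have "p \<in> borel_measurable borel" using assms(1)
    by (intro borel_measurable_continuous_onI linear_continuous_on linear_conv_bounded_linear[THEN iffD1])
  then show ?thesis unfolding slab_def using assms(2) by measurable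
qed

text \<open>
  In an orthonormal basis adapted to \<open>\<xi>\<close> and its orthogonal complement the slab is the product of \<open>A\<close>
  with a ball of radius \<open>r\<close>.
\<close>

lemma emeasure_subspace_lborel_slab:
  fixes \<xi> :: "'a::euclidean_space set"
  assumes \<xi>: "subspace \<xi>" and A: "A \<in> sets borel" and r: "0 < r"
  shows "emeasure lborel (slab (closest_point \<xi>) A r)
     = emeasure (subspace_lborel \<xi>) A * ennreal (unit_ball_vol (real (DIM('a) - dim \<xi>)) * r ^ (DIM('a) - dim \<xi>))"
proof -
  define B where "B = (SOME B. orthonormal_basis_of \<xi> B)"
  have "\<exists>B. orthonormal_basis_of \<xi> B"
    by (rule orthonormal_basis_subspace[OF \<xi>]) (auto simp: orthonormal_basis_of_def)
  then have "orthonormal_basis_of \<xi> B" unfolding B_def by (rule someI_ex)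
  then have B: "pairwise orthogonal B" "\<forall>b\<in>B. norm b = 1" "span B = \<xi>" by (auto simp: orthonormal_basis_of_def)
  have "0 \<notin> B" using B(2) by force
  then have iB: "independent B" using B(1) pairwise_orthogonal_independent by blast
  then have fB: "finite B" by (rule independent_imp_finite)
  have cB: "card B = dim \<xi>" using iB B(3) by (metis dim_span_eq_card_independent)
  define \<eta> where "\<eta> = {y \<in> UNIV. \<forall>x\<in>\<xi>. orthogonal x y}"
  have s\<eta>: "subspace \<eta>" by (auto simp: \<eta>_def subspace_def orthogonal_def inner_add_right)
  have d\<eta>: "dim \<eta> + dim \<xi> = DIM('a)"
    unfolding \<eta>_def using dim_subspace_orthogonal_to_vectors[OF \<xi> subspace_UNIV] by simp
  obtain C where C: "C \<subseteq> \<eta>" "pairwise orthogonal C" "\<And>x. x \<in> C \<Longrightarrow> norm x = 1"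
      "independent C" "card C = dim \<eta>" "span C = \<eta>"
    by (rule orthonormal_basis_subspace[OF s\<eta>]) blast
  have fC: "finite C" using C(4) by (rule independent_imp_finite)
  have BC: "orthogonal b c" if "b \<in> B" "c \<in> C" for b c
    using that B(3) C(1) by (auto simp: \<eta>_def span_base)
  have disj: "B \<inter> C = {}"
  proof (rule ccontr)
    assume "B \<inter> C \<noteq> {}"
    then obtain b where "b \<in> B" "b \<in> C" by blast
    then show False using BC[of b b] C(3)[of b] by (simp add: orthogonal_self)
  qed
  let ?D = "B \<union> C"
  have CB: "orthogonal c b" if "b \<in> B" "c \<in> C" for b c using BC[OF that] orthogonal_commute by blast
  have D: "pairwise orthogonal ?D" "\<forall>b\<in>?D. norm b = 1" "finite ?D" "card ?D = DIM('a)"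
    using B C fB fC BC CB disj d\<eta> cB by (auto simp: pairwise_def card_Un_disjoint)
  have sB: "(\<Sum>b\<in>B. f b *\<^sub>R b) \<in> \<xi>" for f
    unfolding B(3)[symmetric] by (intro span_sum span_scale span_base)
  have sC: "(\<Sum>c\<in>C. f c *\<^sub>R c) \<in> \<eta>" for f
    unfolding C(6)[symmetric] by (intro span_sum span_scale span_base)
  have split: "(\<Sum>b\<in>?D. f b *\<^sub>R b) = (\<Sum>b\<in>B. f b *\<^sub>R b) + (\<Sum>c\<in>C. f c *\<^sub>R c)" for f
    by (rule sum.union_disjoint[OF fB fC disj])
  have cp: "closest_point \<xi> (\<Sum>b\<in>?D. f b *\<^sub>R b) = (\<Sum>b\<in>B. f b *\<^sub>R b)" for f
  proof (rule subspace_closest_point_unique[OF \<xi> sB])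
    fix z assume "z \<in> \<xi>"
    then show "((\<Sum>b\<in>?D. f b *\<^sub>R b) - (\<Sum>b\<in>B. f b *\<^sub>R b)) \<bullet> z = 0"
      using sC[of f] by (auto simp: split \<eta>_def orthogonal_def inner_commute)
  qed
  have nC: "norm (\<Sum>c\<in>C. f c *\<^sub>R c) = sqrt (\<Sum>c\<in>C. (f c)\<^sup>2)" for f
  proof -
    have "(norm (\<Sum>c\<in>C. f c *\<^sub>R c))\<^sup>2 = (\<Sum>c\<in>C. (norm (f c *\<^sub>R c))\<^sup>2)"
      by (rule norm_sum_Pythagorean[OF fC])
         (use C(2) in \<open>auto simp: pairwise_def orthogonal_clauses\<close>)
    also have "\<dots> = (\<Sum>c\<in>C. (f c)\<^sup>2)" using C(3) by (intro sum.cong) auto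
    finally show ?thesis by (metis norm_ge_zero real_sqrt_unique)
  qed
  interpret P: product_sigma_finite "\<lambda>_. lborel :: real measure" ..
  interpret PB: finite_product_sigma_finite "\<lambda>_. lborel :: real measure" B by standard (fact fB)
  interpret PC: finite_product_sigma_finite "\<lambda>_. lborel :: real measure" C by standard (fact fC)
  let ?X = "slab (closest_point \<xi>) A r"
  have X: "?X \<in> sets borel" by (rule linear_slab_borel[OF linear_closest_point[OF \<xi>] A])
  let ?MB = "\<Pi>\<^sub>M b\<in>B. (lborel :: real measure)" and ?MC = "\<Pi>\<^sub>M b\<in>C. (lborel :: real measure)"
    and ?MD = "\<Pi>\<^sub>M b\<in>?D. (lborel :: real measure)"
  let ?E = "(\<lambda>f. \<Sum>b\<in>B. f b *\<^sub>R b) -` A \<inter> space ?MB"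
  let ?F = "{f. sqrt (\<Sum>i\<in>C. (f i)\<^sup>2) \<le> r} \<inter> space ?MC"
  have E: "?E \<in> sets ?MB" using measurable_sets[OF measurable_basis_combination A] .
  have F: "?F \<in> sets ?MC"
  proof -
    have "{f \<in> space ?MC. sqrt (\<Sum>i\<in>C. (f i)\<^sup>2) \<le> r} \<in> sets ?MC" by measurable
    then show ?thesis by (simp add: Int_def conj_commute)
  qed
  let ?SD = "\<lambda>f. \<Sum>b\<in>?D. f b *\<^sub>R b"
  have preX: "?SD -` ?X \<inter> space ?MD \<in> sets ?MD"
    using measurable_sets[OF measurable_basis_combination X] .
  have "emeasure lborel ?X = emeasure (distr ?MD borel ?SD) ?X" using lborel_eq_orthonormal[OF D] by simp
  also have "\<dots> = emeasure ?MD (?SD -` ?X \<inter> space ?MD)"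
    using X by (intro emeasure_distr measurable_basis_combination) auto
  also have "\<dots> = emeasure (distr (?MB \<Otimes>\<^sub>M ?MC) ?MD (merge B C)) (?SD -` ?X \<inter> space ?MD)"
    by (simp add: P.distr_merge[OF disj fB fC])
  also have "\<dots> = emeasure (?MB \<Otimes>\<^sub>M ?MC) (merge B C -` (?SD -` ?X \<inter> space ?MD) \<inter> space (?MB \<Otimes>\<^sub>M ?MC))"
    using preX by (intro emeasure_distr measurable_merge)
  also have "merge B C -` (?SD -` ?X \<inter> space ?MD) \<inter> space (?MB \<Otimes>\<^sub>M ?MC) = ?E \<times> ?F"
  proof -
    have SB: "(\<Sum>b\<in>B. merge B C (f, g) b *\<^sub>R b) = (\<Sum>b\<in>B. f b *\<^sub>R b)" for f g :: "'a \<Rightarrow> real"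
      by (intro sum.cong) (auto simp: merge_def)
    have SC: "(\<Sum>b\<in>C. merge B C (f, g) b *\<^sub>R b) = (\<Sum>b\<in>C. g b *\<^sub>R b)" for f g :: "'a \<Rightarrow> real"
      using disj by (intro sum.cong) (auto simp: merge_def)
    have "?SD (merge B C (f, g)) \<in> ?X \<longleftrightarrow> (\<Sum>b\<in>B. f b *\<^sub>R b) \<in> A \<and> sqrt (\<Sum>i\<in>C. (g i)\<^sup>2) \<le> r" for f g
      unfolding slab_def mem_Collect_eq cp SB by (simp add: split SB SC nC)
    moreover have "merge B C (f, g) \<in> space ?MD" if "f \<in> space ?MB" "g \<in> space ?MC" for f g
      using measurable_space[OF measurable_merge, of "(f, g)" B "\<lambda>_. lborel" C] that
      by (simp add: space_pair_measure)
    ultimately show ?thesis by (auto simp: space_pair_measure)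
  qed
  also have "emeasure (?MB \<Otimes>\<^sub>M ?MC) (?E \<times> ?F) = emeasure ?MB ?E * emeasure ?MC ?F"
    by (rule PC.emeasure_pair_measure_Times[OF E F])
  also have "emeasure ?MC ?F = ennreal (unit_ball_vol (real (DIM('a) - dim \<xi>)) * r ^ (DIM('a) - dim \<xi>))"
  proof -
    have "card C = DIM('a) - dim \<xi>" using C(5) d\<eta> by linarith
    then show ?thesis using emeasure_cball_aux[OF fC r] by simp
  qed
  also have "emeasure ?MB ?E = emeasure (subspace_lborel \<xi>) A"
    unfolding subspace_lborel_def B_def[symmetric] Let_def
    using A by (intro emeasure_distr[symmetric] measurable_basis_combination) auto
  finally show ?thesis .
qed

lemma subspace_vol_eq_slab:
  fixes \<xi> :: "'a::euclidean_space set"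
  assumes \<xi>: "subspace \<xi>" and K: "K \<in> sets borel" and r: "0 < r"
  shows "subspace_vol \<xi> (K \<inter> \<xi>) * (unit_ball_vol (real (DIM('a) - dim \<xi>)) * r ^ (DIM('a) - dim \<xi>))
     = measure lborel (slab (closest_point \<xi>) K r)"
proof -
  have "closed \<xi>" using \<xi> by (rule closed_subspace)
  then have A: "K \<inter> \<xi> \<in> sets borel" using K by auto
  have eq: "slab (closest_point \<xi>) (K \<inter> \<xi>) r = slab (closest_point \<xi>) K r"
    using subspace_closest_point(1)[OF \<xi>] by (auto simp: slab_def)
  have "measure lborel (slab (closest_point \<xi>) K r)
      = enn2real (emeasure (subspace_lborel \<xi>) (K \<inter> \<xi>)) *
        enn2real (ennreal (unit_ball_vol (real (DIM('a) - dim \<xi>)) * r ^ (DIM('a) - dim \<xi>)))"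
    unfolding measure_def eq[symmetric] emeasure_subspace_lborel_slab[OF \<xi> A r] by (rule enn2real_mult)
  also have "enn2real (ennreal (unit_ball_vol (real (DIM('a) - dim \<xi>)) * r ^ (DIM('a) - dim \<xi>)))
      = unit_ball_vol (real (DIM('a) - dim \<xi>)) * r ^ (DIM('a) - dim \<xi>)"
    using r by (intro enn2real_ennreal mult_nonneg_nonneg) auto
  finally show ?thesis unfolding subspace_vol_def measure_def by simp
qed

lemma slab_1_scale:
  fixes K :: "'a::euclidean_space set"
  assumes p: "linear p" and s: "0 < s"
  shows "(\<lambda>x. s *\<^sub>R x) -` slab p ((\<lambda>x. s *\<^sub>R x) ` K) s = slab p K 1"
proof -
  have "p (s *\<^sub>R x) \<in> (\<lambda>x. s *\<^sub>R x) ` K \<longleftrightarrow> p x \<in> K" for x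
    using s by (auto simp: linear_scale[OF p])
  moreover have "norm (s *\<^sub>R x - p (s *\<^sub>R x)) = s * norm (x - p x)" for x
    using s by (simp add: linear_scale[OF p] scaleR_right_diff_distrib[symmetric])
  ultimately show ?thesis using s by (auto simp: slab_def)
qed

text \<open>
  Dilate the slab: its volume scales with exponent \<open>n\<close>, the factor in the complement of \<open>\<xi>\<close> with
  exponent \<open>n - dim \<xi>\<close>.
\<close>

lemma subspace_vol_scale:
  fixes \<xi> :: "'a::euclidean_space set"
  assumes \<xi>: "subspace \<xi>" and K: "closed K" and s: "0 < s"
  shows "subspace_vol \<xi> ((\<lambda>x. s *\<^sub>R x) ` K \<inter> \<xi>) = s ^ dim \<xi> * subspace_vol \<xi> (K \<inter> \<xi>)"
proof -
  let ?n = "DIM('a)" and ?p = "closest_point \<xi>" and ?sK = "(\<lambda>x. s *\<^sub>R x) ` K"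
  let ?w = "unit_ball_vol (real (?n - dim \<xi>))"
  have lin: "linear ?p" by (rule linear_closest_point[OF \<xi>])
  have Kb: "K \<in> sets borel" "?sK \<in> sets borel" using K closed_scaling[OF K] by auto
  have w: "?w \<noteq> 0" using less_imp_neq[OF unit_ball_vol_pos[of "real (?n - dim \<xi>)"]] by simp
  have dn: "dim \<xi> \<le> ?n" by (rule dim_subset_UNIV)
  have "subspace_vol \<xi> (K \<inter> \<xi>) * ?w = measure lborel (slab ?p K 1)"
    using subspace_vol_eq_slab[OF \<xi> Kb(1), of 1] by simp
  also have "\<dots> = measure lborel ((\<lambda>x. s *\<^sub>R x) -` slab ?p ?sK s)" by (simp add: slab_1_scale[OF lin s])
  also have "\<dots> = (1/s) ^ ?n * measure lborel (slab ?p ?sK s)"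
    unfolding measure_def emeasure_lborel_image_scaleR[OF s linear_slab_borel[OF lin Kb(2)]] enn2real_mult
    using s by simp
  also have "\<dots> = (1/s) ^ ?n * (subspace_vol \<xi> (?sK \<inter> \<xi>) * (?w * s ^ (?n - dim \<xi>)))"
    using subspace_vol_eq_slab[OF \<xi> Kb(2) s] by simp
  also have "\<dots> = ((1/s) ^ ?n * s ^ (?n - dim \<xi>)) * subspace_vol \<xi> (?sK \<inter> \<xi>) * ?w" by (simp only: mult_ac)
  also have "(1/s) ^ ?n * s ^ (?n - dim \<xi>) = (1/s) ^ dim \<xi>"
  proof -
    have "(1/s) ^ ?n = (1/s) ^ dim \<xi> * (1/s) ^ (?n - dim \<xi>)" using dn by (simp add: power_add[symmetric])
    then show ?thesis using s by (simp add: power_mult_distrib[symmetric] mult.assoc)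
  qed
  finally have "subspace_vol \<xi> (K \<inter> \<xi>) = (1/s) ^ dim \<xi> * subspace_vol \<xi> (?sK \<inter> \<xi>)" using w by simp
  then show ?thesis using s by (simp add: power_one_over)
qed

lemma slab_bounded:
  assumes "K \<subseteq> cball 0 \<rho>" shows "slab p K r \<subseteq> cball 0 (\<rho> + r)"
proof
  fix x assume "x \<in> slab p K r"
  then have "norm (p x) \<le> \<rho>" "norm (x - p x) \<le> r" using assms by (auto simp: slab_def)
  then have "norm x \<le> \<rho> + r" using norm_triangle_sub[of x "p x"] by linarith
  then show "x \<in> cball 0 (\<rho> + r)" by simp
qed

lemma measure_slab_le:
  fixes K :: "'a::euclidean_space set"
  assumes "K \<subseteq> cball 0 \<rho>"
  shows "measure lborel (slab p K r) \<le> measure lborel (cball (0::'a) (\<rho> + r))"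
proof (cases "slab p K r \<in> sets lborel")
  case True
  then show ?thesis
    by (intro measure_mono_fmeasurable slab_bounded[OF assms]) (auto intro!: fmeasurableI simp: emeasure_lborel_cball_finite[unfolded infinity_ennreal_def])
qed (simp add: measure_notin_sets)

text \<open>
  Dominated convergence in the whole space, where the integration domain does not depend on the section.
\<close>

lemma measure_slab_tendsto:
  fixes K :: "'a::euclidean_space set"
  assumes p: "linear p" and K: "K \<in> sets borel" "\<And>j. Kj j \<in> sets borel" and b: "\<And>j. Kj j \<subseteq> cball 0 \<rho>"
    and conv: "AE x in lborel. \<forall>\<^sub>F j in sequentially. p x \<in> Kj j \<longleftrightarrow> p x \<in> K"
  shows "(\<lambda>j. measure lborel (slab p (Kj j) r)) \<longlonglongrightarrow> measure lborel (slab p K r)"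
proof -
  have "(\<lambda>j. LINT x|lborel. indicat_real (slab p (Kj j) r) x) \<longlonglongrightarrow> (LINT x|lborel. indicat_real (slab p K r) x)"
  proof (rule integral_dominated_convergence[where w = "indicat_real (cball (0::'a) (\<rho> + r))"])
    show "integrable lborel (indicat_real (cball (0::'a) (\<rho> + r)))"
      using emeasure_lborel_cball_finite[of "0::'a" "\<rho> + r"] by (intro integrable_real_indicator) auto
    show "AE x in lborel. (\<lambda>j. indicat_real (slab p (Kj j) r) x) \<longlonglongrightarrow> indicat_real (slab p K r) x"
      using conv
    proof eventually_elim
      case (elim x)
      then show ?case
        by (intro tendsto_eventually eventually_mono[OF elim]) (simp add: slab_def indicator_def)
    qed
    show "AE x in lborel. norm (indicat_real (slab p (Kj j) r) x) \<le> indicat_real (cball 0 (\<rho> + r)) x" for j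
      using slab_bounded[OF b[of j], of p r] by (intro AE_I2) (auto simp: indicator_def)
  qed (use linear_slab_borel[OF p K(1)] linear_slab_borel[OF p K(2)] in auto)
  then show ?thesis using linear_slab_borel[OF p K(1)] linear_slab_borel[OF p K(2)] by simp
qed

text \<open>
  A lower bound that is uniform in the subspace \<open>\<xi>\<close> through \<open>y\<close>.
\<close>

lemma measure_slab_ball_ge:
  fixes K :: "'a::euclidean_space set"
  assumes \<xi>: "subspace \<xi>" and y: "y \<in> \<xi>" "ball y \<delta> \<subseteq> K" "\<delta> \<le> 1"
    and K: "K \<in> sets borel" "K \<subseteq> cball 0 \<rho>"
  shows "measure lborel (ball y \<delta>) \<le> measure lborel (slab (closest_point \<xi>) K 1)"
proof (rule measure_mono_fmeasurable)
  let ?p = "closest_point \<xi>"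
  have lin: "linear ?p" by (rule linear_closest_point[OF \<xi>])
  have sm: "slab ?p K 1 \<in> sets borel" by (rule linear_slab_borel[OF lin K(1)])
  show "ball y \<delta> \<subseteq> slab ?p K 1"
  proof
    fix x assume "x \<in> ball y \<delta>"
    then have d: "norm (x - y) < \<delta>" by (simp add: dist_norm norm_minus_commute)
    have py: "?p y = y" using \<xi> y(1) by (intro closest_point_self)
    have o: "(x - ?p x) \<bullet> (?p x - y) = 0"
      using subspace_closest_point[OF \<xi>] \<xi> y(1) by (meson subspace_diff)
    then have "(norm (x - y))\<^sup>2 = (norm (x - ?p x))\<^sup>2 + (norm (?p x - y))\<^sup>2"
      using norm_add_Pythagorean[of "x - ?p x" "?p x - y"] by (simp add: orthogonal_def)
    then have "norm (x - ?p x) \<le> norm (x - y)" "norm (?p x - y) \<le> norm (x - y)"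
      by (auto intro: power2_le_imp_le)
    then have "norm (x - ?p x) \<le> 1" "?p x \<in> ball y \<delta>" using d y(3) by (auto simp: dist_norm norm_minus_commute)
    then show "x \<in> slab ?p K 1" using y(2) by (auto simp: slab_def)
  qed
  show "slab ?p K 1 \<in> fmeasurable lborel"
    using slab_bounded[OF K(2), of ?p 1] sm
    by (intro fmeasurableI2[OF fmeasurableI[of "cball 0 (\<rho> + 1)" lborel]]) (auto simp: emeasure_lborel_cball_finite[unfolded infinity_ennreal_def])
qed simp

lemma measurable_measure_slab:
  fixes p :: "'b \<Rightarrow> 'a::euclidean_space \<Rightarrow> 'a"
  assumes p: "(\<lambda>(\<omega>, x). p \<omega> x) \<in> borel_measurable (N \<Otimes>\<^sub>M borel)" and K: "K \<in> sets borel"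
  shows "(\<lambda>\<omega>. measure lborel (slab (p \<omega>) K r)) \<in> borel_measurable N"
proof -
  have p': "(\<lambda>q. p (fst q) (snd q)) \<in> borel_measurable (N \<Otimes>\<^sub>M (lborel :: 'a measure))"
    using p by (simp add: case_prod_beta cong: measurable_cong_sets)
  let ?Q = "{q \<in> space (N \<Otimes>\<^sub>M (lborel :: 'a measure)). p (fst q) (snd q) \<in> K \<and> norm (snd q - p (fst q) (snd q)) \<le> r}"
  have Q: "?Q \<in> sets (N \<Otimes>\<^sub>M (lborel :: 'a measure))" using p' K by measurable
  have "(\<lambda>\<omega>. emeasure lborel (Pair \<omega> -` ?Q)) \<in> borel_measurable N"
    by (rule lborel.measurable_emeasure_Pair[OF Q])
  moreover have "Pair \<omega> -` ?Q = slab (p \<omega>) K r" if "\<omega> \<in> space N" for \<omega>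
    using that by (auto simp: slab_def space_pair_measure)
  ultimately have "(\<lambda>\<omega>. emeasure lborel (slab (p \<omega>) K r)) \<in> borel_measurable N"
    by (simp cong: measurable_cong)
  then show ?thesis unfolding measure_def by measurable
qed

section \<open>The dual Radon transform of section volumes\<close>

lemma span_insert_perp:
  fixes u :: "real^'n"
  assumes u: "norm u = 1" and \<zeta>: "\<zeta> \<in> grassmannian_perp u k"
  shows "closest_point (span (insert u \<zeta>)) x = closest_point \<zeta> x + (x \<bullet> u) *\<^sub>R u"
    and "dim (span (insert u \<zeta>)) = Suc k"
proof -
  have s: "subspace \<zeta>" "dim \<zeta> = k" and o: "\<And>z. z \<in> \<zeta> \<Longrightarrow> u \<bullet> z = 0"
    using \<zeta> by (auto simp: grassmannian_perp_def orthogonal_def)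
  have uu: "u \<bullet> u = 1" using u by (simp add: norm_eq_1)
  note p = subspace_closest_point[OF s(1)]
  show "closest_point (span (insert u \<zeta>)) x = closest_point \<zeta> x + (x \<bullet> u) *\<^sub>R u"
  proof (rule subspace_closest_point_unique)
    show "closest_point \<zeta> x + (x \<bullet> u) *\<^sub>R u \<in> span (insert u \<zeta>)"
      using p(1) by (intro span_add span_scale span_base) auto
    fix z assume "z \<in> span (insert u \<zeta>)"
    then obtain c where "z - c *\<^sub>R u \<in> span \<zeta>" by (auto simp: span_breakdown_eq)
    then have w: "z - c *\<^sub>R u \<in> \<zeta>" using s(1) by (simp add: span_eq_iff[THEN iffD2])
    define w where "w = z - c *\<^sub>R u"
    have "(x - (closest_point \<zeta> x + (x \<bullet> u) *\<^sub>R u)) \<bullet> w = 0"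
      using p(2)[of w x] o[of w] w by (simp add: w_def[symmetric] inner_diff_left inner_add_left)
    moreover have "(x - (closest_point \<zeta> x + (x \<bullet> u) *\<^sub>R u)) \<bullet> u = 0"
    proof -
      have "closest_point \<zeta> x \<bullet> u = 0" using o[OF p(1)[of x]] by (simp add: inner_commute)
      then show ?thesis using uu by (simp add: inner_diff_left inner_add_left)
    qed
    moreover have "z = w + c *\<^sub>R u" by (simp add: w_def)
    ultimately show "(x - (closest_point \<zeta> x + (x \<bullet> u) *\<^sub>R u)) \<bullet> z = 0"
      by (simp add: inner_add_right)
  qed (rule subspace_span)
  have "u \<notin> \<zeta>" using o[of u] uu by auto
  then show "dim (span (insert u \<zeta>)) = Suc k"
    using dim_insert[of u \<zeta>] s by (simp add: span_eq_iff[THEN iffD2])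
qed

text \<open>
  The projection onto the span of \<open>u\<close> and \<open>\<zeta>\<close> is written as the projection onto \<open>\<zeta>\<close> plus that onto the
  line of \<open>u\<close>, so that measurability in \<open>\<zeta>\<close> can be read off.
\<close>

definition section_slab :: "(real^'n) set \<Rightarrow> real^'n \<Rightarrow> (real^'n) set \<Rightarrow> real" where
  "section_slab K u \<zeta> = measure lborel (slab (\<lambda>x. closest_point \<zeta> x + (x \<bullet> u) *\<^sub>R u) K 1)"

lemma section_slab_eq:
  fixes u :: "real^'n"
  assumes "norm u = 1" "\<zeta> \<in> grassmannian_perp u k"
  shows "section_slab K u \<zeta> = measure lborel (slab (closest_point (span (insert u \<zeta>))) K 1)"
  unfolding section_slab_def using span_insert_perp(1)[OF assms] by presburger

lemma section_vol_eq:
  fixes u :: "real^'n"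
  assumes u: "norm u = 1" "\<zeta> \<in> grassmannian_perp u k" and K: "K \<in> sets borel"
  shows "subspace_vol (span (insert u \<zeta>)) (K \<inter> span (insert u \<zeta>))
     = section_slab K u \<zeta> / unit_ball_vol (real (CARD('n) - Suc k))"
proof -
  have "unit_ball_vol (real (CARD('n) - Suc k)) \<noteq> 0"
    using less_imp_neq[OF unit_ball_vol_pos[of "real (CARD('n) - Suc k)"]] by simp
  then show ?thesis
    using subspace_vol_eq_slab[OF subspace_span K, of 1 "insert u \<zeta>"] span_insert_perp(2)[OF u]
    by (simp add: section_slab_eq[OF u] field_simps del: dim_span)
qed

text \<open>
  The dual Radon transform that occurs in the affine dual curvature measure of \<open>K\<close>.
\<close>

definition radon_vol :: "nat \<Rightarrow> (real^'n) set \<Rightarrow> real^'n \<Rightarrow> real" where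
  "radon_vol m K u = dual_radon m (\<lambda>\<xi>. subspace_vol \<xi> (K \<inter> \<xi>) ^ (CARD('n) - 1)) u"

text \<open>
  The normalisation of the dual Radon transform, divided by the power of the volume of the
  \<open>(n - m)\<close>-dimensional unit ball that passes from slab volumes to section volumes.
\<close>

definition radon_const :: "nat \<Rightarrow> nat \<Rightarrow> real" where
  "radon_const n m = (real m * unit_ball_vol (real m)) / (real n * unit_ball_vol (real n))
      / unit_ball_vol (real (n - m)) ^ (n - 1)"

lemma radon_const_pos: "0 < m \<Longrightarrow> 0 < n \<Longrightarrow> 0 < radon_const n m"
  unfolding radon_const_def by (intro divide_pos_pos mult_pos_pos zero_less_power unit_ball_vol_pos) auto

lemma haar_perp_facts:
  fixes u :: "real^'n"
  assumes "norm u = 1" "k < CARD('n)"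
  shows "prob_space (haar_perp u k)" "sets (haar_perp u k) = sets (grassmannian_perp_borel u k)"
    "space (haar_perp u k) = grassmannian_perp u k"
  using is_haar_perpD[OF is_haar_perp_haar_perp[OF assms]] by auto

lemma radon_vol_eq:
  fixes u :: "real^'n"
  assumes u: "norm u = 1" and K: "K \<in> sets borel" and m: "0 < m" "m \<le> CARD('n)"
  shows "radon_vol m K u = radon_const CARD('n) m *
     (LINT \<zeta>|haar_perp u (m - 1). section_slab K u \<zeta> ^ (CARD('n) - 1))"
proof -
  let ?w = "unit_ball_vol (real (CARD('n) - m))"
  have "(LINT \<zeta>|haar_perp u (m - 1). subspace_vol (span (insert u \<zeta>)) (K \<inter> span (insert u \<zeta>)) ^ (CARD('n) - 1))
     = (LINT \<zeta>|haar_perp u (m - 1). section_slab K u \<zeta> ^ (CARD('n) - 1) / ?w ^ (CARD('n) - 1))"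
  proof (rule Bochner_Integration.integral_cong[OF refl])
    fix \<zeta> assume "\<zeta> \<in> space (haar_perp u (m - 1))"
    then have \<zeta>: "\<zeta> \<in> grassmannian_perp u (m - 1)" using haar_perp_facts(3)[OF u, of "m - 1"] m by simp
    show "subspace_vol (span (insert u \<zeta>)) (K \<inter> span (insert u \<zeta>)) ^ (CARD('n) - 1)
       = section_slab K u \<zeta> ^ (CARD('n) - 1) / ?w ^ (CARD('n) - 1)"
      using section_vol_eq[OF u \<zeta> K] m by (simp add: power_divide)
  qed
  also have "\<dots> = (LINT \<zeta>|haar_perp u (m - 1). section_slab K u \<zeta> ^ (CARD('n) - 1)) / ?w ^ (CARD('n) - 1)"
    by simp
  finally show ?thesis unfolding radon_vol_def dual_radon_def radon_const_def by simp
qed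

lemma section_slab_measurable:
  fixes u :: "real^'n"
  assumes u: "norm u = 1" "k < CARD('n)" and K: "K \<in> sets borel"
  shows "section_slab K u \<in> borel_measurable (haar_perp u k)"
  unfolding section_slab_def[abs_def]
proof (rule measurable_measure_slab[OF _ K])
  have f: "fst \<in> measurable (haar_perp u k \<Otimes>\<^sub>M (borel :: (real^'n) measure)) (grassmannian_perp_borel u k)"
    using measurable_fst[of "haar_perp u k"] haar_perp_facts(2)[OF u] by (simp cong: measurable_cong_sets)
  have "(\<lambda>q. closest_point (fst q) (snd q)) \<in> borel_measurable (haar_perp u k \<Otimes>\<^sub>M (borel :: (real^'n) measure))"
    by (rule measurable_closest_point_grassmannian[OF f measurable_snd])
  then show "(\<lambda>(\<zeta>, x). closest_point \<zeta> x + (x \<bullet> u) *\<^sub>R u) \<in> borel_measurable (haar_perp u k \<Otimes>\<^sub>M borel)"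
    unfolding case_prod_beta by measurable
qed

lemma section_slab_le:
  fixes K :: "(real^'n) set"
  assumes "K \<subseteq> cball 0 \<rho>"
  shows "section_slab K u \<zeta> \<le> measure lborel (cball (0::real^'n) (\<rho> + 1))"
  unfolding section_slab_def by (rule measure_slab_le[OF assms])

lemma section_slab_nonneg: "0 \<le> section_slab K u \<zeta>"
  by (simp add: section_slab_def)

lemma section_slab_power_le:
  fixes K :: "(real^'n) set"
  assumes "K \<subseteq> cball 0 \<rho>"
  shows "\<bar>section_slab K u \<zeta> ^ q\<bar> \<le> measure lborel (cball (0::real^'n) (\<rho> + 1)) ^ q"
    "section_slab K u \<zeta> ^ q \<le> measure lborel (cball (0::real^'n) (\<rho> + 1)) ^ q"
proof -
  show le: "section_slab K u \<zeta> ^ q \<le> measure lborel (cball (0::real^'n) (\<rho> + 1)) ^ q"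
    by (intro power_mono section_slab_le[OF assms] section_slab_nonneg)
  show "\<bar>section_slab K u \<zeta> ^ q\<bar> \<le> measure lborel (cball (0::real^'n) (\<rho> + 1)) ^ q"
    using le section_slab_nonneg[of K u \<zeta>] by simp
qed

lemma section_slab_power_integrable:
  fixes u :: "real^'n"
  assumes u: "norm u = 1" "k < CARD('n)" and K: "K \<in> sets borel" "K \<subseteq> cball 0 \<rho>"
  shows "integrable (haar_perp u k) (\<lambda>\<zeta>. section_slab K u \<zeta> ^ q)"
proof -
  interpret prob_space "haar_perp u k" by (rule haar_perp_facts[OF u])
  show ?thesis
  proof (rule integrable_const_bound)
    show "AE \<zeta> in haar_perp u k. norm (section_slab K u \<zeta> ^ q) \<le> measure lborel (cball (0::real^'n) (\<rho> + 1)) ^ q"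
      using section_slab_power_le[OF K(2)] by (intro AE_I2) simp
    show "(\<lambda>\<zeta>. section_slab K u \<zeta> ^ q) \<in> borel_measurable (haar_perp u k)"
      using section_slab_measurable[OF u K(1)] by measurable
  qed
qed

lemma radon_vol_bounds:
  fixes u :: "real^'n"
  assumes u: "norm u = 1" and K: "K \<in> sets borel" "K \<subseteq> cball 0 \<rho>" and m: "0 < m" "m \<le> CARD('n)"
  shows "0 \<le> radon_vol m K u"
    "radon_vol m K u \<le> radon_const CARD('n) m * measure lborel (cball (0::real^'n) (\<rho> + 1)) ^ (CARD('n) - 1)"
proof -
  have k: "m - 1 < CARD('n)" using m by simp
  interpret prob_space "haar_perp u (m - 1)" by (rule haar_perp_facts[OF u k])
  have c: "0 < radon_const CARD('n) m" using m by (intro radon_const_pos) auto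
  have "(LINT \<zeta>|haar_perp u (m - 1). section_slab K u \<zeta> ^ (CARD('n) - 1))
      \<le> (LINT \<zeta>|haar_perp u (m - 1). measure lborel (cball (0::real^'n) (\<rho> + 1)) ^ (CARD('n) - 1))"
    using section_slab_power_le[OF K(2)]
    by (intro integral_mono section_slab_power_integrable[OF u k K] integrable_const) auto
  then show "radon_vol m K u \<le> radon_const CARD('n) m * measure lborel (cball (0::real^'n) (\<rho> + 1)) ^ (CARD('n) - 1)"
    unfolding radon_vol_eq[OF u K(1) m] using c prob_space by simp
  show "0 \<le> radon_vol m K u"
    unfolding radon_vol_eq[OF u K(1) m] using c section_slab_nonneg
    by (intro mult_nonneg_nonneg integral_nonneg_AE AE_I2 zero_le_power) auto
qed

text \<open>
  In the integral \<open>p\<close> is the orthogonal projection onto a subspace through \<open>u\<close>; the hypothesis names those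
  properties of such projections from which the convergence follows for polytopes.
\<close>

lemma radon_vol_tendsto:
  fixes u :: "real^'n"
  assumes u: "norm u = 1" and K: "K \<in> sets borel" "\<And>j. Kj j \<in> sets borel" and b: "\<And>j. Kj j \<subseteq> cball 0 \<rho>"
    and m: "0 < m" "m \<le> CARD('n)"
    and conv: "\<And>p. linear p \<Longrightarrow> p u = u \<Longrightarrow> (\<And>x y. p x \<bullet> y = x \<bullet> p y) \<Longrightarrow>
       AE x in lborel. \<forall>\<^sub>F j in sequentially. p x \<in> Kj j \<longleftrightarrow> p x \<in> K"
  shows "(\<lambda>j. radon_vol m (Kj j) u) \<longlonglongrightarrow> radon_vol m K u"
proof -
  have k: "m - 1 < CARD('n)" using m by simp
  interpret prob_space "haar_perp u (m - 1)" by (rule haar_perp_facts[OF u k])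
  let ?B = "measure lborel (cball (0::real^'n) (\<rho> + 1)) ^ (CARD('n) - 1)"
  have "(\<lambda>j. LINT \<zeta>|haar_perp u (m - 1). section_slab (Kj j) u \<zeta> ^ (CARD('n) - 1))
     \<longlonglongrightarrow> (LINT \<zeta>|haar_perp u (m - 1). section_slab K u \<zeta> ^ (CARD('n) - 1))"
  proof (rule integral_dominated_convergence[where w = "\<lambda>_. ?B"])
    show "AE \<zeta> in haar_perp u (m - 1). (\<lambda>j. section_slab (Kj j) u \<zeta> ^ (CARD('n) - 1))
        \<longlonglongrightarrow> section_slab K u \<zeta> ^ (CARD('n) - 1)"
    proof (rule AE_I2)
      fix \<zeta> assume "\<zeta> \<in> space (haar_perp u (m - 1))"
      then have \<zeta>: "\<zeta> \<in> grassmannian_perp u (m - 1)" using haar_perp_facts(3)[OF u k] by simp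
      let ?\<xi> = "span (insert u \<zeta>)"
      let ?p = "closest_point ?\<xi>"
      note P = subspace_closest_point[OF subspace_span[of "insert u \<zeta>"]]
      have lin: "linear ?p" by (rule linear_closest_point[OF subspace_span])
      have "?p u = u" by (intro closest_point_self span_base) auto
      moreover have "?p x \<bullet> y = x \<bullet> ?p y" for x y
      proof -
        have "(x - ?p x) \<bullet> ?p y = 0" "(y - ?p y) \<bullet> ?p x = 0" using P by blast+
        then have "x \<bullet> ?p y = ?p x \<bullet> ?p y" "y \<bullet> ?p x = ?p y \<bullet> ?p x"
          unfolding inner_diff_left by linarith+
        then show ?thesis by (metis inner_commute)
      qed
      ultimately have "AE x in lborel. \<forall>\<^sub>F j in sequentially. ?p x \<in> Kj j \<longleftrightarrow> ?p x \<in> K"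
        by (intro conv lin)
      from measure_slab_tendsto[OF lin K b this, of 1]
      show "(\<lambda>j. section_slab (Kj j) u \<zeta> ^ (CARD('n) - 1)) \<longlonglongrightarrow> section_slab K u \<zeta> ^ (CARD('n) - 1)"
        unfolding section_slab_eq[OF u \<zeta>] by (rule tendsto_power)
    qed
    show "AE \<zeta> in haar_perp u (m - 1). norm (section_slab (Kj j) u \<zeta> ^ (CARD('n) - 1)) \<le> ?B" for j
      using section_slab_power_le[OF b] by (intro AE_I2) simp
    show "integrable (haar_perp u (m - 1)) (\<lambda>_. ?B)" by (rule integrable_const)
  qed (use section_slab_measurable[OF u k K(1)] section_slab_measurable[OF u k K(2)] in \<open>auto intro!: borel_measurable_power\<close>)
  then show ?thesis unfolding radon_vol_eq[OF u K(1) m] radon_vol_eq[OF u K(2) m] by (intro tendsto_intros)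
qed

text \<open>
  All subspaces through \<open>u\<close> contain the centre \<open>c u\<close> of one ball in \<open>K\<close>.
\<close>

lemma radon_vol_pos:
  fixes u :: "real^'n"
  assumes u: "norm u = 1" and K: "K \<in> sets borel" "K \<subseteq> cball 0 \<rho>" and m: "0 < m" "m \<le> CARD('n)"
    and c: "c *\<^sub>R u \<in> interior K"
  shows "0 < radon_vol m K u"
proof -
  have k: "m - 1 < CARD('n)" using m by simp
  interpret prob_space "haar_perp u (m - 1)" by (rule haar_perp_facts[OF u k])
  obtain e where e: "0 < e" "ball (c *\<^sub>R u) e \<subseteq> K" using c by (auto simp: mem_interior)
  define \<delta> where "\<delta> = min e 1"
  have \<delta>: "0 < \<delta>" "\<delta> \<le> 1" "ball (c *\<^sub>R u) \<delta> \<subseteq> K" using e by (auto simp: \<delta>_def)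
  let ?v = "measure lborel (ball (c *\<^sub>R u) \<delta>)"
  have v: "0 < ?v" using content_ball_pos[OF \<delta>(1)] .
  have "?v ^ (CARD('n) - 1) = (LINT \<zeta>|haar_perp u (m - 1). ?v ^ (CARD('n) - 1))" using prob_space by simp
  also have "\<dots> \<le> (LINT \<zeta>|haar_perp u (m - 1). section_slab K u \<zeta> ^ (CARD('n) - 1))"
  proof (intro integral_mono section_slab_power_integrable[OF u k K] integrable_const)
    fix \<zeta> assume "\<zeta> \<in> space (haar_perp u (m - 1))"
    then have \<zeta>: "\<zeta> \<in> grassmannian_perp u (m - 1)" using haar_perp_facts(3)[OF u k] by simp
    have "?v \<le> section_slab K u \<zeta>"
      unfolding section_slab_eq[OF u \<zeta>]
      by (rule measure_slab_ball_ge[OF subspace_span _ \<delta>(3,2) K]) (intro span_scale span_base insertI1)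
    then show "?v ^ (CARD('n) - 1) \<le> section_slab K u \<zeta> ^ (CARD('n) - 1)" by (intro power_mono) auto
  qed
  finally have "0 < (LINT \<zeta>|haar_perp u (m - 1). section_slab K u \<zeta> ^ (CARD('n) - 1))"
    using v by (meson less_le_trans zero_less_power)
  then show ?thesis unfolding radon_vol_eq[OF u K(1) m] using m by (intro mult_pos_pos radon_const_pos) auto
qed

lemma radon_vol_scale:
  fixes u :: "real^'n"
  assumes u: "norm u = 1" and K: "closed K" and m: "0 < m" "m \<le> CARD('n)" and s: "0 < s"
  shows "radon_vol m ((\<lambda>x. s *\<^sub>R x) ` K) u = s ^ (m * (CARD('n) - 1)) * radon_vol m K u"
proof -
  have k: "m - 1 < CARD('n)" using m by simp
  have "(LINT \<zeta>|haar_perp u (m - 1). subspace_vol (span (insert u \<zeta>)) ((\<lambda>x. s *\<^sub>R x) ` K \<inter> span (insert u \<zeta>)) ^ (CARD('n) - 1))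
    = (LINT \<zeta>|haar_perp u (m - 1). s ^ (m * (CARD('n) - 1)) * subspace_vol (span (insert u \<zeta>)) (K \<inter> span (insert u \<zeta>)) ^ (CARD('n) - 1))"
  proof (rule Bochner_Integration.integral_cong[OF refl])
    fix \<zeta> assume "\<zeta> \<in> space (haar_perp u (m - 1))"
    then have \<zeta>: "\<zeta> \<in> grassmannian_perp u (m - 1)" using haar_perp_facts(3)[OF u k] by simp
    have d: "dim (span (insert u \<zeta>)) = m" using span_insert_perp(2)[OF u \<zeta>] m by simp
    show "subspace_vol (span (insert u \<zeta>)) ((\<lambda>x. s *\<^sub>R x) ` K \<inter> span (insert u \<zeta>)) ^ (CARD('n) - 1)
      = s ^ (m * (CARD('n) - 1)) * subspace_vol (span (insert u \<zeta>)) (K \<inter> span (insert u \<zeta>)) ^ (CARD('n) - 1)"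
      unfolding subspace_vol_scale[OF subspace_span K s] d by (simp add: power_mult_distrib power_mult)
  qed
  then show ?thesis unfolding radon_vol_def dual_radon_def by simp
qed

text \<open>
  The reflection that exchanges the unit vectors \<open>e\<close> and \<open>u\<close>. It is a measurable function of \<open>u\<close>, also at
  \<open>u = e\<close>, where division by zero turns it into the identity.
\<close>

definition swap_reflection :: "'a::euclidean_space \<Rightarrow> 'a \<Rightarrow> 'a \<Rightarrow> 'a" where
  "swap_reflection e u x = x - (2 * (x \<bullet> (u - e)) / ((u - e) \<bullet> (u - e))) *\<^sub>R (u - e)"

lemma swap_reflection_props:
  fixes e u :: "'a::euclidean_space"
  assumes "norm e = 1" "norm u = 1"
  shows "orthogonal_transformation (swap_reflection e u)" "swap_reflection e u e = u"
    "swap_reflection e u (swap_reflection e u x) = x"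
proof -
  let ?w = "u - e"
  have refl: "(x - (2 * (x \<bullet> w) / (w \<bullet> w)) *\<^sub>R w) \<bullet> (y - (2 * (y \<bullet> w) / (w \<bullet> w)) *\<^sub>R w) = x \<bullet> y" for x y w :: 'a
  proof (cases "w = 0")
    case False
    define W a b where "W = w \<bullet> w" and "a = x \<bullet> w" and "b = y \<bullet> w"
    have W: "W \<noteq> 0" using False by (simp add: W_def)
    have "(x - (2 * a / W) *\<^sub>R w) \<bullet> (y - (2 * b / W) *\<^sub>R w)
        = x \<bullet> y - (2 * b / W) * a - (2 * a / W) * b + (2 * a / W) * (2 * b / W) * W"
    proof -
      have "w \<bullet> y = b" by (simp add: b_def inner_commute)
      then show ?thesis
        by (simp add: inner_diff_left inner_diff_right W_def[symmetric] a_def[symmetric])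
    qed
    also have "\<dots> = x \<bullet> y" using W by (simp add: field_simps)
    finally show ?thesis by (simp add: W_def a_def b_def)
  qed simp
  have inv: "swap_reflection e u x \<bullet> swap_reflection e u y = x \<bullet> y" for x y
    unfolding swap_reflection_def by (rule refl)
  show o: "orthogonal_transformation (swap_reflection e u)"
    unfolding orthogonal_transformation_def
  proof (intro conjI allI inv)
    show "linear (swap_reflection e u)"
    proof (rule linearI)
      have lin: "(x + y) - (2 * ((x + y) \<bullet> w) / (w \<bullet> w)) *\<^sub>R w
          = (x - (2 * (x \<bullet> w) / (w \<bullet> w)) *\<^sub>R w) + (y - (2 * (y \<bullet> w) / (w \<bullet> w)) *\<^sub>R w)"
        "r *\<^sub>R x - (2 * ((r *\<^sub>R x) \<bullet> w) / (w \<bullet> w)) *\<^sub>R w = r *\<^sub>R (x - (2 * (x \<bullet> w) / (w \<bullet> w)) *\<^sub>R w)"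
        for x y w :: 'a and r
        by (simp_all add: inner_add_left distrib_left add_divide_distrib scaleR_left_distrib scaleR_right_diff_distrib)
      show "swap_reflection e u (x + y) = swap_reflection e u x + swap_reflection e u y"
        "swap_reflection e u (r *\<^sub>R x) = r *\<^sub>R swap_reflection e u x" for x y r
        unfolding swap_reflection_def by (rule lin)+
    qed
  qed
  show "swap_reflection e u (swap_reflection e u x) = x"
  proof -
    have "(x - c *\<^sub>R w) - (2 * ((x - c *\<^sub>R w) \<bullet> w) / (w \<bullet> w)) *\<^sub>R w = x"
      if c: "c = 2 * (x \<bullet> w) / (w \<bullet> w)" for w :: 'a and c
    proof (cases "w = 0")
      case False
      then have "(x - c *\<^sub>R w) \<bullet> w = - (x \<bullet> w)" by (simp add: c inner_diff_left)
      then show ?thesis by (simp add: c)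
    qed simp
    then show ?thesis unfolding swap_reflection_def by blast
  qed
  show "swap_reflection e u e = u"
  proof (cases "?w = 0")
    case False
    have 1: "?w \<bullet> ?w = - 2 * (e \<bullet> ?w)"
      using assms by (simp add: inner_diff_left inner_diff_right norm_eq_1 inner_commute)
    have "?w \<bullet> ?w \<noteq> 0" using False by simp
    then have "2 * (e \<bullet> ?w) / (?w \<bullet> ?w) = -1" unfolding 1 by (simp add: field_simps)
    then show ?thesis by (simp add: swap_reflection_def)
  qed (simp add: swap_reflection_def)
qed

text \<open>
  The measure of integration varies with \<open>u\<close>. Carrying it over from a fixed pole \<open>e\<close> by the reflection that
  exchanges \<open>e\<close> and \<open>u\<close> turns the transform into an integral over a fixed measure space.
\<close>

lemma radon_vol_measurable:
  fixes K :: "(real^'n) set"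
  assumes K: "K \<in> sets borel" and m: "0 < m" "m \<le> CARD('n)"
  shows "radon_vol m K \<in> borel_measurable (restrict_space borel (sphere 0 1))"
proof -
  have k: "m - 1 < CARD('n)" using m by simp
  let ?N = "restrict_space (borel :: (real^'n) measure) (sphere 0 1)"
  obtain e :: "real^'n" where e: "norm e = 1" using vector_choose_size[of 1] by auto
  let ?H = "haar_perp e (m - 1)"
  interpret H: prob_space ?H by (rule haar_perp_facts[OF e k])
  let ?p = "\<lambda>u \<zeta> x. swap_reflection e u (closest_point \<zeta> (swap_reflection e u x)) + (x \<bullet> u) *\<^sub>R u"
  have eq: "radon_vol m K u = radon_const CARD('n) m *
      (LINT \<zeta>|?H. measure lborel (slab (?p u \<zeta>) K 1) ^ (CARD('n) - 1))" if u: "norm u = 1" for u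
  proof -
    let ?T = "swap_reflection e u"
    note T = swap_reflection_props[OF e u]
    have Tm: "(\<lambda>V. ?T ` V) \<in> measurable ?H (grassmannian_perp_borel u (m - 1))"
      using measurable_grassmannian_image[OF T(1), of e "m - 1"] haar_perp_facts(2)[OF e k] T(2)
      by (simp cong: measurable_cong_sets)
    have sm: "(\<lambda>\<zeta>. section_slab K u \<zeta> ^ (CARD('n) - 1)) \<in> borel_measurable (grassmannian_perp_borel u (m - 1))"
      using section_slab_measurable[OF u k K] haar_perp_facts(2)[OF u k]
      by (auto intro!: borel_measurable_power cong: measurable_cong_sets)
    have "haar_perp u (m - 1) = distr ?H (grassmannian_perp_borel u (m - 1)) (\<lambda>V. ?T ` V)"
      using haar_perp_orthogonal_image[OF e k T(1)] T(2) by simp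
    then have "(LINT \<zeta>|haar_perp u (m - 1). section_slab K u \<zeta> ^ (CARD('n) - 1))
       = (LINT \<zeta>|?H. section_slab K u (?T ` \<zeta>) ^ (CARD('n) - 1))"
      using integral_distr[OF Tm sm] by simp
    also have "\<dots> = (LINT \<zeta>|?H. measure lborel (slab (?p u \<zeta>) K 1) ^ (CARD('n) - 1))"
    proof (rule Bochner_Integration.integral_cong[OF refl])
      fix \<zeta> assume "\<zeta> \<in> space ?H"
      then have "subspace \<zeta>" using haar_perp_facts(3)[OF e k] by (simp add: grassmannian_perp_def)
      then show "section_slab K u (?T ` \<zeta>) ^ (CARD('n) - 1) = measure lborel (slab (?p u \<zeta>) K 1) ^ (CARD('n) - 1)"
        by (simp add: section_slab_def closest_point_orthogonal_image[OF _ T(1) T(3)])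
    qed
    finally show ?thesis using radon_vol_eq[OF u K m] by simp
  qed
  have um: "(\<lambda>q. fst (fst q)) \<in> borel_measurable ((?N \<Otimes>\<^sub>M ?H) \<Otimes>\<^sub>M (borel :: (real^'n) measure))"
  proof -
    have "(\<lambda>u. u) \<in> borel_measurable ?N" by (intro measurable_restrict_space1) auto
    then show ?thesis by measurable
  qed
  have \<zeta>m: "(\<lambda>q. snd (fst q)) \<in> measurable ((?N \<Otimes>\<^sub>M ?H) \<Otimes>\<^sub>M (borel :: (real^'n) measure)) (grassmannian_perp_borel e (m - 1))"
    using measurable_compose[OF measurable_fst measurable_snd] haar_perp_facts(2)[OF e k]
    by (auto cong: measurable_cong_sets)
  have xm: "snd \<in> borel_measurable ((?N \<Otimes>\<^sub>M ?H) \<Otimes>\<^sub>M (borel :: (real^'n) measure))" by (rule measurable_snd)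
  have Tm: "(\<lambda>q. swap_reflection e (f q) (g q)) \<in> borel_measurable M"
    if "f \<in> borel_measurable M" "g \<in> borel_measurable M" for f g :: "_ \<Rightarrow> real^'n" and M
    unfolding swap_reflection_def using that by measurable
  have pm: "(\<lambda>q. ?p (fst (fst q)) (snd (fst q)) (snd q)) \<in> borel_measurable ((?N \<Otimes>\<^sub>M ?H) \<Otimes>\<^sub>M (borel :: (real^'n) measure))"
    by (intro borel_measurable_add borel_measurable_scaleR borel_measurable_inner Tm
        measurable_closest_point_grassmannian[OF \<zeta>m] um xm)
  have "(\<lambda>\<omega>. measure lborel (slab (?p (fst \<omega>) (snd \<omega>)) K 1)) \<in> borel_measurable (?N \<Otimes>\<^sub>M ?H)"
    by (rule measurable_measure_slab[OF _ K]) (use pm in \<open>simp add: case_prod_beta\<close>)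
  then have "(\<lambda>(u, \<zeta>). measure lborel (slab (?p u \<zeta>) K 1) ^ (CARD('n) - 1)) \<in> borel_measurable (?N \<Otimes>\<^sub>M ?H)"
    unfolding case_prod_beta by (rule borel_measurable_power)
  from H.borel_measurable_lebesgue_integral[OF this]
  have "(\<lambda>u. radon_const CARD('n) m * (LINT \<zeta>|?H. measure lborel (slab (?p u \<zeta>) K 1) ^ (CARD('n) - 1))) \<in> borel_measurable ?N"
    by (rule borel_measurable_times[OF borel_measurable_const])
  then show ?thesis
    by (rule measurable_cong[THEN iffD1, rotated]) (simp add: eq space_restrict_space)
qed

section \<open>Radial functions of polytopes\<close>

lemma radial_fn_props:
  fixes K :: "'a::euclidean_space set"
  assumes K: "compact K" "convex K" "0 \<in> K" "K \<subseteq> cball 0 \<rho>" and u: "norm u = 1"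
  shows "0 \<le> radial_fn K u" "radial_fn K u \<le> \<rho>" "radial_fn K u *\<^sub>R u \<in> K"
    "\<And>r. 0 \<le> r \<Longrightarrow> r *\<^sub>R u \<in> K \<longleftrightarrow> r \<le> radial_fn K u"
proof -
  let ?S = "{t. 0 \<le> t \<and> t *\<^sub>R u \<in> K}"
  have 0: "0 \<in> ?S" using K(3) by simp
  have le: "t \<le> \<rho>" if "t \<in> ?S" for t using that K(4) u by auto
  have bdd: "bdd_above ?S" by (intro bdd_aboveI[of _ \<rho>] le)
  have "closed ?S"
  proof -
    have "?S = {0..} \<inter> (\<lambda>t. t *\<^sub>R u) -` K" by auto
    moreover have "closed ((\<lambda>t. t *\<^sub>R u) -` K)"
      by (intro continuous_closed_vimage compact_imp_closed K continuous_intros)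
    ultimately show ?thesis by (simp add: closed_Int)
  qed
  then have S: "radial_fn K u \<in> ?S"
    unfolding radial_fn_def using closed_contains_Sup[of ?S] bdd 0 by blast
  then show "0 \<le> radial_fn K u" and "radial_fn K u \<le> \<rho>" and inK: "radial_fn K u *\<^sub>R u \<in> K" using le by auto
  fix r :: real assume r: "0 \<le> r"
  show "r *\<^sub>R u \<in> K \<longleftrightarrow> r \<le> radial_fn K u"
  proof
    assume "r *\<^sub>R u \<in> K"
    then show "r \<le> radial_fn K u" unfolding radial_fn_def using r bdd by (intro cSup_upper) auto
  next
    assume le: "r \<le> radial_fn K u"
    show "r *\<^sub>R u \<in> K"
    proof (cases "radial_fn K u = 0")
      case True
      then show ?thesis using le r K(3) by simp
    next
      case False
      then have p: "0 < radial_fn K u" using S by auto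
      have "(r / radial_fn K u) *\<^sub>R (radial_fn K u *\<^sub>R u) + (1 - r / radial_fn K u) *\<^sub>R 0 \<in> K"
        using inK K(2,3) r le p by (intro convexD) auto
      then show ?thesis using p by simp
    qed
  qed
qed

lemma radial_fn_measurable:
  fixes K :: "'a::euclidean_space set"
  assumes K: "compact K" "convex K" "0 \<in> K" "K \<subseteq> cball 0 \<rho>"
  shows "radial_fn K \<in> borel_measurable (restrict_space borel (sphere 0 1))"
proof (subst borel_measurable_iff_ge, intro allI)
  fix a :: real
  let ?N = "restrict_space (borel :: 'a measure) (sphere 0 1)"
  have "{w \<in> space ?N. a \<le> radial_fn K w} = (if a < 0 then sphere 0 1 else sphere 0 1 \<inter> (\<lambda>u. a *\<^sub>R u) -` K)"
    using radial_fn_props(1,4)[OF K] by (auto simp: space_restrict_space intro: order_trans less_imp_le)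
  moreover have "closed ((\<lambda>u. a *\<^sub>R u) -` K)"
    by (intro continuous_closed_vimage compact_imp_closed K continuous_intros)
  ultimately show "{w \<in> space ?N. a \<le> radial_fn K w} \<in> sets ?N"
    by (auto simp: sets_restrict_space_iff intro: borel_closed closed_Int)
qed

text \<open>
  The coefficients \<open>t\<close> are kept apart from the offsets \<open>s\<close>: letting \<open>t k\<close> tend to zero pushes the \<open>k\<close>-th
  facet to infinity continuously.
\<close>

definition halfspace_poly :: "nat \<Rightarrow> (nat \<Rightarrow> 'a::euclidean_space) \<Rightarrow> (nat \<Rightarrow> real) \<Rightarrow> (nat \<Rightarrow> real) \<Rightarrow> 'a set" where
  "halfspace_poly N u s t = {x. \<forall>k\<in>{1..N}. t k * (u k \<bullet> x) \<le> s k}"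

text \<open>
  The origin may lie on a facet (\<open>s k = 0\<close>), as the base points below range over a closed polytope. The
  void constraint \<open>0 \<le> 0\<close> is excluded, since every direction would count as tight for it.
\<close>

definition admissible ::
    "nat \<Rightarrow> (nat \<Rightarrow> 'a::euclidean_space) \<Rightarrow> real \<Rightarrow> (nat \<Rightarrow> real) \<Rightarrow> (nat \<Rightarrow> real) \<Rightarrow> bool" where
  "admissible N u \<rho> s t \<longleftrightarrow>
     (\<forall>k\<in>{1..N}. 0 \<le> t k \<and> 0 \<le> s k \<and> (t k = 0 \<longrightarrow> 0 < s k)) \<and>
     halfspace_poly N u s t \<subseteq> cball 0 \<rho> \<and> interior (halfspace_poly N u s t) \<noteq> {}"

lemma halfspace_poly_closed_convex: "closed (halfspace_poly N u s t)" "convex (halfspace_poly N u s t)"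
proof -
  have eq: "halfspace_poly N u s t = (\<Inter>k\<in>{1..N}. {x. (t k *\<^sub>R u k) \<bullet> x \<le> s k})" by (auto simp: halfspace_poly_def)
  show "closed (halfspace_poly N u s t)" unfolding eq by (intro closed_INT ballI closed_halfspace_le)
  show "convex (halfspace_poly N u s t)" unfolding eq by (intro convex_INT convex_halfspace_le)
qed

lemma admissible_body:
  assumes "admissible N u \<rho> s t"
  shows "compact (halfspace_poly N u s t)" "convex (halfspace_poly N u s t)" "0 \<in> halfspace_poly N u s t" "halfspace_poly N u s t \<subseteq> cball 0 \<rho>"
    "halfspace_poly N u s t \<in> sets borel"
  using assms halfspace_poly_closed_convex[of N u s t] bounded_subset[OF bounded_cball]
  by (auto simp: admissible_def compact_eq_bounded_closed halfspace_poly_def)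

text \<open>
  If no constraint that increases along the ray were tight at the boundary point, a slightly longer segment
  of the ray would lie in the polytope.
\<close>

lemma admissible_tight:
  assumes ad: "admissible N u \<rho> s t" and v: "norm v = 1"
  obtains k where "k \<in> {1..N}" "0 < t k * (u k \<bullet> v)" "t k * (radial_fn (halfspace_poly N u s t) v * (u k \<bullet> v)) = s k"
proof -
  let ?P = "halfspace_poly N u s t"
  let ?r = "radial_fn ?P v"
  note R = radial_fn_props[OF admissible_body(1-4)[OF ad] v]
  have "\<exists>k\<in>{1..N}. 0 < t k * (u k \<bullet> v) \<and> t k * (?r * (u k \<bullet> v)) = s k"
  proof (rule ccontr)
    assume no: "\<not> ?thesis"
    have "\<forall>\<^sub>F r in at_right ?r. t k * (u k \<bullet> (r *\<^sub>R v)) \<le> s k" if k: "k \<in> {1..N}" for k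
    proof (cases "0 < t k * (u k \<bullet> v)")
      case True
      have "t k * (u k \<bullet> (?r *\<^sub>R v)) \<le> s k" using R(3) k by (auto simp: halfspace_poly_def)
      then have lt: "t k * (u k \<bullet> (?r *\<^sub>R v)) < s k" using no k True by force
      have "((\<lambda>r. t k * (u k \<bullet> (r *\<^sub>R v))) \<longlongrightarrow> t k * (u k \<bullet> (?r *\<^sub>R v))) (at_right ?r)"
        by (intro tendsto_intros)
      from order_tendstoD(2)[OF this lt] show ?thesis by (auto elim: eventually_mono)
    next
      case False
      have "\<forall>\<^sub>F r in at_right ?r. ?r < r" by (rule eventually_at_right_less)
      then show ?thesis
      proof eventually_elim
        case (elim r)
        have "t k * (u k \<bullet> (r *\<^sub>R v)) = r * (t k * (u k \<bullet> v))" by simp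
        also have "\<dots> \<le> 0" using elim R(1) False by (intro mult_nonneg_nonpos[of r]) linarith+
        also have "0 \<le> s k" using ad k by (auto simp: admissible_def)
        finally show ?case .
      qed
    qed
    then have "\<forall>\<^sub>F r in at_right ?r. \<forall>k\<in>{1..N}. t k * (u k \<bullet> (r *\<^sub>R v)) \<le> s k"
      by (intro eventually_ball_finite) auto
    moreover have "\<forall>\<^sub>F r in at_right ?r. ?r < r" by (rule eventually_at_right_less)
    ultimately have "\<forall>\<^sub>F r in at_right ?r. r *\<^sub>R v \<in> ?P \<and> ?r < r"
      by eventually_elim (simp add: halfspace_poly_def)
    then obtain r where "r *\<^sub>R v \<in> ?P" "?r < r" using eventually_happens[of _ "at_right ?r"] by auto
    then show False using R(1) R(4)[of r] by auto
  qed
  then show ?thesis using that by blast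
qed

section \<open>Masses of the facets\<close>

text \<open>
  The directions in which the ray leaves the polytope through the \<open>k\<close>-th bounding hyperplane.
\<close>

definition facet_cone :: "nat \<Rightarrow> (nat \<Rightarrow> 'a::euclidean_space) \<Rightarrow> (nat \<Rightarrow> real) \<Rightarrow> (nat \<Rightarrow> real) \<Rightarrow> nat \<Rightarrow> 'a set" where
  "facet_cone N u s t k = {v \<in> sphere 0 1. t k * (radial_fn (halfspace_poly N u s t) v * (u k \<bullet> v)) = s k}"

definition curv_density :: "nat \<Rightarrow> (real^'n) set \<Rightarrow> real^'n \<Rightarrow> real" where
  "curv_density m K v = radial_fn K v ^ m * radon_vol m K v"

definition facet_mass ::
    "nat \<Rightarrow> nat \<Rightarrow> (nat \<Rightarrow> real^'n) \<Rightarrow> (nat \<Rightarrow> real) \<Rightarrow> (nat \<Rightarrow> real) \<Rightarrow> nat \<Rightarrow> real" where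
  "facet_mass m N u s t k =
     (LINT v|sphere_measure. indicat_real (facet_cone N u s t k) v * curv_density m (halfspace_poly N u s t) v)"

lemma measurable_sphere_measure_iff:
  "f \<in> borel_measurable (sphere_measure :: (real^'n) measure) \<longleftrightarrow> f \<in> borel_measurable (restrict_space borel (sphere 0 1))"
  using sets_sphere_measure by (auto cong: measurable_cong_sets)

lemma curv_density_measurable:
  fixes K :: "(real^'n) set"
  assumes K: "compact K" "convex K" "0 \<in> K" "K \<subseteq> cball 0 \<rho>" and m: "0 < m" "m \<le> CARD('n)"
  shows "curv_density m K \<in> borel_measurable sphere_measure"
  unfolding curv_density_def[abs_def] measurable_sphere_measure_iff
  using radial_fn_measurable[OF K] radon_vol_measurable[of K, OF _ m] K(1)
  by (auto intro!: borel_measurable_times borel_measurable_power simp: compact_imp_closed)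

lemma facet_cone_measurable:
  fixes u :: "nat \<Rightarrow> real^'n"
  assumes ad: "admissible N u \<rho> s t"
  shows "facet_cone N u s t k \<in> sets sphere_measure"
proof -
  let ?N = "restrict_space (borel :: (real^'n) measure) (sphere 0 1)"
  have [measurable]: "radial_fn (halfspace_poly N u s t) \<in> borel_measurable ?N"
    by (rule radial_fn_measurable[OF admissible_body(1-4)[OF ad]])
  have [measurable]: "(\<lambda>v. v) \<in> borel_measurable ?N" by (intro measurable_restrict_space1) auto
  have "{v \<in> space ?N. t k * (radial_fn (halfspace_poly N u s t) v * (u k \<bullet> v)) = s k} \<in> sets ?N" by measurable
  then show ?thesis by (simp add: facet_cone_def space_restrict_space sets_sphere_measure)
qed

lemma curv_density_bounds:
  fixes K :: "(real^'n) set"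
  assumes K: "compact K" "convex K" "0 \<in> K" "K \<subseteq> cball 0 \<rho>" and m: "0 < m" "m \<le> CARD('n)" and v: "norm v = 1"
  shows "0 \<le> curv_density m K v"
    "curv_density m K v \<le> \<rho> ^ m * (radon_const CARD('n) m * measure lborel (cball (0::real^'n) (\<rho> + 1)) ^ (CARD('n) - 1))"
proof -
  have Kb: "K \<in> sets borel" using K(1) by (simp add: compact_imp_closed)
  note R = radial_fn_props[OF K v] and V = radon_vol_bounds[OF v Kb K(4) m]
  show "0 \<le> curv_density m K v" unfolding curv_density_def using R V by simp
  show "curv_density m K v \<le> \<rho> ^ m * (radon_const CARD('n) m * measure lborel (cball (0::real^'n) (\<rho> + 1)) ^ (CARD('n) - 1))"
    unfolding curv_density_def using R V by (intro mult_mono power_mono) auto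
qed

lemma facet_integrand_integrable:
  fixes u :: "nat \<Rightarrow> real^'n"
  assumes ad: "admissible N u \<rho> s t" and m: "0 < m" "m \<le> CARD('n)" and A: "A \<in> sets sphere_measure"
  shows "integrable sphere_measure (\<lambda>v. indicat_real A v * curv_density m (halfspace_poly N u s t) v)"
proof -
  interpret finite_measure "sphere_measure :: (real^'n) measure" by (rule finite_measure_sphere_measure)
  note B = admissible_body[OF ad]
  show ?thesis
  proof (rule integrable_const_bound)
    show "AE v in sphere_measure. norm (indicat_real A v * curv_density m (halfspace_poly N u s t) v)
       \<le> \<rho> ^ m * (radon_const CARD('n) m * measure lborel (cball (0::real^'n) (\<rho> + 1)) ^ (CARD('n) - 1))"
    proof (rule AE_I2)
      fix v :: "real^'n" assume "v \<in> space sphere_measure"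
      then have v: "norm v = 1" by simp
      note C = curv_density_bounds[OF B(1-4) m v]
      show "norm (indicat_real A v * curv_density m (halfspace_poly N u s t) v)
       \<le> \<rho> ^ m * (radon_const CARD('n) m * measure lborel (cball (0::real^'n) (\<rho> + 1)) ^ (CARD('n) - 1))"
        using C by (simp add: indicator_def)
    qed
    show "(\<lambda>v. indicat_real A v * curv_density m (halfspace_poly N u s t) v) \<in> borel_measurable sphere_measure"
      using curv_density_measurable[OF B(1-4) m] A by measurable
  qed
qed

text \<open>
  Besides the hyperplanes orthogonal to the \<open>u k\<close>, the direction avoids those that contain every \<open>v\<close> whose
  ray meets the bounding hyperplanes \<open>i\<close> and \<open>k\<close> in the same point: eliminate \<open>r\<close> from
  \<open>t i * (r * (u i \<bullet> v)) = s i\<close> and \<open>t k * (r * (u k \<bullet> v)) = s k\<close>.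
\<close>

definition generic_dir :: "nat \<Rightarrow> (nat \<Rightarrow> real^'n) \<Rightarrow> (nat \<Rightarrow> real) \<Rightarrow> (nat \<Rightarrow> real) \<Rightarrow> real^'n \<Rightarrow> bool" where
  "generic_dir N u s t v \<longleftrightarrow> norm v = 1 \<and> (\<forall>k\<in>{1..N}. v \<bullet> u k \<noteq> 0) \<and>
     (\<forall>i\<in>{1..N}. \<forall>k\<in>{1..N}. (s i * t k) *\<^sub>R u k - (s k * t i) *\<^sub>R u i \<noteq> 0 \<longrightarrow>
        v \<bullet> ((s i * t k) *\<^sub>R u k - (s k * t i) *\<^sub>R u i) \<noteq> 0)"

text \<open>
  The conclusion concerns only one coefficient, since \<open>i\<close> and \<open>k\<close> can be exchanged.
\<close>

definition pairwise_indep :: "nat \<Rightarrow> (nat \<Rightarrow> 'a::euclidean_space) \<Rightarrow> bool" where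
  "pairwise_indep N u \<longleftrightarrow> (\<forall>i\<in>{1..N}. \<forall>k\<in>{1..N}. i \<noteq> k \<longrightarrow> (\<forall>a b. a *\<^sub>R u i = b *\<^sub>R u k \<longrightarrow> b = 0))"

lemma AE_generic_dir:
  fixes u :: "nat \<Rightarrow> real^'n"
  assumes "\<forall>k\<in>{1..N}. norm (u k) = 1"
  shows "AE v in sphere_measure. generic_dir N u s t v"
proof -
  have 1: "AE v in sphere_measure. \<forall>k\<in>{1..N}. v \<bullet> u k \<noteq> 0"
    using assms by (intro AE_finite_allI AE_sphere_measure_not_orthogonal) fastforce+
  have 2: "AE v in sphere_measure. \<forall>i\<in>{1..N}. \<forall>k\<in>{1..N}. (s i * t k) *\<^sub>R u k - (s k * t i) *\<^sub>R u i \<noteq> 0 \<longrightarrow>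
        v \<bullet> ((s i * t k) *\<^sub>R u k - (s k * t i) *\<^sub>R u i) \<noteq> 0"
    by (intro AE_finite_allI AE_impI AE_sphere_measure_not_orthogonal) auto
  show ?thesis using 1 2 AE_space
    by eventually_elim (auto simp: generic_dir_def)
qed

lemma generic_unique_tight:
  fixes u :: "nat \<Rightarrow> real^'n"
  assumes ad: "admissible N u \<rho> s t" and g: "generic_dir N u s t v" and pi: "pairwise_indep N u"
    and r: "0 < radial_fn (halfspace_poly N u s t) v"
    and ik: "i \<in> {1..N}" "k \<in> {1..N}" "i \<noteq> k"
    and tk: "t k * (radial_fn (halfspace_poly N u s t) v * (u k \<bullet> v)) = s k"
  shows "t i * (radial_fn (halfspace_poly N u s t) v * (u i \<bullet> v)) < s i"
proof -
  let ?r = "radial_fn (halfspace_poly N u s t) v"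
  have v: "norm v = 1" using g by (simp add: generic_dir_def)
  note R = radial_fn_props[OF admissible_body(1-4)[OF ad] v]
  have le: "t i * (?r * (u i \<bullet> v)) \<le> s i" using R(3) ik by (auto simp: halfspace_poly_def)
  have "t i * (?r * (u i \<bullet> v)) \<noteq> s i"
  proof
    assume ti: "t i * (?r * (u i \<bullet> v)) = s i"
    have pos: "t j \<noteq> 0" "s j \<noteq> 0" if "j \<in> {1..N}" "t j * (?r * (u j \<bullet> v)) = s j" for j
    proof -
      show "t j \<noteq> 0" using ad that by (fastforce simp: admissible_def)
      then show "s j \<noteq> 0" using that r g by (auto simp: generic_dir_def inner_commute)
    qed
    have "v \<bullet> ((s i * t k) *\<^sub>R u k - (s k * t i) *\<^sub>R u i) = s i * (t k * (u k \<bullet> v)) - s k * (t i * (u i \<bullet> v))"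
      by (simp add: inner_diff_right inner_commute)
    also have "t k * (u k \<bullet> v) = s k / ?r" using tk r by (simp add: field_simps)
    also have "t i * (u i \<bullet> v) = s i / ?r" using ti r by (simp add: field_simps)
    finally have "v \<bullet> ((s i * t k) *\<^sub>R u k - (s k * t i) *\<^sub>R u i) = 0" by simp
    then have "(s i * t k) *\<^sub>R u k - (s k * t i) *\<^sub>R u i = 0"
      using g ik(1,2) unfolding generic_dir_def by blast
    then have "(s i * t k) *\<^sub>R u k = (s k * t i) *\<^sub>R u i" by simp
    then have "s k * t i = 0" using pi ik by (metis pairwise_indep_def)
    then show False using pos[OF ik(1) ti] pos[OF ik(2) tk] by simp
  qed
  then show ?thesis using le by simp
qed

text \<open>
  For \<open>r > 0\<close> below the radial function, \<open>r v\<close> satisfies all constraints strictly: those with \<open>t k = 0\<close> are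
  strict everywhere, and the others are not constant along the ray. Strictly satisfied and violated
  constraints remain so under small changes of \<open>s\<close> and \<open>t\<close>.
\<close>

lemma radial_fn_poly_tendsto:
  fixes u :: "nat \<Rightarrow> real^'n"
  assumes ad: "admissible N u \<rho> s t" "\<And>j. admissible N u \<rho> (S j) (T j)"
    and lim: "\<And>k. k \<in> {1..N} \<Longrightarrow> (\<lambda>j. S j k) \<longlonglongrightarrow> s k" "\<And>k. k \<in> {1..N} \<Longrightarrow> (\<lambda>j. T j k) \<longlonglongrightarrow> t k"
    and v: "norm v = 1" "\<forall>k\<in>{1..N}. v \<bullet> u k \<noteq> 0"
  shows "(\<lambda>j. radial_fn (halfspace_poly N u (S j) (T j)) v) \<longlonglongrightarrow> radial_fn (halfspace_poly N u s t) v"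
proof (rule order_tendstoI)
  let ?r = "radial_fn (halfspace_poly N u s t) v"
  note R = radial_fn_props[OF admissible_body(1-4)[OF ad(1)] v(1)]
  note Rj = radial_fn_props[OF admissible_body(1-4)[OF ad(2)] v(1)]
  have limr: "(\<lambda>j. T j k * (u k \<bullet> (r *\<^sub>R v))) \<longlonglongrightarrow> t k * (u k \<bullet> (r *\<^sub>R v))" if "k \<in> {1..N}" for k r
    by (intro tendsto_intros lim that)
  {
    fix a assume a: "a < ?r"
    show "\<forall>\<^sub>F j in sequentially. a < radial_fn (halfspace_poly N u (S j) (T j)) v"
    proof (cases "a < 0")
      case True
      then show ?thesis using Rj(1) by (intro always_eventually allI) (meson less_le_trans)
    next
      case False
      \<comment> \<open>Not a itself, since a may be 0, where constraints with zero offset are not strict.\<close>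
      define r where "r = (a + ?r) / 2"
      have r: "0 < r" "a < r" "r < ?r" using False a by (auto simp: r_def)
      have strict: "t k * (u k \<bullet> (r *\<^sub>R v)) < s k" if k: "k \<in> {1..N}" for k
      proof -
        have adk: "0 \<le> t k" "0 \<le> s k" "t k = 0 \<longrightarrow> 0 < s k" using ad(1) k by (auto simp: admissible_def)
        consider "t k = 0" | "0 < t k" "0 < u k \<bullet> v" | "0 < t k" "u k \<bullet> v < 0"
          using v(2) k adk(1) by (metis inner_commute less_eq_real_def linorder_neqE_linordered_idom)
        then show ?thesis
        proof cases
          case 2
          have "t k * (u k \<bullet> (r *\<^sub>R v)) = r * (t k * (u k \<bullet> v))" by simp
          also have "\<dots> < ?r * (t k * (u k \<bullet> v))" using r 2 by (intro mult_strict_right_mono) auto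
          also have "\<dots> = t k * (u k \<bullet> (?r *\<^sub>R v))" by simp
          also have "\<dots> \<le> s k" using R(3) k unfolding halfspace_poly_def by blast
          finally show ?thesis .
        next
          case 3
          have "t k * (u k \<bullet> (r *\<^sub>R v)) = t k * (r * (u k \<bullet> v))" by simp
          also have "\<dots> < 0" using 3 r by (intro mult_pos_neg) auto
          finally show ?thesis using adk(2) by linarith
        qed (use adk in auto)
      qed
      have "\<forall>\<^sub>F j in sequentially. T j k * (u k \<bullet> (r *\<^sub>R v)) < S j k" if k: "k \<in> {1..N}" for k
        using order_tendstoD(2)[OF tendsto_diff[OF limr[OF k, of r] lim(1)[OF k]], of 0] strict[OF k] by simp
      then have "\<forall>\<^sub>F j in sequentially. \<forall>k\<in>{1..N}. T j k * (u k \<bullet> (r *\<^sub>R v)) < S j k"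
        by (intro eventually_ball_finite) auto
      then show ?thesis
      proof eventually_elim
        case (elim j)
        then have "r *\<^sub>R v \<in> halfspace_poly N u (S j) (T j)" unfolding halfspace_poly_def by (auto intro: less_imp_le)
        then show ?case using Rj(4)[of r j] r by auto
      qed
    qed
  }
  {
    fix a assume a: "?r < a"
    then have "a *\<^sub>R v \<notin> halfspace_poly N u s t" using R(1) R(4)[of a] by auto
    then obtain k where k: "k \<in> {1..N}" "s k < t k * (u k \<bullet> (a *\<^sub>R v))" by (auto simp: halfspace_poly_def not_le)
    have "\<forall>\<^sub>F j in sequentially. S j k < T j k * (u k \<bullet> (a *\<^sub>R v))"
      using order_tendstoD(1)[OF tendsto_diff[OF limr[OF k(1), of a] lim(1)[OF k(1)]], of 0] k(2) by simp
    then show "\<forall>\<^sub>F j in sequentially. radial_fn (halfspace_poly N u (S j) (T j)) v < a"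
    proof eventually_elim
      case (elim j)
      have "a *\<^sub>R v \<notin> halfspace_poly N u (S j) (T j)"
      proof
        assume "a *\<^sub>R v \<in> halfspace_poly N u (S j) (T j)"
        then have "T j k * (u k \<bullet> (a *\<^sub>R v)) \<le> S j k" using k(1) unfolding halfspace_poly_def by blast
        then show False using elim by simp
      qed
      then show ?case using Rj(4)[of a j] R(1) a by (auto simp: not_le)
    qed
  }
qed

text \<open>
  A projection \<open>p\<close> onto a subspace through \<open>v\<close> satisfies \<open>p (u k) \<bullet> v = u k \<bullet> v \<noteq> 0\<close>. Hence the points
  that \<open>p\<close> maps onto a bounding hyperplane form a hyperplane and are negligible, and at the
  other points membership in the polytope is stable.
\<close>

lemma radon_vol_poly_tendsto:
  fixes u :: "nat \<Rightarrow> real^'n"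
  assumes ad: "admissible N u \<rho> s t" "\<And>j. admissible N u \<rho> (S j) (T j)"
    and lim: "\<And>k. k \<in> {1..N} \<Longrightarrow> (\<lambda>j. S j k) \<longlonglongrightarrow> s k" "\<And>k. k \<in> {1..N} \<Longrightarrow> (\<lambda>j. T j k) \<longlonglongrightarrow> t k"
    and v: "norm v = 1" "\<forall>k\<in>{1..N}. v \<bullet> u k \<noteq> 0" and m: "0 < m" "m \<le> CARD('n)"
  shows "(\<lambda>j. radon_vol m (halfspace_poly N u (S j) (T j)) v) \<longlonglongrightarrow> radon_vol m (halfspace_poly N u s t) v"
proof (rule radon_vol_tendsto[OF v(1) _ _ _ m])
  fix p :: "real^'n \<Rightarrow> real^'n" assume p: "linear p" "p v = v" "\<And>x y. p x \<bullet> y = x \<bullet> p y"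
  have "AE x in lborel. t k * (u k \<bullet> p x) \<noteq> s k" if k: "k \<in> {1..N}" for k
  proof (cases "t k = 0")
    case True
    then show ?thesis using ad(1) k by (auto simp: admissible_def)
  next
    case False
    have "p (u k) \<bullet> v = u k \<bullet> v" using p(2) p(3)[of "u k" v] by simp
    then have "p (u k) \<noteq> 0" using v(2) k by (metis inner_commute inner_zero_left)
    then have "negligible {x. p (u k) \<bullet> x = s k / t k}" by (intro negligible_hyperplane) simp
    moreover have "closed {x. p (u k) \<bullet> x = s k / t k}" by (rule closed_hyperplane)
    ultimately have "{x. p (u k) \<bullet> x = s k / t k} \<in> null_sets lborel"
      by (auto simp: negligible_iff_null_sets null_sets_completion_iff)
    then have "AE x in lborel. x \<notin> {x. p (u k) \<bullet> x = s k / t k}" by (rule AE_not_in)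
    then show ?thesis using False p(3)[of "u k"] by (auto elim!: eventually_mono simp: field_simps)
  qed
  then have "AE x in lborel. \<forall>k\<in>{1..N}. t k * (u k \<bullet> p x) \<noteq> s k" by (intro AE_finite_allI) auto
  then show "AE x in lborel. \<forall>\<^sub>F j in sequentially. p x \<in> halfspace_poly N u (S j) (T j) \<longleftrightarrow> p x \<in> halfspace_poly N u s t"
  proof eventually_elim
    case (elim x)
    have "\<forall>\<^sub>F j in sequentially. (T j k * (u k \<bullet> p x) \<le> S j k) = (t k * (u k \<bullet> p x) \<le> s k)" if k: "k \<in> {1..N}" for k
    proof -
      have l: "(\<lambda>j. T j k * (u k \<bullet> p x) - S j k) \<longlonglongrightarrow> t k * (u k \<bullet> p x) - s k"
        by (intro tendsto_intros lim k)
      show ?thesis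
      proof (cases "t k * (u k \<bullet> p x) \<le> s k")
        case True
        then have "t k * (u k \<bullet> p x) - s k < 0" using elim k by force
        from order_tendstoD(2)[OF l this] show ?thesis by eventually_elim (use True in auto)
      next
        case False
        then have "0 < t k * (u k \<bullet> p x) - s k" by simp
        from order_tendstoD(1)[OF l this] show ?thesis by eventually_elim (use False in auto)
      qed
    qed
    then have "\<forall>\<^sub>F j in sequentially. \<forall>k\<in>{1..N}. (T j k * (u k \<bullet> p x) \<le> S j k) = (t k * (u k \<bullet> p x) \<le> s k)"
      by (intro eventually_ball_finite) auto
    then show ?case by eventually_elim (simp add: halfspace_poly_def)
  qed
qed (use admissible_body(4,5)[OF ad(1)] admissible_body(4,5)[OF ad(2)] in auto)

text \<open>
  Dominated convergence. For a generic direction exactly one constraint is tight, and the others stay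
  strict, so the index of the facet that is hit is eventually constant. If the origin is a boundary point
  and the radial function vanishes at \<open>v\<close>, the index may oscillate, but then the density tends to zero.
\<close>

lemma facet_mass_tendsto:
  fixes u :: "nat \<Rightarrow> real^'n"
  assumes ad: "admissible N u \<rho> s t" "\<And>j. admissible N u \<rho> (S j) (T j)"
    and lim: "\<And>k. k \<in> {1..N} \<Longrightarrow> (\<lambda>j. S j k) \<longlonglongrightarrow> s k" "\<And>k. k \<in> {1..N} \<Longrightarrow> (\<lambda>j. T j k) \<longlonglongrightarrow> t k"
    and unit: "\<forall>k\<in>{1..N}. norm (u k) = 1" and pi: "pairwise_indep N u"
    and m: "0 < m" "m \<le> CARD('n)" and k: "k \<in> {1..N}"
  shows "(\<lambda>j. facet_mass m N u (S j) (T j) k) \<longlonglongrightarrow> facet_mass m N u s t k"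
  unfolding facet_mass_def
proof (rule integral_dominated_convergence)
  interpret finite_measure "sphere_measure :: (real^'n) measure" by (rule finite_measure_sphere_measure)
  let ?B = "\<rho> ^ m * (radon_const CARD('n) m * measure lborel (cball (0::real^'n) (\<rho> + 1)) ^ (CARD('n) - 1))"
  show "integrable sphere_measure (\<lambda>_ :: real^'n. ?B)" by (rule integrable_const)
  show "AE v in sphere_measure. norm (indicat_real (facet_cone N u (S j) (T j) k) v * curv_density m (halfspace_poly N u (S j) (T j)) v) \<le> ?B" for j
  proof (rule AE_I2)
    fix v :: "real^'n" assume "v \<in> space sphere_measure"
    then have v: "norm v = 1" by simp
    note C = curv_density_bounds[OF admissible_body(1-4)[OF ad(2)] m v, of j]
    show "norm (indicat_real (facet_cone N u (S j) (T j) k) v * curv_density m (halfspace_poly N u (S j) (T j)) v) \<le> ?B"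
      using C by (simp add: indicator_def)
  qed
  have ae: "AE v in sphere_measure. generic_dir N u s t v" by (rule AE_generic_dir) (rule unit)
  show "AE v in sphere_measure. (\<lambda>j. indicat_real (facet_cone N u (S j) (T j) k) v * curv_density m (halfspace_poly N u (S j) (T j)) v)
      \<longlonglongrightarrow> indicat_real (facet_cone N u s t k) v * curv_density m (halfspace_poly N u s t) v"
    using ae
  proof eventually_elim
    case (elim v)
    note gen = elim
    then have v: "norm v = 1" "\<forall>k\<in>{1..N}. v \<bullet> u k \<noteq> 0" by (auto simp: generic_dir_def)
    let ?r = "radial_fn (halfspace_poly N u s t) v"
    let ?rj = "\<lambda>j. radial_fn (halfspace_poly N u (S j) (T j)) v"
    have rl: "?rj \<longlonglongrightarrow> ?r" by (rule radial_fn_poly_tendsto[OF ad lim v])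
    have dl: "(\<lambda>j. curv_density m (halfspace_poly N u (S j) (T j)) v) \<longlonglongrightarrow> curv_density m (halfspace_poly N u s t) v"
      unfolding curv_density_def by (intro tendsto_intros rl radon_vol_poly_tendsto[OF ad lim v m])
    show ?case
    proof (cases "?r = 0")
      case True
      then have z: "curv_density m (halfspace_poly N u s t) v = 0" using m by (simp add: curv_density_def)
      have "(\<lambda>j. indicat_real (facet_cone N u (S j) (T j) k) v * curv_density m (halfspace_poly N u (S j) (T j)) v) \<longlonglongrightarrow> 0"
      proof (rule Lim_null_comparison)
        show "(\<lambda>j. \<bar>curv_density m (halfspace_poly N u (S j) (T j)) v\<bar>) \<longlonglongrightarrow> 0"
          using tendsto_rabs[OF dl] z by simp
      qed (auto simp: indicator_def)
      then show ?thesis using z by simp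
    next
      case False
      then have r: "0 < ?r" using radial_fn_props(1)[OF admissible_body(1-4)[OF ad(1)] v(1)] by simp
      obtain k0 where k0: "k0 \<in> {1..N}" "t k0 * (?r * (u k0 \<bullet> v)) = s k0"
        using admissible_tight[OF ad(1) v(1)] by metis
      have strict: "\<forall>\<^sub>F j in sequentially. T j i * (?rj j * (u i \<bullet> v)) < S j i" if i: "i \<in> {1..N}" "i \<noteq> k0" for i
      proof -
        have lt: "t i * (?r * (u i \<bullet> v)) - s i < 0"
          using generic_unique_tight[OF ad(1) gen pi r i(1) k0(1) i(2) k0(2)] by simp
        have "(\<lambda>j. T j i * (?rj j * (u i \<bullet> v)) - S j i) \<longlonglongrightarrow> t i * (?r * (u i \<bullet> v)) - s i"
          by (intro tendsto_intros rl lim i)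
        from order_tendstoD(2)[OF this lt] show ?thesis by eventually_elim simp
      qed
      have "\<forall>\<^sub>F j in sequentially. \<forall>i\<in>{1..N} - {k0}. T j i * (?rj j * (u i \<bullet> v)) < S j i"
        using strict by (intro eventually_ball_finite) auto
      then have "\<forall>\<^sub>F j in sequentially. v \<in> facet_cone N u (S j) (T j) k \<longleftrightarrow> v \<in> facet_cone N u s t k"
      proof eventually_elim
        case (elim j)
        note st = elim
        obtain kj where kj: "kj \<in> {1..N}" "T j kj * (?rj j * (u kj \<bullet> v)) = S j kj"
          using admissible_tight[OF ad(2) v(1)] by metis
        have kj0: "kj = k0"
        proof (rule ccontr)
          assume "kj \<noteq> k0"
          then have "kj \<in> {1..N} - {k0}" using kj(1) by simp
          then show False using st kj(2) by force
        qed
        have "v \<in> facet_cone N u (S j) (T j) k \<longleftrightarrow> k = k0"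
        proof (cases "k = k0")
          case True
          then show ?thesis using kj(2) kj0 v(1) by (simp add: facet_cone_def)
        next
          case False
          then have "T j k * (?rj j * (u k \<bullet> v)) < S j k" using st k by simp
          then show ?thesis using False by (simp add: facet_cone_def)
        qed
        moreover have "v \<in> facet_cone N u s t k \<longleftrightarrow> k = k0"
        proof (cases "k = k0")
          case True
          then show ?thesis using k0(2) v(1) by (simp add: facet_cone_def)
        next
          case False
          have "t k * (?r * (u k \<bullet> v)) < s k"
            by (rule generic_unique_tight[OF ad(1) gen pi r k k0(1) False k0(2)])
          then show ?thesis using False by (simp add: facet_cone_def)
        qed
        ultimately show ?case by simp
      qed
      then have "(\<lambda>j. indicat_real (facet_cone N u (S j) (T j) k) v) \<longlonglongrightarrow> indicat_real (facet_cone N u s t k) v"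
        by (intro tendsto_eventually) (auto elim!: eventually_mono simp: indicator_def)
      then show ?thesis by (intro tendsto_mult dl)
    qed
  qed
qed (rule borel_measurable_integrable[OF facet_integrand_integrable[OF ad(1) m facet_cone_measurable[OF ad(1)]]]
    borel_measurable_integrable[OF facet_integrand_integrable[OF ad(2) m facet_cone_measurable[OF ad(2)]]])+

lemma facet_mass_nonneg:
  fixes u :: "nat \<Rightarrow> real^'n"
  assumes ad: "admissible N u \<rho> s t" and m: "0 < m" "m \<le> CARD('n)"
  shows "0 \<le> facet_mass m N u s t k"
  unfolding facet_mass_def
  using curv_density_bounds(1)[OF admissible_body(1-4)[OF ad] m]
  by (intro integral_nonneg_AE AE_I2) auto

text \<open>
  A facet through the origin is seen from it only in directions orthogonal to its normal, which form a null
  set, or in directions where the radial function, and with it the density, vanishes.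
\<close>

lemma facet_mass_zero:
  fixes u :: "nat \<Rightarrow> real^'n"
  assumes ad: "admissible N u \<rho> s t" and unit: "\<forall>k\<in>{1..N}. norm (u k) = 1"
    and k: "k \<in> {1..N}" and m: "0 < m" and z: "t k = 0 \<or> s k = 0"
  shows "facet_mass m N u s t k = 0"
  unfolding facet_mass_def
proof (rule integral_eq_zero_AE)
  have ae: "AE v in sphere_measure. generic_dir N u s t v" by (rule AE_generic_dir) (rule unit)
  show "AE v in sphere_measure. indicat_real (facet_cone N u s t k) v * curv_density m (halfspace_poly N u s t) v = 0"
    using ae
  proof eventually_elim
    case (elim v)
    then have vk: "u k \<bullet> v \<noteq> 0" using k by (auto simp: generic_dir_def inner_commute)
    have pos: "t k = 0 \<longrightarrow> 0 < s k" using ad k by (auto simp: admissible_def)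
    show ?case
    proof (cases "v \<in> facet_cone N u s t k")
      case True
      then have "t k * (radial_fn (halfspace_poly N u s t) v * (u k \<bullet> v)) = s k" by (simp add: facet_cone_def)
      then have "radial_fn (halfspace_poly N u s t) v = 0" using z pos vk by auto
      then show ?thesis using m by (simp add: curv_density_def)
    qed simp
  qed
qed

text \<open>
  The facet cones cover the sphere, and the density is positive on the directions in which a sphere through
  a nonzero interior point meets the interior. They form a nonempty open part of the unit sphere.
\<close>

lemma facet_mass_exists_pos:
  fixes u :: "nat \<Rightarrow> real^'n"
  assumes ad: "admissible N u \<rho> s t" and m: "0 < m" "m \<le> CARD('n)" and n: "2 \<le> CARD('n)"
  shows "\<exists>k\<in>{1..N}. 0 < facet_mass m N u s t k"
proof (rule ccontr)
  assume no: "\<not> ?thesis"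
  let ?P = "halfspace_poly N u s t"
  note B = admissible_body[OF ad]
  have z: "facet_mass m N u s t k = 0" if "k \<in> {1..N}" for k
    using no that facet_mass_nonneg[OF ad m] by (meson linorder_not_less order_antisym)
  have "AE v in sphere_measure. indicat_real (facet_cone N u s t k) v * curv_density m ?P v = 0" if k: "k \<in> {1..N}" for k
  proof -
    have int: "integrable sphere_measure (\<lambda>v. indicat_real (facet_cone N u s t k) v * curv_density m ?P v)"
      by (rule facet_integrand_integrable[OF ad m facet_cone_measurable[OF ad]])
    have nn: "AE v in sphere_measure. 0 \<le> indicat_real (facet_cone N u s t k) v * curv_density m ?P v"
      using curv_density_bounds(1)[OF B(1-4) m] by (intro AE_I2) auto
    show ?thesis using integral_nonneg_eq_0_iff_AE[OF int nn] z[OF k] by (simp add: facet_mass_def)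
  qed
  then have "AE v in sphere_measure. \<forall>k\<in>{1..N}. indicat_real (facet_cone N u s t k) v * curv_density m ?P v = 0"
    by (intro AE_finite_allI) auto
  then have ae: "AE v in sphere_measure. curv_density m ?P v = 0"
    using AE_space
  proof eventually_elim
    case (elim v)
    then have v: "norm v = 1" by simp
    obtain k where "k \<in> {1..N}" "t k * (radial_fn ?P v * (u k \<bullet> v)) = s k"
      using admissible_tight[OF ad v] by metis
    then have "k \<in> {1..N}" "v \<in> facet_cone N u s t k" using v by (auto simp: facet_cone_def)
    then show ?case using elim(1) by force
  qed
  obtain z0 where z0: "z0 \<in> interior ?P" using ad by (auto simp: admissible_def)
  obtain z where z: "z \<in> interior ?P" "z \<noteq> 0"
  proof (cases "z0 = 0")
    case True
    then obtain e where e: "0 < e" "ball 0 e \<subseteq> interior ?P" using z0 open_interior[of ?P] by (metis open_contains_ball)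
    obtain b :: "real^'n" where b: "b \<in> Basis" using nonempty_Basis by blast
    have "(e/2) *\<^sub>R b \<in> ball 0 e" using e(1) b by simp
    then have "(e/2) *\<^sub>R b \<in> interior ?P" using e(2) by blast
    moreover have "(e/2) *\<^sub>R b \<noteq> 0" using e(1) b by (simp add: nonzero_Basis)
    ultimately show ?thesis by (rule that)
  qed (use z0 that in blast)
  define c where "c = norm z"
  have c: "0 < c" using z by (simp add: c_def)
  let ?U = "(\<lambda>v. c *\<^sub>R v) -` interior ?P"
  have "open ?U" by (intro continuous_open_vimage continuous_intros open_interior)
  moreover have "(1/c) *\<^sub>R z \<in> ?U \<inter> sphere 0 1" using c z by (simp add: c_def)
  then have "?U \<inter> sphere 0 1 \<noteq> {}" by blast
  ultimately have "0 < hausdorff_outer (DIM(real^'n) - 1) (?U \<inter> sphere 0 1)"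
    using n by (intro hausdorff_outer_open_in_sphere_pos) simp_all
  then have "0 < emeasure sphere_measure (?U \<inter> sphere 0 1)"
    using \<open>open ?U\<close> by (subst emeasure_sphere_measure) auto
  moreover have "emeasure sphere_measure (?U \<inter> sphere 0 1) = 0"
  proof -
    have "AE v in sphere_measure. v \<notin> ?U \<inter> sphere 0 1"
      using ae
    proof eventually_elim
      case (elim v)
      show ?case
      proof
        assume "v \<in> ?U \<inter> sphere 0 1"
        then have v: "norm v = 1" "c *\<^sub>R v \<in> interior ?P" by auto
        have "c *\<^sub>R v \<in> ?P" using v(2) interior_subset by blast
        then have "c \<le> radial_fn ?P v" using radial_fn_props(4)[OF B(1-4) v(1), of c] c by simp
        moreover have "0 < radon_vol m ?P v" by (rule radon_vol_pos[OF v(1) B(5) B(4) m v(2)])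
        ultimately have "0 < curv_density m ?P v" using c unfolding curv_density_def by (intro mult_pos_pos zero_less_power) auto
        then show False using elim by simp
      qed
    qed
    moreover have "?U \<inter> sphere 0 1 \<in> sets sphere_measure"
      using \<open>open ?U\<close> by (auto simp: sets_sphere_measure sets_restrict_space_iff)
    ultimately show ?thesis by (simp add: AE_iff_measurable[OF _ refl] AE_iff_null_sets null_setsD1)
  qed
  ultimately show False by simp
qed

lemma halfspace_poly_scale:
  assumes l: "0 < l"
  shows "halfspace_poly N u (\<lambda>k. l * s k) t = (\<lambda>x. l *\<^sub>R x) ` halfspace_poly N u s t"
proof (intro equalityI subsetI)
  fix x assume x: "x \<in> halfspace_poly N u (\<lambda>k. l * s k) t"
  have "(1/l) *\<^sub>R x \<in> halfspace_poly N u s t" using x l by (auto simp: halfspace_poly_def field_simps)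
  moreover have "x = l *\<^sub>R ((1/l) *\<^sub>R x)" using l by simp
  ultimately show "x \<in> (\<lambda>x. l *\<^sub>R x) ` halfspace_poly N u s t" by blast
next
  fix x assume "x \<in> (\<lambda>x. l *\<^sub>R x) ` halfspace_poly N u s t"
  then obtain y where y: "y \<in> halfspace_poly N u s t" "x = l *\<^sub>R y" by blast
  show "x \<in> halfspace_poly N u (\<lambda>k. l * s k) t"
    unfolding halfspace_poly_def mem_Collect_eq
  proof
    fix k assume "k \<in> {1..N}"
    then have "l * (t k * (u k \<bullet> y)) \<le> l * s k" using y(1) l by (intro mult_left_mono) (auto simp: halfspace_poly_def)
    then show "t k * (u k \<bullet> x) \<le> l * s k" by (simp add: y(2) mult_ac)
  qed
qed

lemma radial_fn_scale:
  fixes K :: "'a::euclidean_space set"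
  assumes l: "0 < l" and K: "compact K" "convex K" "0 \<in> K" "K \<subseteq> cball 0 \<rho>" and v: "norm v = 1"
  shows "radial_fn ((\<lambda>x. l *\<^sub>R x) ` K) v = l * radial_fn K v"
proof -
  let ?lK = "(\<lambda>x. l *\<^sub>R x) ` K"
  have lK: "compact ?lK" "convex ?lK" "0 \<in> ?lK" "?lK \<subseteq> cball 0 (l * \<rho>)"
    using K l by (auto simp: compact_scaling convex_scaling image_iff intro!: bexI[of _ 0])
  note R = radial_fn_props[OF K v] and L = radial_fn_props[OF lK v]
  have mem: "r *\<^sub>R v \<in> ?lK \<longleftrightarrow> (r / l) *\<^sub>R v \<in> K" for r
  proof
    assume "r *\<^sub>R v \<in> ?lK"
    then obtain y where y: "y \<in> K" "r *\<^sub>R v = l *\<^sub>R y" by blast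
    have "(r / l) *\<^sub>R v = (1 / l) *\<^sub>R (r *\<^sub>R v)" by simp
    also have "\<dots> = y" unfolding y(2) using l by simp
    finally show "(r / l) *\<^sub>R v \<in> K" using y(1) by simp
  next
    assume "(r / l) *\<^sub>R v \<in> K"
    moreover have "r *\<^sub>R v = l *\<^sub>R ((r / l) *\<^sub>R v)" using l by simp
    ultimately show "r *\<^sub>R v \<in> ?lK" by blast
  qed
  have "(radial_fn ?lK v / l) *\<^sub>R v \<in> K" using L(3) mem by blast
  then have "radial_fn ?lK v / l \<le> radial_fn K v" using R(4)[of "radial_fn ?lK v / l"] L(1) l by simp
  moreover have "(l * radial_fn K v) *\<^sub>R v \<in> ?lK" using R(3) mem[of "l * radial_fn K v"] l by simp
  then have "l * radial_fn K v \<le> radial_fn ?lK v" using L(4)[of "l * radial_fn K v"] R(1) l by simp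
  ultimately show ?thesis using l by (simp add: field_simps)
qed

text \<open>
  The radial function contributes the exponent \<open>m\<close> and the power of section volumes the exponent
  \<open>m (n - 1)\<close>.
\<close>

lemma facet_mass_scale:
  fixes u :: "nat \<Rightarrow> real^'n"
  assumes ad: "admissible N u \<rho> s t" and m: "0 < m" "m \<le> CARD('n)" and l: "0 < l"
  shows "facet_mass m N u (\<lambda>k. l * s k) t k = l ^ (m * CARD('n)) * facet_mass m N u s t k"
proof -
  let ?P = "halfspace_poly N u s t"
  note B = admissible_body[OF ad]
  have "facet_mass m N u (\<lambda>k. l * s k) t k
     = (LINT v|sphere_measure. l ^ (m * CARD('n)) * (indicat_real (facet_cone N u s t k) v * curv_density m ?P v))"
    unfolding facet_mass_def
  proof (rule Bochner_Integration.integral_cong[OF refl])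
    fix v :: "real^'n" assume "v \<in> space sphere_measure"
    then have v: "norm v = 1" by simp
    have r: "radial_fn (halfspace_poly N u (\<lambda>k. l * s k) t) v = l * radial_fn ?P v"
      unfolding halfspace_poly_scale[OF l] by (rule radial_fn_scale[OF l B(1-4) v])
    have "t k * (l * radial_fn ?P v * (u k \<bullet> v)) = l * (t k * (radial_fn ?P v * (u k \<bullet> v)))" by simp
    then have "v \<in> facet_cone N u (\<lambda>k. l * s k) t k \<longleftrightarrow> v \<in> facet_cone N u s t k"
      using l by (simp add: facet_cone_def r)
    then have i: "indicat_real (facet_cone N u (\<lambda>k. l * s k) t k) v = indicat_real (facet_cone N u s t k) v"
      by (simp add: indicator_def)
    have "m * CARD('n) = m + m * (CARD('n) - 1)"
      using mult_Suc_right[of m "CARD('n) - 1"] Suc_pred[OF zero_less_card_finite[where 'a='n]] by (simp only: One_nat_def)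
    then have e: "l ^ (m * CARD('n)) = l ^ m * l ^ (m * (CARD('n) - 1))" by (simp only: power_add)
    have "curv_density m (halfspace_poly N u (\<lambda>k. l * s k) t) v = l ^ (m * CARD('n)) * curv_density m ?P v"
      unfolding curv_density_def r unfolding halfspace_poly_scale[OF l]
        radon_vol_scale[OF v halfspace_poly_closed_convex(1) m l] e power_mult_distrib by (simp only: mult_ac)
    then show "indicat_real (facet_cone N u (\<lambda>k. l * s k) t k) v * curv_density m (halfspace_poly N u (\<lambda>k. l * s k) t) v
       = l ^ (m * CARD('n)) * (indicat_real (facet_cone N u s t k) v * curv_density m ?P v)"
      using i by simp
  qed
  then show ?thesis by (simp add: facet_mass_def)
qed

section \<open>A fixed point theorem\<close>

lemma unit_cube_convergent_subsequence:
  fixes X :: "nat \<Rightarrow> nat \<Rightarrow> real"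
  assumes "\<And>j i. i < n \<Longrightarrow> 0 \<le> X j i \<and> X j i \<le> 1"
  shows "\<exists>r l. strict_mono (r :: nat \<Rightarrow> nat) \<and> (\<forall>i<n. (\<lambda>j. X (r j) i) \<longlonglongrightarrow> l i)"
  using assms
proof (induction n)
  case 0
  then show ?case by (auto intro!: exI[of _ id] strict_mono_id)
next
  case (Suc n)
  then obtain r l where r: "strict_mono (r :: nat \<Rightarrow> nat)" "\<And>i. i < n \<Longrightarrow> (\<lambda>j. X (r j) i) \<longlonglongrightarrow> l i"
    by auto
  have bd: "\<forall>j. X (r j) n \<in> {0..1}" using Suc.prems by auto
  obtain a s where s: "strict_mono (s :: nat \<Rightarrow> nat)" "((\<lambda>j. X (r j) n) \<circ> s) \<longlonglongrightarrow> a"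
    by (rule seq_compactE[OF compact_imp_seq_compact[OF compact_Icc[of "0::real" 1]] bd])
  have "(\<lambda>j. X ((r \<circ> s) j) i) \<longlonglongrightarrow> (l(n := a)) i" if "i < Suc n" for i
    using that s(2) LIMSEQ_subseq_LIMSEQ[OF r(2)[of i] s(1)]
    by (cases "i = n") (auto simp: comp_def)
  then show ?case using strict_mono_o[OF r(1) s(1)] by blast
qed

text \<open>
  Brouwer's theorem for a cube whose dimension is a number, in sequential form. Kuhn's lemma gives, for
  every mesh, a small cube on which each coordinate of \<open>f\<close> moves both upwards and downwards; any
  limit of these cubes is a fixed point.
\<close>

lemma brouwer_nat_cube:
  fixes f :: "nat \<Rightarrow> (nat \<Rightarrow> real) \<Rightarrow> real" and n :: nat
  defines "Q \<equiv> {x. \<forall>i<n. 0 \<le> x i \<and> x i \<le> 1}"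
  assumes cont: "\<And>X x i. (\<And>j. X j \<in> Q) \<Longrightarrow> x \<in> Q \<Longrightarrow> (\<And>i. i < n \<Longrightarrow> (\<lambda>j. X j i) \<longlonglongrightarrow> x i)
      \<Longrightarrow> i < n \<Longrightarrow> (\<lambda>j. f i (X j)) \<longlonglongrightarrow> f i x"
    and into: "\<And>x i. x \<in> Q \<Longrightarrow> i < n \<Longrightarrow> 0 \<le> f i x \<and> f i x \<le> 1"
  shows "\<exists>x\<in>Q. \<forall>i<n. f i x = x i"
proof -
  define grid :: "nat \<Rightarrow> (nat \<Rightarrow> nat) \<Rightarrow> nat \<Rightarrow> real" where "grid p y i = real (y i) / real (Suc p)" for p y i
  define label :: "nat \<Rightarrow> (nat \<Rightarrow> nat) \<Rightarrow> nat \<Rightarrow> nat" where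
    "label p y i = (if y i = 0 then 0 else if y i = Suc p then 1
        else if grid p y i \<le> f i (grid p y) then 0 else 1)" for p y i
  have grid: "grid p y \<in> Q" if "\<forall>i<n. y i \<le> Suc p" for p y
    using that by (auto simp: grid_def Q_def divide_le_eq_1)
  have lab: "if label p y i = 0 then grid p y i \<le> f i (grid p y) else f i (grid p y) \<le> grid p y i"
    if "\<forall>i<n. y i \<le> Suc p" "i < n" for p y i
    using into[OF grid[OF that(1)] that(2)] by (auto simp: label_def grid_def)
  define kuhn where "kuhn p q \<longleftrightarrow> (\<forall>i<n. q i < Suc p) \<and> (\<forall>i<n. \<exists>r s. (\<forall>j<n. q j \<le> r j \<and> r j \<le> q j + 1) \<and>
      (\<forall>j<n. q j \<le> s j \<and> s j \<le> q j + 1) \<and> label p r i \<noteq> label p s i)" for p q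
  have "\<forall>p. \<exists>q. kuhn p q"
  proof
    fix p
    have L: "\<And>y i. label p y i = 0 \<or> label p y i = 1" "\<And>y i. y i = 0 \<Longrightarrow> label p y i = 0"
        "\<And>y i. y i = Suc p \<Longrightarrow> label p y i = 1"
      by (auto simp: label_def)
    show "\<exists>q. kuhn p q"
      unfolding kuhn_def by (rule kuhn_lemma[of "Suc p" n "label p"]) (use L in blast)+
  qed
  from choice[OF this] obtain q where kuhn: "\<And>p. kuhn p (q p)" by blast
  have q: "\<And>p i. i < n \<Longrightarrow> q p i < Suc p"
      "\<And>p i. i < n \<Longrightarrow> \<exists>r s. (\<forall>j<n. q p j \<le> r j \<and> r j \<le> q p j + 1) \<and>
        (\<forall>j<n. q p j \<le> s j \<and> s j \<le> q p j + 1) \<and> label p r i \<noteq> label p s i"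
    using kuhn unfolding kuhn_def by auto
  have "\<exists>a b. (\<forall>j<n. q p j \<le> a j \<and> a j \<le> q p j + 1) \<and> (\<forall>j<n. q p j \<le> b j \<and> b j \<le> q p j + 1)
      \<and> grid p a i \<le> f i (grid p a) \<and> f i (grid p b) \<le> grid p b i" if i: "i < n" for p i
  proof -
    obtain r s where rs: "\<forall>j<n. q p j \<le> r j \<and> r j \<le> q p j + 1" "\<forall>j<n. q p j \<le> s j \<and> s j \<le> q p j + 1"
      "label p r i \<noteq> label p s i" using q(2)[OF i] by blast
    have below: "\<forall>j<n. c j \<le> Suc p" if "\<forall>j<n. q p j \<le> c j \<and> c j \<le> q p j + 1" for c
    proof (intro allI impI)
      fix j assume "j < n"
      then show "c j \<le> Suc p" using that q(1)[of j p] by force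
    qed
    have "\<forall>j<n. r j \<le> Suc p" "\<forall>j<n. s j \<le> Suc p" using below rs by auto
    note lab[OF this(1) i] lab[OF this(2) i]
    moreover have "label p r i = 0 \<longleftrightarrow> label p s i \<noteq> 0" using rs(3) by (auto simp: label_def split: if_splits)
    ultimately show ?thesis using rs(1,2) by (cases "label p r i = 0") (simp, blast)+
  qed
  then obtain a b where
    a: "\<And>i p. i < n \<Longrightarrow> \<forall>j<n. q p j \<le> a i p j \<and> a i p j \<le> q p j + 1" and
    b: "\<And>i p. i < n \<Longrightarrow> \<forall>j<n. q p j \<le> b i p j \<and> b i p j \<le> q p j + 1" and
    ab: "\<And>i p. i < n \<Longrightarrow> grid p (a i p) i \<le> f i (grid p (a i p))"
      "\<And>i p. i < n \<Longrightarrow> f i (grid p (b i p)) \<le> grid p (b i p) i"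
    by metis
  obtain r l where r: "strict_mono (r :: nat \<Rightarrow> nat)"
      and l: "\<And>i. i < n \<Longrightarrow> (\<lambda>j. grid (r j) (q (r j)) i) \<longlonglongrightarrow> l i"
  proof -
    have bd: "0 \<le> grid j (q j) i \<and> grid j (q j) i \<le> 1" if "i < n" for j i
      using q(1)[OF that, of j] by (simp add: grid_def)
    have "\<exists>r l. strict_mono (r :: nat \<Rightarrow> nat) \<and> (\<forall>i<n. (\<lambda>j. grid (r j) (q (r j)) i) \<longlonglongrightarrow> l i)"
      by (rule unit_cube_convergent_subsequence) (rule bd)
    then show ?thesis using that by blast
  qed
  have lQ: "l \<in> Q"
    unfolding Q_def
  proof (clarify, intro conjI)
    fix i assume i: "i < n"
    have "0 \<le> grid (r j) (q (r j)) i \<and> grid (r j) (q (r j)) i \<le> 1" for j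
      using q(1)[OF i, of "r j"] by (simp add: grid_def)
    then show "0 \<le> l i" "l i \<le> 1"
      by (auto intro: LIMSEQ_le_const[OF l[OF i]] LIMSEQ_le_const2[OF l[OF i]])
  qed
  have near: "(\<lambda>j. grid (r j) (c (r j)) i) \<longlonglongrightarrow> l i"
    if c: "\<And>p. \<forall>j<n. q p j \<le> c p j \<and> c p j \<le> q p j + 1" and i: "i < n" for c i
  proof -
    have "(\<lambda>p. grid p (c p) i - grid p (q p) i) \<longlonglongrightarrow> 0"
    proof (rule tendsto_sandwich)
      show "\<forall>\<^sub>F p in sequentially. 0 \<le> grid p (c p) i - grid p (q p) i"
        using c i by (intro always_eventually) (auto simp: grid_def divide_right_mono)
      show "\<forall>\<^sub>F p in sequentially. grid p (c p) i - grid p (q p) i \<le> 1 / real (Suc p)"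
      proof (intro always_eventually allI)
        fix p
        have "real (c p i) \<le> real (q p i) + 1" using c[of p] i by force
        then show "grid p (c p) i - grid p (q p) i \<le> 1 / real (Suc p)"
          unfolding grid_def diff_divide_distrib[symmetric] by (intro divide_right_mono) auto
      qed
    qed (auto intro: LIMSEQ_Suc[OF lim_1_over_n] simp del: of_nat_Suc)
    then have "(\<lambda>j. grid (r j) (c (r j)) i - grid (r j) (q (r j)) i) \<longlonglongrightarrow> 0"
      using LIMSEQ_subseq_LIMSEQ[OF _ r] by (fastforce simp: comp_def)
    from tendsto_add[OF this l[OF i]] show ?thesis by simp
  qed
  have "f i l = l i" if i: "i < n" for i
  proof (rule antisym)
    have inQ: "grid p (c p) \<in> Q" if "\<And>p. \<forall>j<n. q p j \<le> c p j \<and> c p j \<le> q p j + 1" for c p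
    proof (intro grid allI impI)
      fix i assume "i < n"
      then show "c p i \<le> Suc p" using that[of p] q(1)[of i p] by force
    qed
    show "f i l \<le> l i"
    proof (rule LIMSEQ_le)
      show "(\<lambda>j. f i (grid (r j) (b i (r j)))) \<longlonglongrightarrow> f i l"
        using near[OF b[OF i]] inQ[OF b[OF i]] by (intro cont[OF _ lQ _ i])
      show "(\<lambda>j. grid (r j) (b i (r j)) i) \<longlonglongrightarrow> l i" by (rule near[OF b[OF i] i])
    qed (use ab(2)[OF i] in blast)
    show "l i \<le> f i l"
    proof (rule LIMSEQ_le)
      show "(\<lambda>j. f i (grid (r j) (a i (r j)))) \<longlonglongrightarrow> f i l"
        using near[OF a[OF i]] inQ[OF a[OF i]] by (intro cont[OF _ lQ _ i])
      show "(\<lambda>j. grid (r j) (a i (r j)) i) \<longlonglongrightarrow> l i" by (rule near[OF a[OF i] i])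
    qed (use ab(1)[OF i] in blast)
  qed
  then show ?thesis using lQ by blast
qed

text \<open>
  Two fixed point arguments run simultaneously: Nash's map, which raises the weights of the coordinates
  with positive payoff \<open>G\<close>, and a step against the vector field \<open>V\<close>, clamped to a cube. Since the mean payoff is
  zero, a fixed point of the first has no positive payoffs; since \<open>V\<close> points outwards, a
  fixed point of the second is a zero of \<open>V\<close>.
\<close>

lemma simplex_ball_equilibrium:
  fixes G :: "(nat \<Rightarrow> real) \<Rightarrow> 'a::euclidean_space \<Rightarrow> nat \<Rightarrow> real"
    and M :: nat
    and V :: "(nat \<Rightarrow> real) \<Rightarrow> 'a \<Rightarrow> 'a"
    and R :: real
  defines "\<Delta> \<equiv> {w. (\<forall>j<M. 0 \<le> w j) \<and> (\<Sum>j<M. w j) = 1}"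
  assumes M: "0 < M" and R: "0 < R"
    and contG: "\<And>W X w x j. (\<And>i. W i \<in> \<Delta>) \<Longrightarrow> w \<in> \<Delta> \<Longrightarrow> (\<And>j. j < M \<Longrightarrow> (\<lambda>i. W i j) \<longlonglongrightarrow> w j)
      \<Longrightarrow> X \<longlonglongrightarrow> x \<Longrightarrow> j < M \<Longrightarrow> (\<lambda>i. G (W i) (X i) j) \<longlonglongrightarrow> G w x j"
    and contV: "\<And>W X w x. (\<And>i. W i \<in> \<Delta>) \<Longrightarrow> w \<in> \<Delta> \<Longrightarrow> (\<And>j. j < M \<Longrightarrow> (\<lambda>i. W i j) \<longlonglongrightarrow> w j)
      \<Longrightarrow> X \<longlonglongrightarrow> x \<Longrightarrow> (\<lambda>i. V (W i) (X i)) \<longlonglongrightarrow> V w x"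
    and bal: "\<And>w x. w \<in> \<Delta> \<Longrightarrow> (\<Sum>j<M. w j * G w x j) = 0"
    and out: "\<And>w x. w \<in> \<Delta> \<Longrightarrow> R \<le> norm x \<Longrightarrow> 0 < V w x \<bullet> x"
  shows "\<exists>w x. w \<in> \<Delta> \<and> (\<forall>j<M. G w x j \<le> 0) \<and> V w x = 0"
proof -
  let ?d = "DIM('a)"
  obtain e where e: "bij_betw e {..<?d} (Basis :: 'a set)"
    using ex_bij_betw_nat_finite[OF finite_Basis] by (metis atLeast0LessThan)
  have eB: "e i \<in> Basis" if "i < ?d" for i using e that bij_betwE by blast
  let ?Q = "{x :: nat \<Rightarrow> real. \<forall>i<M + ?d. 0 \<le> x i \<and> x i \<le> 1}"
  define S where "S a = (\<Sum>j<M. a j)" for a :: "nat \<Rightarrow> real"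
  \<comment> \<open>A retraction of the cube onto the simplex: missing mass is added evenly, excess mass is
    removed by scaling.\<close>
  define w where "w a j = (a j + max 0 (1 - S a) / real M) / max 1 (S a)" for a j
  \<comment> \<open>The remaining coordinates parametrise the cube with all coordinates in [-R, R].\<close>
  define x where "x a = (\<Sum>i<?d. (R * (2 * a (M + i) - 1)) *\<^sub>R e i)" for a
  define p where "p a j = max 0 (G (w a) (x a) j)" for a j
  define f where "f i a = (if i < M then (w a i + p a i) / (1 + (\<Sum>j<M. p a j))
      else max 0 (min 1 (a i - V (w a) (x a) \<bullet> e (i - M))))" for i a
  have wD: "w a \<in> \<Delta>" if "a \<in> ?Q" for a
  proof -
    have a: "0 \<le> a j" if "j < M" for j using that \<open>a \<in> ?Q\<close> by auto
    have "(\<Sum>j<M. w a j) = (S a + max 0 (1 - S a)) / max 1 (S a)"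
      using M by (simp add: w_def S_def sum_divide_distrib[symmetric] sum.distrib)
    also have "\<dots> = 1" by (auto simp: max_def)
    finally show ?thesis using a by (auto simp: \<Delta>_def w_def intro!: divide_nonneg_pos add_nonneg_nonneg)
  qed
  have p0: "0 \<le> p a j" for a j by (simp add: p_def)
  have wcont: "(\<lambda>k. w (X k) j) \<longlonglongrightarrow> w a j"
    if "\<And>i. i < M + ?d \<Longrightarrow> (\<lambda>k. X k i) \<longlonglongrightarrow> a i" "j < M" for X a j
    unfolding w_def S_def using that by (intro tendsto_intros) auto
  have xcont: "(\<lambda>k. x (X k)) \<longlonglongrightarrow> x a"
    if "\<And>i. i < M + ?d \<Longrightarrow> (\<lambda>k. X k i) \<longlonglongrightarrow> a i" for X a
    unfolding x_def using that by (intro tendsto_intros) auto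
  have "\<exists>a\<in>?Q. \<forall>i<M + ?d. f i a = a i"
  proof (rule brouwer_nat_cube)
    fix X a i assume X: "\<And>j. X j \<in> ?Q" and a: "a \<in> ?Q"
      and lim: "\<And>i. i < M + ?d \<Longrightarrow> (\<lambda>j. X j i) \<longlonglongrightarrow> a i" and i: "i < M + ?d"
    have Gc: "(\<lambda>k. p (X k) j) \<longlonglongrightarrow> p a j" if "j < M" for j
      unfolding p_def
      by (intro tendsto_intros contG wD X a wcont xcont lim that)
    have Vc: "(\<lambda>k. V (w (X k)) (x (X k))) \<longlonglongrightarrow> V (w a) (x a)"
      by (intro contV wD X a wcont xcont lim)
    show "(\<lambda>j. f i (X j)) \<longlonglongrightarrow> f i a"
    proof (cases "i < M")
      case True
      have "1 + (\<Sum>j<M. p a j) \<noteq> 0" using sum_nonneg[of "{..<M}" "p a"] p0 by (smt (verit))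
      then show ?thesis
        using True unfolding f_def by (auto intro!: tendsto_intros wcont lim Gc)
    next
      case False
      then show ?thesis unfolding f_def by (auto intro!: tendsto_intros Vc lim i)
    qed
  next
    fix a i assume a: "a \<in> ?Q" and i: "i < M + ?d"
    show "0 \<le> f i a \<and> f i a \<le> 1"
    proof (cases "i < M")
      case True
      have w: "0 \<le> w a i" "w a i \<le> 1"
        using wD[OF a] True member_le_sum[of i "{..<M}" "w a"] by (auto simp: \<Delta>_def)
      have "p a i \<le> (\<Sum>j<M. p a j)" using True p0 by (intro member_le_sum) auto
      then show ?thesis using True w p0[of a i]
        by (auto simp: f_def divide_le_eq_1 intro!: divide_nonneg_nonneg)
    qed (auto simp: f_def)
  qed
  then obtain a where a: "a \<in> ?Q" and fix_a: "\<And>i. i < M + ?d \<Longrightarrow> f i a = a i" by blast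
  let ?P = "\<Sum>j<M. p a j"
  have P0: "0 \<le> ?P" using p0 by (intro sum_nonneg) auto
  have wa: "w a \<in> \<Delta>" using wD[OF a] .
  have aw: "a j = (w a j + p a j) / (1 + ?P)" if "j < M" for j
    using fix_a[of j] that by (simp add: f_def)
  have "S a = ((\<Sum>j<M. w a j) + ?P) / (1 + ?P)"
    by (simp add: S_def aw sum_divide_distrib[symmetric] sum.distrib)
  also have "\<dots> = 1" using wa P0 by (simp add: \<Delta>_def)
  finally have "w a j = a j" for j by (simp add: w_def)
  then have pw: "p a j = ?P * w a j" if "j < M" for j
    using aw[OF that] P0 by (simp add: field_simps)
  have "?P = 0"
  proof (rule ccontr)
    assume "?P \<noteq> 0"
    then have P: "0 < ?P" using P0 by simp
    \<comment> \<open>If some payoff is positive, then p is a positive multiple of w, so on the support of w the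
      payoffs are positive and equal to p.\<close>
    have key: "w a j * G (w a) (x a) j = w a j * p a j" if "j < M" for j
    proof (cases "w a j = 0")
      case False
      then have "0 < p a j" using pw[OF that] P wa that by (auto simp: \<Delta>_def order.strict_iff_order)
      then show ?thesis by (auto simp: p_def max_def split: if_splits)
    qed simp
    then have "(\<Sum>j<M. w a j * p a j) = (\<Sum>j<M. w a j * G (w a) (x a) j)"
      by (intro sum.cong) (simp_all add: key)
    then have "(\<Sum>j<M. w a j * p a j) = 0" using bal[OF wa, of "x a"] by simp
    then have "(\<Sum>j<M. ?P * (w a j)\<^sup>2) = 0" by (simp add: pw power2_eq_square algebra_simps)
    then have "?P * (\<Sum>j<M. (w a j)\<^sup>2) = 0" by (simp add: sum_distrib_left)
    then have "\<forall>j<M. w a j = 0" using P by (simp add: sum_nonneg_eq_0_iff)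
    then show False using wa by (simp add: \<Delta>_def)
  qed
  then have "p a j = 0" if "j < M" for j using pw[OF that] by simp
  then have G0: "G (w a) (x a) j \<le> 0" if "j < M" for j using that by (force simp: p_def max_def split: if_splits)
  have xe: "x a \<bullet> e i = R * (2 * a (M + i) - 1)" if "i < ?d" for i
  proof -
    have "x a \<bullet> e i = (\<Sum>k<?d. if k = i then R * (2 * a (M + k) - 1) else 0)"
      unfolding x_def inner_sum_left
    proof (rule sum.cong)
      fix k assume k: "k \<in> {..<?d}"
      have "e k \<bullet> e i = (if k = i then 1 else 0)"
        using eB k that e by (auto simp: inner_Basis bij_betw_def inj_on_eq_iff)
      then show "(R * (2 * a (M + k) - 1)) *\<^sub>R e k \<bullet> e i = (if k = i then R * (2 * a (M + k) - 1) else 0)"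
        by simp
    qed simp
    then show ?thesis using that by simp
  qed
  let ?V = "V (w a) (x a)"
  \<comment> \<open>At a fixed point of the clamped step a component of V can only be nonzero on a face of the
    cube, and there it points inwards.\<close>
  have comp: "(?V \<bullet> e i) * (x a \<bullet> e i) \<le> 0 \<and> (?V \<bullet> e i \<noteq> 0 \<longrightarrow> \<bar>x a \<bullet> e i\<bar> = R)" if "i < ?d" for i
  proof -
    have clamp: "max 0 (min 1 (a (M + i) - ?V \<bullet> e i)) = a (M + i)"
      using fix_a[of "M + i"] that by (simp add: f_def)
    then have "?V \<bullet> e i = 0 \<or> (a (M + i) = 0 \<and> 0 \<le> ?V \<bullet> e i) \<or> (a (M + i) = 1 \<and> ?V \<bullet> e i \<le> 0)"
      by (auto simp: max_def min_def split: if_splits)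
    then show ?thesis using R xe[OF that] by (auto simp: mult_nonneg_nonpos mult_nonpos_nonneg)
  qed
  have "?V = 0"
  proof (rule ccontr)
    assume "?V \<noteq> 0"
    then obtain b where b: "b \<in> Basis" "?V \<bullet> b \<noteq> 0" using euclidean_all_zero_iff by blast
    then obtain i where i: "i < ?d" "b = e i" using e by (auto simp: bij_betw_def)
    have "R = \<bar>x a \<bullet> e i\<bar>" using comp[OF i(1)] b i by auto
    also have "\<dots> \<le> norm (x a)" using Basis_le_norm[OF eB[OF i(1)]] .
    finally have "0 < ?V \<bullet> x a" using out[OF wa] by simp
    moreover have "?V \<bullet> x a = (\<Sum>i<?d. (?V \<bullet> e i) * (x a \<bullet> e i))"
      by (subst euclidean_inner) (rule sum.reindex_bij_betw[OF e, symmetric])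
    moreover have "\<dots> \<le> 0" using comp by (intro sum_nonpos) auto
    ultimately show False by simp
  qed
  then show ?thesis using wa G0 by blast
qed

section \<open>Balanced weights\<close>

definition balanced :: "nat \<Rightarrow> (nat \<Rightarrow> 'a::euclidean_space) \<Rightarrow> (nat \<Rightarrow> real) \<Rightarrow> bool" where
  "balanced N u t \<longleftrightarrow> (\<forall>k\<in>{1..N}. 0 \<le> t k) \<and> (\<Sum>k=1..N. t k *\<^sub>R u k) = 0 \<and> (\<Sum>k=1..N. t k) = 1"

lemma balancedD:
  assumes "balanced N u t"
  shows "\<And>k. k \<in> {1..N} \<Longrightarrow> 0 \<le> t k" "(\<Sum>k=1..N. t k *\<^sub>R u k) = 0" "(\<Sum>k=1..N. t k) = 1"
  using assms by (auto simp: balanced_def)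

lemma balanced_normalize:
  assumes "\<And>k. k \<in> {1..N} \<Longrightarrow> 0 \<le> t k" "(\<Sum>k=1..N. t k *\<^sub>R u k) = 0" "0 < (\<Sum>k=1..N. t k)"
  shows "balanced N u (\<lambda>k. t k / (\<Sum>k=1..N. t k))"
proof -
  let ?s = "\<Sum>k=1..N. t k"
  have "(\<Sum>k=1..N. (t k / ?s) *\<^sub>R u k) = (1 / ?s) *\<^sub>R (\<Sum>k=1..N. t k *\<^sub>R u k)"
    by (simp add: scaleR_sum_right)
  then show ?thesis using assms by (auto simp: balanced_def sum_divide_distrib[symmetric])
qed

text \<open>
  The balanced weights form a polytope, but instead of its vertices one balanced vector is chosen for each
  possible support. Subtracting the largest possible multiple of the chosen vector with the same support
  leaves a nonnegative vector with smaller support, and induction applies.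
\<close>

lemma balanced_generators:
  assumes ex: "\<exists>t. balanced N u t"
  shows "\<exists>(M::nat) \<tau>. 0 < M \<and> (\<forall>j<M. balanced N u (\<tau> j)) \<and>
     (\<forall>t. balanced N u t \<longrightarrow> (\<exists>w. (\<forall>j<M. 0 \<le> w j) \<and> (\<Sum>j<M. w j) = 1 \<and>
        (\<forall>k\<in>{1..N}. t k = (\<Sum>j<M. w j * \<tau> j k))))"
proof -
  define supp where "supp t = {k \<in> {1..N}. t k \<noteq> (0::real)}" for t
  define \<S> where "\<S> = supp ` Collect (balanced N u)"
  define \<sigma> where "\<sigma> J = (SOME t. balanced N u t \<and> supp t = J)" for J
  have fin: "finite \<S>"
    by (rule finite_subset[of _ "Pow {1..N}"]) (auto simp: \<S>_def supp_def)
  have \<sigma>: "balanced N u (\<sigma> J) \<and> supp (\<sigma> J) = J" if "J \<in> \<S>" for J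
    unfolding \<sigma>_def using that by (intro someI_ex[of "\<lambda>t. balanced N u t \<and> supp t = J"]) (auto simp: \<S>_def)
  have cone: "\<exists>w. (\<forall>J\<in>\<S>. 0 \<le> w J) \<and> (\<forall>k\<in>{1..N}. t k = (\<Sum>J\<in>\<S>. w J * \<sigma> J k))"
    if "\<And>k. k \<in> {1..N} \<Longrightarrow> 0 \<le> t k" "(\<Sum>k=1..N. t k *\<^sub>R u k) = 0" for t
    using that
  proof (induction "card (supp t)" arbitrary: t rule: less_induct)
    case less
    show ?case
    proof (cases "supp t = {}")
      case True
      then show ?thesis by (intro exI[of _ "\<lambda>_. 0"]) (auto simp: supp_def)
    next
      case False
      define J where "J = supp t"
      let ?s = "\<Sum>k=1..N. t k"
      obtain k0 where k0: "k0 \<in> {1..N}" "t k0 \<noteq> 0" using False by (auto simp: supp_def)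
      have "t k0 \<le> ?s" using k0 less.prems(1) by (intro member_le_sum) auto
      then have s: "0 < ?s" using k0 less.prems(1)[OF k0(1)] by linarith
      have "supp (\<lambda>k. t k / ?s) = J" using s by (auto simp: supp_def J_def)
      then have JS: "J \<in> \<S>" using balanced_normalize[OF less.prems s] by (auto simp: \<S>_def)
      note b = \<sigma>[OF JS]
      let ?\<tau> = "\<sigma> J"
      have pos: "0 < ?\<tau> k" if "k \<in> J" for k
      proof -
        have "k \<in> supp ?\<tau>" using b that by simp
        then show ?thesis using balancedD(1)[of N u ?\<tau> k] b by (auto simp: supp_def order.strict_iff_order)
      qed
      have zero: "?\<tau> k = 0" "t k = 0" if "k \<in> {1..N}" "k \<notin> J" for k
        using b that by (auto simp: supp_def J_def)
      have Jf: "finite J" "J \<noteq> {}" "J \<subseteq> {1..N}" using False by (auto simp: J_def supp_def)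
      \<comment> \<open>The largest multiple of the chosen vector that can be subtracted.\<close>
      define \<rho> where "\<rho> = Min ((\<lambda>k. t k / ?\<tau> k) ` J)"
      have "\<rho> \<in> (\<lambda>k. t k / ?\<tau> k) ` J" unfolding \<rho>_def using Jf by (intro Min_in) auto
      then obtain i where i: "i \<in> J" "\<rho> = t i / ?\<tau> i" by auto
      have \<rho>0: "0 \<le> \<rho>" using i pos[OF i(1)] less.prems(1)[of i] Jf by (auto intro!: divide_nonneg_pos)
      have \<rho>le: "\<rho> * ?\<tau> k \<le> t k" if "k \<in> J" for k
      proof -
        have "\<rho> \<le> t k / ?\<tau> k" unfolding \<rho>_def using Jf that by (intro Min_le) auto
        then show ?thesis using pos[OF that] by (simp add: field_simps)
      qed
      define t' where "t' k = t k - \<rho> * ?\<tau> k" for k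
      have t'0: "0 \<le> t' k" if "k \<in> {1..N}" for k
        using \<rho>le[of k] zero[OF that] by (cases "k \<in> J") (auto simp: t'_def)
      have "(\<Sum>k=1..N. t' k *\<^sub>R u k) = (\<Sum>k=1..N. t k *\<^sub>R u k) - \<rho> *\<^sub>R (\<Sum>k=1..N. ?\<tau> k *\<^sub>R u k)"
        by (simp add: t'_def scaleR_left_diff_distrib sum_subtractf scaleR_sum_right)
      then have t'u: "(\<Sum>k=1..N. t' k *\<^sub>R u k) = 0"
        using less.prems(2) balancedD(2)[of N u ?\<tau>] b by simp
      have "supp t' \<subset> J"
      proof
        show "supp t' \<subseteq> J"
        proof
          fix k assume k: "k \<in> supp t'"
          show "k \<in> J"
          proof (rule ccontr)
            assume "k \<notin> J"
            then show False using k zero[of k] by (simp add: supp_def t'_def)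
          qed
        qed
        have "i \<notin> supp t'" using i pos[OF i(1)] by (simp add: supp_def t'_def)
        then show "supp t' \<noteq> J" using i(1) by auto
      qed
      then have "card (supp t') < card (supp t)" unfolding J_def by (intro psubset_card_mono) (auto simp: supp_def)
      then obtain w where w: "\<forall>J\<in>\<S>. 0 \<le> w J" "\<forall>k\<in>{1..N}. t' k = (\<Sum>J\<in>\<S>. w J * \<sigma> J k)"
        using less.hyps[of t'] t'0 t'u by blast
      define w' where "w' I = w I + (if I = J then \<rho> else 0)" for I
      have "t k = (\<Sum>I\<in>\<S>. w' I * \<sigma> I k)" if "k \<in> {1..N}" for k
      proof -
        have "(\<Sum>I\<in>\<S>. w' I * \<sigma> I k) = (\<Sum>I\<in>\<S>. w I * \<sigma> I k) + (\<Sum>I\<in>\<S>. if I = J then \<rho> * \<sigma> I k else 0)"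
          unfolding sum.distrib[symmetric] by (intro sum.cong) (auto simp: w'_def algebra_simps)
        also have "(\<Sum>I\<in>\<S>. if I = J then \<rho> * \<sigma> I k else 0) = \<rho> * ?\<tau> k"
          using fin JS by (simp add: sum.delta)
        also have "(\<Sum>I\<in>\<S>. w I * \<sigma> I k) = t' k" using w(2) that by simp
        finally show ?thesis by (simp add: t'_def)
      qed
      moreover have "\<forall>I\<in>\<S>. 0 \<le> w' I" using w(1) \<rho>0 by (auto simp: w'_def)
      ultimately show ?thesis by blast
    qed
  qed
  obtain f where f: "bij_betw f {..<card \<S>} \<S>"
    using ex_bij_betw_nat_finite[OF fin] by (auto simp: atLeast0LessThan)
  have "0 < card \<S>" using ex fin by (auto simp: \<S>_def card_gt_0_iff)
  moreover have "\<forall>j<card \<S>. balanced N u (\<sigma> (f j))" using \<sigma> f by (auto simp: bij_betw_def)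
  moreover have "\<exists>w. (\<forall>j<card \<S>. 0 \<le> w j) \<and> (\<Sum>j<card \<S>. w j) = 1 \<and>
        (\<forall>k\<in>{1..N}. t k = (\<Sum>j<card \<S>. w j * \<sigma> (f j) k))" if t: "balanced N u t" for t
  proof -
    obtain w where w: "\<forall>J\<in>\<S>. 0 \<le> w J" "\<forall>k\<in>{1..N}. t k = (\<Sum>J\<in>\<S>. w J * \<sigma> J k)"
      using cone[of t] balancedD[OF t] by auto
    have eq: "t k = (\<Sum>j<card \<S>. w (f j) * \<sigma> (f j) k)" if "k \<in> {1..N}" for k
      using w(2) that sum.reindex_bij_betw[OF f, of "\<lambda>J. w J * \<sigma> J k"] by simp
    have "1 = (\<Sum>k=1..N. \<Sum>j<card \<S>. w (f j) * \<sigma> (f j) k)"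
      using balancedD(3)[OF t] eq by simp
    also have "\<dots> = (\<Sum>j<card \<S>. w (f j) * (\<Sum>k=1..N. \<sigma> (f j) k))"
      by (subst sum.swap) (simp add: sum_distrib_left)
    also have "\<dots> = (\<Sum>j<card \<S>. w (f j))"
    proof (rule sum.cong)
      fix j assume "j \<in> {..<card \<S>}"
      then have "f j \<in> \<S>" using f by (auto simp: bij_betw_def)
      then show "w (f j) * (\<Sum>k=1..N. \<sigma> (f j) k) = w (f j)" using \<sigma> balancedD(3) by (metis mult.right_neutral)
    qed simp
    finally have "(\<Sum>j<card \<S>. w (f j)) = 1" ..
    moreover have "\<forall>j<card \<S>. 0 \<le> w (f j)" using w(1) f by (auto simp: bij_betw_def)
    ultimately show ?thesis using eq by (intro exI[of _ "\<lambda>j. w (f j)"]) auto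
  qed
  ultimately show ?thesis by (intro exI[of _ "card \<S>"] exI[of _ "\<lambda>j. \<sigma> (f j)"]) auto
qed

text \<open>
  The normals in the support of any balanced vector span the space, expressed through the orthogonal
  complement.
\<close>

definition supports_span :: "nat \<Rightarrow> (nat \<Rightarrow> 'a::euclidean_space) \<Rightarrow> bool" where
  "supports_span N u \<longleftrightarrow> (\<forall>t x. balanced N u t \<longrightarrow> (\<forall>k\<in>{1..N}. t k \<noteq> 0 \<longrightarrow> u k \<bullet> x = 0) \<longrightarrow> x = 0)"

text \<open>
  The right-hand side is positively homogeneous and continuous in \<open>x\<close>, so it suffices that it has no zero on
  the sphere: as the products sum to zero, they would all vanish.
\<close>

lemma balanced_pos_lower_bound:
  assumes sp: "supports_span N u" and t: "balanced N u t"
  obtains d where "0 < d" "\<And>x. d * norm x \<le> (\<Sum>k=1..N. max 0 (t k * (u k \<bullet> x)))"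
proof -
  let ?h = "\<lambda>x. \<Sum>k=1..N. max 0 (t k * (u k \<bullet> x))"
  have "\<exists>x\<in>sphere 0 1. \<forall>y\<in>sphere 0 1. ?h x \<le> ?h y"
    by (intro continuous_attains_inf continuous_intros) auto
  then obtain x0 where x0: "norm x0 = 1" "\<And>y. norm y = 1 \<Longrightarrow> ?h x0 \<le> ?h y" by auto
  have h0: "0 \<le> ?h x" for x by (intro sum_nonneg) auto
  have "?h x0 \<noteq> 0"
  proof
    assume "?h x0 = 0"
    then have le: "t k * (u k \<bullet> x0) \<le> 0" if "k \<in> {1..N}" for k
    proof -
      have "max 0 (t k * (u k \<bullet> x0)) = 0"
        by (rule sum_nonneg_0[OF _ _ \<open>?h x0 = 0\<close> that]) auto
      then show ?thesis by (metis max.cobounded2)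
    qed
    have "(\<Sum>k=1..N. - (t k * (u k \<bullet> x0))) = - ((\<Sum>k=1..N. t k *\<^sub>R u k) \<bullet> x0)"
      by (simp add: inner_sum_left sum_negf)
    also have "\<dots> = 0" using balancedD(2)[OF t] by simp
    finally have "\<forall>k\<in>{1..N}. - (t k * (u k \<bullet> x0)) = 0"
      using le by (subst (asm) sum_nonneg_eq_0_iff) auto
    then have "x0 = 0" using sp t unfolding supports_span_def by auto
    then show False using x0(1) by simp
  qed
  then have pos: "0 < ?h x0" using h0[of x0] by linarith
  show ?thesis
  proof (rule that[OF pos])
    fix x
    show "?h x0 * norm x \<le> ?h x"
    proof (cases "x = 0")
      case False
      then have n: "0 < norm x" by simp
      have "?h x0 \<le> ?h (x /\<^sub>R norm x)" using n by (intro x0(2)) simp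
      also have "?h (x /\<^sub>R norm x) = ?h x / norm x"
        unfolding sum_divide_distrib
      proof (rule sum.cong)
        fix k
        have "max 0 (a / norm x) = max 0 a / norm x" for a using n by (simp add: max_def divide_le_0_iff zero_le_divide_iff)
        from this[of "t k * (u k \<bullet> x)"]
        show "max 0 (t k * (u k \<bullet> (x /\<^sub>R norm x))) = max 0 (t k * (u k \<bullet> x)) / norm x"
          by (simp add: divide_inverse mult_ac)
      qed simp
      finally show ?thesis using n by (simp add: field_simps)
    qed (simp add: sum_nonneg)
  qed
qed

text \<open>
  The polytopes \<open>{x. t k * (u k \<bullet> x) \<le> g}\<close> are bounded uniformly in \<open>t\<close>. Some generator has weight at least
  \<open>1/M\<close> in \<open>t\<close>, so \<open>M t\<close> dominates this generator, and finitely many generators give a common bound.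
\<close>

lemma balanced_uniform_bound:
  assumes sp: "supports_span N u"
  shows "\<exists>C>0. \<forall>t x g. balanced N u t \<longrightarrow> 0 \<le> g \<longrightarrow> (\<forall>k\<in>{1..N}. t k * (u k \<bullet> x) \<le> g) \<longrightarrow> norm x \<le> C * g"
proof (cases "\<exists>t. balanced N u t")
  case False
  then show ?thesis by (intro exI[of _ 1]) auto
next
  case True
  obtain M :: nat and \<tau> where M: "0 < M" and \<tau>: "\<And>j. j < M \<Longrightarrow> balanced N u (\<tau> j)"
    and gen: "\<And>t. balanced N u t \<Longrightarrow> \<exists>w. (\<forall>j<M. 0 \<le> w j) \<and> (\<Sum>j<M. w j) = 1 \<and>
        (\<forall>k\<in>{1..N}. t k = (\<Sum>j<M. w j * \<tau> j k))"
    using balanced_generators[OF True] by auto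
  have "\<exists>d. j < M \<longrightarrow> 0 < d \<and> (\<forall>x. d * norm x \<le> (\<Sum>k=1..N. max 0 (\<tau> j k * (u k \<bullet> x))))" for j
    using balanced_pos_lower_bound[OF sp \<tau>] by metis
  then obtain d where d: "\<And>j. j < M \<Longrightarrow> 0 < d j"
     "\<And>j x. j < M \<Longrightarrow> d j * norm x \<le> (\<Sum>k=1..N. max 0 (\<tau> j k * (u k \<bullet> x)))"
    by metis
  define C where "C = (\<Sum>j<M. real N * real M / d j) + 1"
  have C0: "0 \<le> (\<Sum>j<M. real N * real M / d j)" using d(1) by (intro sum_nonneg) (auto intro!: divide_nonneg_pos)
  have "norm x \<le> C * g" if t: "balanced N u t" and g: "0 \<le> g" and le: "\<forall>k\<in>{1..N}. t k * (u k \<bullet> x) \<le> g" for t x g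
  proof -
    obtain w where w: "\<forall>j<M. 0 \<le> w j" "(\<Sum>j<M. w j) = 1" "\<forall>k\<in>{1..N}. t k = (\<Sum>j<M. w j * \<tau> j k)"
      using gen[OF t] by blast
    obtain j where j: "j < M" "1 / real M \<le> w j"
    proof (rule ccontr)
      assume "\<not> thesis"
      then have "w j < 1 / real M" if "j < M" for j using \<open>\<not> thesis\<close> \<open>\<And>j. j < M \<Longrightarrow> 1 / real M \<le> w j \<Longrightarrow> thesis\<close> that by force
      then have "(\<Sum>j<M. w j) < (\<Sum>j<M. 1 / real M)" using M by (intro sum_strict_mono) auto
      then show False using w(2) M by simp
    qed
    have "\<tau> j k * (u k \<bullet> x) \<le> real M * g" if k: "k \<in> {1..N}" for k
    proof (cases "0 < u k \<bullet> x")
      case True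
      have "(1 / real M) * \<tau> j k \<le> w j * \<tau> j k"
        using j balancedD(1)[OF \<tau>[OF j(1)] k] by (intro mult_right_mono) auto
      also have "\<dots> \<le> (\<Sum>j<M. w j * \<tau> j k)"
        using w(1) j balancedD(1)[OF \<tau> k] by (intro member_le_sum) auto
      also have "\<dots> = t k" using w(3) k by simp
      finally have "\<tau> j k \<le> real M * t k" using M by (simp add: field_simps)
      then have "\<tau> j k * (u k \<bullet> x) \<le> real M * t k * (u k \<bullet> x)" using True by (intro mult_right_mono) auto
      also have "\<dots> = real M * (t k * (u k \<bullet> x))" by simp
      also have "\<dots> \<le> real M * g" using le k by (intro mult_left_mono) auto
      finally show ?thesis .
    next
      case False
      then have "\<tau> j k * (u k \<bullet> x) \<le> 0"
        using balancedD(1)[OF \<tau>[OF j(1)] k] by (intro mult_nonneg_nonpos) auto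
      then show ?thesis using g by (meson mult_nonneg_nonneg of_nat_0_le_iff order_trans)
    qed
    then have "(\<Sum>k=1..N. max 0 (\<tau> j k * (u k \<bullet> x))) \<le> (\<Sum>k=1..N. real M * g)"
      using g by (intro sum_mono) auto
    then have "d j * norm x \<le> real N * real M * g" using d(2)[OF j(1), of x] by simp
    then have "norm x \<le> (real N * real M / d j) * g" using d(1)[OF j(1)] by (simp add: field_simps)
    also have "\<dots> \<le> (\<Sum>j<M. real N * real M / d j) * g"
      using j d(1) g by (intro mult_right_mono member_le_sum) (auto intro!: divide_nonneg_pos)
    also have "\<dots> \<le> C * g" using g by (intro mult_right_mono) (auto simp: C_def)
    finally show ?thesis .
  qed
  then show ?thesis using C0 by (intro exI[of _ C]) (auto simp: C_def)
qed

lemma tendsto_Max_finite: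
  fixes f :: "'k \<Rightarrow> 'i \<Rightarrow> real"
  assumes "finite A" "A \<noteq> {}" "\<And>k. k \<in> A \<Longrightarrow> (f k \<longlongrightarrow> l k) F"
  shows "((\<lambda>i. Max ((\<lambda>k. f k i) ` A)) \<longlongrightarrow> Max (l ` A)) F"
  using assms
proof (induction A rule: finite_ne_induct)
  case (insert a A)
  then show ?case by (simp add: tendsto_max)
qed simp

text \<open>
  The convex hull of the normals contains a ball about the origin. So it contains a small negative multiple
  of the sum of all normals, and adding that multiple back makes all coefficients positive.
\<close>

lemma exists_strictly_balanced:
  fixes u :: "nat \<Rightarrow> 'a::euclidean_space"
  assumes half: "\<And>v. v \<noteq> 0 \<Longrightarrow> \<exists>k\<in>{1..N}. u k \<bullet> v < 0" and inj: "inj_on u {1..N}"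
  obtains t where "balanced N u t" "\<And>k. k \<in> {1..N} \<Longrightarrow> 0 < t k"
proof -
  let ?K = "convex hull (u ` {1..N})"
  obtain b :: 'a where "b \<in> Basis" using nonempty_Basis by blast
  then have "b \<noteq> 0" by (auto simp: nonzero_Basis)
  then have N: "1 \<in> {1..N}" using half[of b] by fastforce
  let ?h = "\<lambda>v. \<Sum>k=1..N. max 0 (- (u k \<bullet> v))"
  have "\<exists>x\<in>sphere 0 1. \<forall>y\<in>sphere 0 1. ?h x \<le> ?h y"
    by (intro continuous_attains_inf continuous_intros) auto
  then obtain v0 where v0: "norm v0 = 1" "\<And>y. norm y = 1 \<Longrightarrow> ?h v0 \<le> ?h y" by auto
  have "v0 \<noteq> 0" using v0(1) by auto
  then obtain k where k: "k \<in> {1..N}" "u k \<bullet> v0 < 0" using half by blast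
  then have "0 < max 0 (- (u k \<bullet> v0))" by simp
  also have "\<dots> \<le> ?h v0" using k by (intro member_le_sum) auto
  finally have pos: "0 < ?h v0" .
  define \<delta> where "\<delta> = ?h v0 / real N"
  have \<delta>: "0 < \<delta>" using pos N by (simp add: \<delta>_def)
  have inK: "z \<in> ?K" if z: "norm z < \<delta>" for z
  proof (rule ccontr)
    assume "z \<notin> ?K"
    moreover have "convex ?K" "closed ?K" by (auto simp: finite_imp_compact_convex_hull compact_imp_closed)
    ultimately obtain a c where ac: "a \<bullet> z < c" "\<forall>x\<in>?K. c < a \<bullet> x"
      using separating_hyperplane_closed_point by blast
    have uk: "c < a \<bullet> u k" if "k \<in> {1..N}" for k using bspec[OF ac(2)] hull_inc[of "u k" "u ` {1..N}"] that by blast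
    have "a \<noteq> 0" using ac(1) uk[OF N] by auto
    then have na: "0 < norm a" by simp
    have "- (norm a * \<delta>) < c"
    proof -
      have "- (a \<bullet> z) \<le> norm a * norm z" using Cauchy_Schwarz_ineq2[of a z] by linarith
      also have "\<dots> \<le> norm a * \<delta>" using z by (intro mult_left_mono) auto
      finally show ?thesis using ac(1) by linarith
    qed
    then have lt: "max 0 (- (u k \<bullet> (a /\<^sub>R norm a))) < \<delta>" if "k \<in> {1..N}" for k
      using uk[OF that] na \<delta> by (simp add: inner_commute field_simps)
    have "?h v0 \<le> ?h (a /\<^sub>R norm a)" using na by (intro v0(2)) simp
    also have "\<dots> < (\<Sum>k=1..N. \<delta>)" using lt N by (intro sum_strict_mono) auto
    also have "\<dots> = ?h v0" using N by (simp add: \<delta>_def)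
    finally show False by simp
  qed
  define z where "z = (\<Sum>k=1..N. u k)"
  define \<eta> where "\<eta> = \<delta> / (2 * (norm z + 1))"
  have \<eta>: "0 < \<eta>" using \<delta> by (simp add: \<eta>_def add_nonneg_pos)
  have "norm (- (\<eta> *\<^sub>R z)) = \<delta> * (norm z / (2 * (norm z + 1)))" using \<delta> by (simp add: \<eta>_def)
  also have "\<dots> < \<delta> * 1" using \<delta> by (intro mult_strict_left_mono) (auto simp: divide_less_eq add_nonneg_pos)
  finally have "- (\<eta> *\<^sub>R z) \<in> ?K" by (intro inK) simp
  then obtain q where q: "\<forall>x\<in>u ` {1..N}. 0 \<le> q x" "(\<Sum>x\<in>u ` {1..N}. q x *\<^sub>R x) = - (\<eta> *\<^sub>R z)"
    by (auto simp: convex_hull_finite)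
  define t where "t k = q (u k) + \<eta>" for k
  have tpos: "0 < t k" if "k \<in> {1..N}" for k using q(1) \<eta> that by (auto simp: t_def intro: add_nonneg_pos)
  have "(\<Sum>k=1..N. t k *\<^sub>R u k) = (\<Sum>k=1..N. q (u k) *\<^sub>R u k) + \<eta> *\<^sub>R z"
    by (simp add: t_def z_def scaleR_left_distrib sum.distrib scaleR_sum_right)
  also have "(\<Sum>k=1..N. q (u k) *\<^sub>R u k) = - (\<eta> *\<^sub>R z)"
    using q(2) sum.reindex[OF inj, of "\<lambda>x. q x *\<^sub>R x"] by (simp add: comp_def)
  finally have bal: "(\<Sum>k=1..N. t k *\<^sub>R u k) = 0" by simp
  have s: "0 < (\<Sum>k=1..N. t k)" using tpos N by (intro sum_pos) auto
  show ?thesis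
  proof (rule that)
    show "balanced N u (\<lambda>k. t k / (\<Sum>k=1..N. t k))"
      using tpos by (intro balanced_normalize bal s) (auto intro: less_imp_le)
    show "0 < t k / (\<Sum>k=1..N. t k)" if "k \<in> {1..N}" for k
      using tpos[OF that] s by simp
  qed
qed

section \<open>Equilibrium of weights and base point\<close>

definition feasible :: "nat \<Rightarrow> (nat \<Rightarrow> 'a::euclidean_space) \<Rightarrow> (nat \<Rightarrow> real) \<Rightarrow> (nat \<Rightarrow> real) \<Rightarrow> 'a \<Rightarrow> bool" where
  "feasible N u \<gamma> t x \<longleftrightarrow> balanced N u t \<and> (\<forall>k\<in>{1..N}. t k * (u k \<bullet> x) \<le> \<gamma> k)"

text \<open>
  The polytopes enter only through their masses \<open>c\<close>: these are continuous, nonnegative, not all zero, and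
  zero for a missing facet and for a facet that contains the base point. The variational inequality and
  the vector field are those of the introduction.
\<close>

lemma balanced_equilibrium:
  fixes u :: "nat \<Rightarrow> 'a::euclidean_space" and c :: "(nat \<Rightarrow> real) \<Rightarrow> 'a \<Rightarrow> nat \<Rightarrow> real"
    and \<gamma> :: "nat \<Rightarrow> real" and N :: nat
  assumes unit': "\<forall>k\<in>{1..N}. norm (u k) = 1"
    and \<gamma>': "\<forall>k\<in>{1..N}. 0 < \<gamma> k"
    and sp: "supports_span N u"
    and strict': "balanced N u t0" "\<forall>k\<in>{1..N}. 0 < t0 k"
    and cont: "\<And>T X t x k. (\<And>i. feasible N u \<gamma> (T i) (X i)) \<Longrightarrow> feasible N u \<gamma> t x \<Longrightarrow>
        (\<And>k. k \<in> {1..N} \<Longrightarrow> (\<lambda>i. T i k) \<longlonglongrightarrow> t k) \<Longrightarrow> X \<longlonglongrightarrow> x \<Longrightarrow> k \<in> {1..N} \<Longrightarrow>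
        (\<lambda>i. c (T i) (X i) k) \<longlonglongrightarrow> c t x k"
    and c0: "\<And>t x k. feasible N u \<gamma> t x \<Longrightarrow> k \<in> {1..N} \<Longrightarrow> 0 \<le> c t x k"
    and c_off: "\<And>t x k. feasible N u \<gamma> t x \<Longrightarrow> k \<in> {1..N} \<Longrightarrow> t k = 0 \<or> t k * (u k \<bullet> x) = \<gamma> k \<Longrightarrow> c t x k = 0"
    and cpos: "\<And>t x. feasible N u \<gamma> t x \<Longrightarrow> \<exists>k\<in>{1..N}. 0 < c t x k"
  shows "\<exists>t x \<mu>. feasible N u \<gamma> t x \<and> 0 < \<mu> \<and> (\<forall>k\<in>{1..N}. \<mu> * c t x k = \<gamma> k)"
proof -
  let ?I = "{1..N}"
  have unit: "norm (u k) = 1" and \<gamma>: "0 < \<gamma> k" if "k \<in> ?I" for k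
    using that unit' \<gamma>' by auto
  have strict: "balanced N u t0" "\<And>k. k \<in> ?I \<Longrightarrow> 0 < t0 k" using strict' by auto
  have N: "?I \<noteq> {}" using balancedD(3)[OF strict(1)] by (cases "?I = {}") auto
  obtain M :: nat and \<tau> where M: "0 < M" and \<tau>: "\<And>j. j < M \<Longrightarrow> balanced N u (\<tau> j)"
    and gen: "\<And>t. balanced N u t \<Longrightarrow> \<exists>w. (\<forall>j<M. 0 \<le> w j) \<and> (\<Sum>j<M. w j) = 1 \<and>
        (\<forall>k\<in>{1..N}. t k = (\<Sum>j<M. w j * \<tau> j k))"
    using balanced_generators[of N u] strict(1) by blast
  obtain C where C: "0 < C"
    "\<And>t x g. balanced N u t \<Longrightarrow> 0 \<le> g \<Longrightarrow> (\<forall>k\<in>{1..N}. t k * (u k \<bullet> x) \<le> g) \<Longrightarrow> norm x \<le> C * g"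
    using balanced_uniform_bound[OF sp] by blast
  define \<Delta> where "\<Delta> = {w. (\<forall>j<M. 0 \<le> w j) \<and> (\<Sum>j<M. w j) = (1::real)}"
  define tw where "tw w k = (\<Sum>j<M. w j * \<tau> j k)" for w k
  have tw: "balanced N u (tw w)" if "w \<in> \<Delta>" for w
    unfolding balanced_def
  proof (intro conjI ballI)
    have w: "\<And>j. j < M \<Longrightarrow> 0 \<le> w j" "(\<Sum>j<M. w j) = 1" using that by (auto simp: \<Delta>_def)
    show "0 \<le> tw w k" if "k \<in> ?I" for k
      using that w(1) balancedD(1)[OF \<tau>] by (auto simp: tw_def intro!: sum_nonneg)
    have "(\<Sum>k=1..N. tw w k *\<^sub>R u k) = (\<Sum>j<M. w j *\<^sub>R (\<Sum>k=1..N. \<tau> j k *\<^sub>R u k))"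
      unfolding tw_def scaleR_sum_left scaleR_sum_right by (subst sum.swap) simp
    also have "\<dots> = 0" using balancedD(2)[OF \<tau>] by simp
    finally show "(\<Sum>k=1..N. tw w k *\<^sub>R u k) = 0" .
    have "(\<Sum>k=1..N. tw w k) = (\<Sum>j<M. w j * (\<Sum>k=1..N. \<tau> j k))"
      unfolding tw_def sum_distrib_left by (subst sum.swap) simp
    also have "\<dots> = 1" using balancedD(3)[OF \<tau>] w by simp
    finally show "(\<Sum>k=1..N. tw w k) = 1" .
  qed
  \<comment> \<open>The gauge function of the polytope with offsets \<open>\<gamma>\<close>, truncated at 1; division by it is the
    radial retraction onto the polytope.\<close>
  define g where "g t x = max 1 (Max ((\<lambda>k. t k * (u k \<bullet> x) / \<gamma> k) ` ?I))" for t x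
  define xh where "xh t x = x /\<^sub>R g t x" for t x
  have g1: "1 \<le> g t x" for t x by (simp add: g_def)
  have gge: "t k * (u k \<bullet> x) \<le> \<gamma> k * g t x" if "k \<in> ?I" for t x k
  proof -
    have "t k * (u k \<bullet> x) / \<gamma> k \<le> Max ((\<lambda>k. t k * (u k \<bullet> x) / \<gamma> k) ` ?I)" using that by (intro Max_ge) auto
    also have "\<dots> \<le> g t x" by (simp add: g_def)
    finally show ?thesis using \<gamma>[OF that] by (simp add: field_simps)
  qed
  have fsb: "feasible N u \<gamma> t (xh t x)" if "balanced N u t" for t x
    unfolding feasible_def
  proof (intro conjI ballI that)
    fix k assume k: "k \<in> ?I"
    have "t k * (u k \<bullet> xh t x) = t k * (u k \<bullet> x) / g t x" by (simp add: xh_def field_simps)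
    also have "\<dots> \<le> \<gamma> k" using gge[OF k, of t x] g1[of t x] by (simp add: divide_le_eq)
    finally show "t k * (u k \<bullet> xh t x) \<le> \<gamma> k" .
  qed
  define d where "d t x k = c t (xh t x) k" for t x k
  define lam where "lam t x = (\<Sum>k=1..N. t k * \<gamma> k) / (\<Sum>k=1..N. t k * d t x k)" for t x
  define \<psi> where "\<psi> t x k = \<gamma> k - lam t x * d t x k" for t x k
  have d0: "0 \<le> d t x k" if "balanced N u t" "k \<in> ?I" for t x k
    unfolding d_def by (rule c0[OF fsb[OF that(1)] that(2)])
  have tdpos: "0 < (\<Sum>k=1..N. t k * d t x k)" if t: "balanced N u t" for t x
  proof -
    obtain k where k: "k \<in> ?I" "0 < d t x k" using cpos[OF fsb[OF t]] unfolding d_def by blast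
    have "t k \<noteq> 0" using c_off[OF fsb[OF t] k(1)] k(2) unfolding d_def by (metis less_irrefl)
    then have "0 < t k * d t x k" using balancedD(1)[OF t k(1)] k(2) by simp
    also have "\<dots> \<le> (\<Sum>k=1..N. t k * d t x k)"
      using k d0[OF t] balancedD(1)[OF t] by (intro member_le_sum) auto
    finally show ?thesis .
  qed
  have t\<gamma>pos: "0 < (\<Sum>k=1..N. t k * \<gamma> k)" if t: "balanced N u t" for t
  proof -
    have "\<exists>k\<in>?I. t k \<noteq> 0" using balancedD(3)[OF t] by (metis sum.neutral zero_neq_one)
    then obtain k where k: "k \<in> ?I" "t k \<noteq> 0" by blast
    then have "0 < t k * \<gamma> k" using balancedD(1)[OF t k(1)] \<gamma> by simp
    also have "\<dots> \<le> (\<Sum>k=1..N. t k * \<gamma> k)"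
      using k \<gamma> balancedD(1)[OF t] by (intro member_le_sum) (auto intro!: mult_nonneg_nonneg intro: less_imp_le)
    finally show ?thesis .
  qed
  have lampos: "0 < lam t x" if "balanced N u t" for t x
    using tdpos[OF that] t\<gamma>pos[OF that] by (simp add: lam_def)
  have \<psi>bal: "(\<Sum>k=1..N. \<psi> t x k * t k) = 0" if "balanced N u t" for t x
  proof -
    have "(\<Sum>k=1..N. \<psi> t x k * t k) = (\<Sum>k=1..N. t k * \<gamma> k) - lam t x * (\<Sum>k=1..N. t k * d t x k)"
      by (simp add: \<psi>_def sum_distrib_left sum_subtractf algebra_simps)
    then show ?thesis using tdpos[OF that, of x] by (simp add: lam_def)
  qed
  \<comment> \<open>The violation of the k-th constraint. Adding it with the weight \<open>max 0 \<psi>\<close> keeps the sign of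
    \<open>\<psi>\<close> and only ever strengthens it.\<close>
  define a where "a t x k = max 0 (t k * (u k \<bullet> x) - \<gamma> k)" for t x k
  define \<alpha> where "\<alpha> t x k = \<psi> t x k + max 0 (\<psi> t x k) * a t x k" for t x k
  define V where "V w x = (\<Sum>k=1..N. (tw w k * \<alpha> (tw w) x k) *\<^sub>R u k)" for w x
  define G where "G w x j = (\<Sum>k=1..N. \<psi> (tw w) x k * \<tau> j k)" for w x j
  have twlim: "(\<lambda>i. tw (W i) k) \<longlonglongrightarrow> tw w k" if "\<And>j. j < M \<Longrightarrow> (\<lambda>i. W i j) \<longlonglongrightarrow> w j" for W w k
    unfolding tw_def using that by (intro tendsto_intros) auto
  have \<psi>lim: "(\<lambda>i. \<psi> (tw (W i)) (X i) k) \<longlonglongrightarrow> \<psi> (tw w) x k"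
    if W: "\<And>i. W i \<in> \<Delta>" "w \<in> \<Delta>" "\<And>j. j < M \<Longrightarrow> (\<lambda>i. W i j) \<longlonglongrightarrow> w j" "X \<longlonglongrightarrow> x" and k: "k \<in> ?I"
    for W w X x k
  proof -
    have glim: "(\<lambda>i. g (tw (W i)) (X i)) \<longlonglongrightarrow> g (tw w) x"
      unfolding g_def using N \<gamma>
      by (intro tendsto_intros tendsto_Max_finite twlim W) (auto simp: less_imp_neq[symmetric])
    have "g (tw w) x \<noteq> 0" using g1[of "tw w" x] by simp
    then have xlim: "(\<lambda>i. xh (tw (W i)) (X i)) \<longlonglongrightarrow> xh (tw w) x"
      unfolding xh_def using glim W(4) by (intro tendsto_intros) auto
    have dlim: "(\<lambda>i. d (tw (W i)) (X i) k) \<longlonglongrightarrow> d (tw w) x k" if "k \<in> ?I" for k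
      unfolding d_def by (intro cont fsb tw W twlim xlim that)
    have "(\<lambda>i. lam (tw (W i)) (X i)) \<longlonglongrightarrow> lam (tw w) x"
      unfolding lam_def using tdpos[OF tw[OF W(2)], of x]
      by (intro tendsto_intros dlim twlim W) auto
    then show ?thesis unfolding \<psi>_def by (intro tendsto_intros dlim k)
  qed
  define \<gamma>m where "\<gamma>m = Min (\<gamma> ` ?I)"
  define \<gamma>s where "\<gamma>s = (\<Sum>k=1..N. \<gamma> k)"
  have \<gamma>m: "0 < \<gamma>m" "\<And>k. k \<in> ?I \<Longrightarrow> \<gamma>m \<le> \<gamma> k" using N \<gamma> by (auto simp: \<gamma>m_def)
  have \<gamma>s: "\<And>k. k \<in> ?I \<Longrightarrow> \<gamma> k \<le> \<gamma>s" unfolding \<gamma>s_def using \<gamma> by (intro member_le_sum) (auto intro: less_imp_le)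
  have \<gamma>spos: "0 < \<gamma>s" using \<gamma> N unfolding \<gamma>s_def by (intro sum_pos) auto
  have t1: "t k \<le> 1" if "balanced N u t" "k \<in> ?I" for t k
    using member_le_sum[of k ?I t] balancedD(1,3)[OF that(1)] that(2) by simp
  have t\<psi>: "\<bar>t k * \<psi> t x k\<bar> \<le> \<gamma>s" if t: "balanced N u t" and k: "k \<in> ?I" for t x k
  proof -
    have "t k * (lam t x * d t x k) \<le> (\<Sum>k=1..N. t k * (lam t x * d t x k))"
      using k d0[OF t] balancedD(1)[OF t] lampos[OF t] by (intro member_le_sum) (auto intro!: mult_nonneg_nonneg intro: less_imp_le)
    also have "\<dots> = lam t x * (\<Sum>k=1..N. t k * d t x k)" by (simp add: sum_distrib_left mult_ac)
    also have "\<dots> = (\<Sum>k=1..N. t k * \<gamma> k)" using tdpos[OF t, of x] by (simp add: lam_def)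
    also have "\<dots> \<le> \<gamma>s" unfolding \<gamma>s_def
      using t1[OF t] \<gamma> by (intro sum_mono) (auto simp: mult_le_cancel_right1 intro!: mult_left_le_one_le balancedD(1)[OF t] intro: less_imp_le)
    finally have 1: "t k * (lam t x * d t x k) \<le> \<gamma>s" .
    have 2: "0 \<le> t k * (lam t x * d t x k)" using k d0[OF t k] balancedD(1)[OF t k] lampos[OF t, of x] by simp
    have "t k * \<gamma> k \<le> 1 * \<gamma> k" using t1[OF t k] \<gamma>[OF k] by (intro mult_right_mono) auto
    then have 3: "t k * \<gamma> k \<le> \<gamma>s" using \<gamma>s[OF k] by simp
    have 4: "0 \<le> t k * \<gamma> k" using balancedD(1)[OF t k] \<gamma>[OF k] by simp
    show ?thesis using 1 2 3 4 by (simp add: \<psi>_def right_diff_distrib abs_le_iff)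
  qed
  \<comment> \<open>For x of norm at least R the gauge g is so large that the quadratic term \<open>\<gamma>m ^ 3 * (g * (g - 1))\<close>, which
    the most violated constraint contributes to the field, exceeds the linear bound
    \<open>N * \<gamma>s * norm x \<le> N * \<gamma>s * (C * \<gamma>s) * g\<close> for the other terms.\<close>
  define R where "R = C * \<gamma>s * (2 + real N * \<gamma>s * (C * \<gamma>s) / \<gamma>m ^ 3)"
  have R: "0 < R"
    unfolding R_def using C(1) \<gamma>spos \<gamma>m(1) by (intro mult_pos_pos add_pos_nonneg) auto
  have out: "0 < V w x \<bullet> x" if w: "w \<in> \<Delta>" and x: "R \<le> norm x" for w x
  proof -
    let ?t = "tw w"
    note t = tw[OF w]
    let ?g = "g ?t x"
    have "norm x \<le> C * (\<gamma>s * ?g)"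
    proof (rule C(2)[OF t])
      show "0 \<le> \<gamma>s * ?g" using \<gamma>spos g1[of ?t x] by simp
      show "\<forall>k\<in>{1..N}. ?t k * (u k \<bullet> x) \<le> \<gamma>s * ?g"
      proof
        fix k assume k: "k \<in> ?I"
        show "?t k * (u k \<bullet> x) \<le> \<gamma>s * ?g"
          by (rule order_trans[OF gge[OF k]]) (use \<gamma>s[OF k] g1[of ?t x] in \<open>auto intro: mult_right_mono\<close>)
      qed
    qed
    then have nx: "norm x \<le> (C * \<gamma>s) * ?g" by simp
    with x have "C * \<gamma>s * (2 + real N * \<gamma>s * (C * \<gamma>s) / \<gamma>m ^ 3) \<le> C * \<gamma>s * ?g" by (simp add: R_def)
    then have gbig: "2 + real N * \<gamma>s * (C * \<gamma>s) / \<gamma>m ^ 3 \<le> ?g"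
      using C(1) \<gamma>spos by (subst (asm) mult_le_cancel_left_pos) auto
    have "0 \<le> real N * \<gamma>s * (C * \<gamma>s) / \<gamma>m ^ 3" using C(1) \<gamma>spos \<gamma>m(1) by simp
    then have g2: "2 \<le> ?g" using gbig by linarith
    then have "?g = Max ((\<lambda>k. ?t k * (u k \<bullet> x) / \<gamma> k) ` ?I)" by (auto simp: g_def max_def split: if_splits)
    moreover have "Max ((\<lambda>k. ?t k * (u k \<bullet> x) / \<gamma> k) ` ?I) \<in> (\<lambda>k. ?t k * (u k \<bullet> x) / \<gamma> k) ` ?I"
      using N by (intro Max_in) auto
    ultimately obtain i where i: "i \<in> ?I" "?g = ?t i * (u i \<bullet> x) / \<gamma> i" by auto
    then have ti: "?t i * (u i \<bullet> x) = \<gamma> i * ?g" using \<gamma>[OF i(1)] by simp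
    moreover have "?t i * (u i \<bullet> xh ?t x) = ?t i * (u i \<bullet> x) / ?g" by (simp add: xh_def field_simps)
    ultimately have "?t i * (u i \<bullet> xh ?t x) = \<gamma> i" using g2 by simp
    \<comment> \<open>The retracted base point lies on the facet of the most violated constraint, which therefore
      has no mass.\<close>
    then have "d ?t x i = 0" unfolding d_def by (intro c_off[OF fsb[OF t] i(1)]) simp
    then have \<psi>i: "\<psi> ?t x i = \<gamma> i" by (simp add: \<psi>_def)
    define q where "q k = ?t k * (u k \<bullet> x) * (max 0 (\<psi> ?t x k) * a ?t x k)" for k
    have q0: "0 \<le> q k" if "k \<in> ?I" for k
    proof (cases "?t k * (u k \<bullet> x) \<le> \<gamma> k")
      case True
      then show ?thesis by (simp add: q_def a_def)
    next
      case False
      then have "0 \<le> ?t k * (u k \<bullet> x)" using \<gamma>[OF that] by linarith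
      then show ?thesis by (simp add: q_def a_def)
    qed
    have "q i = (\<gamma> i * ?g) * (\<gamma> i * (\<gamma> i * ?g - \<gamma> i))"
      using \<gamma>[OF i(1)] g2 by (simp add: q_def a_def \<psi>i ti max_def)
    also have "\<dots> = \<gamma> i ^ 3 * (?g * (?g - 1))" by (simp add: power3_eq_cube algebra_simps)
    finally have "q i = \<gamma> i ^ 3 * (?g * (?g - 1))" .
    moreover have "\<gamma>m ^ 3 * (?g * (?g - 1)) \<le> \<gamma> i ^ 3 * (?g * (?g - 1))"
      using \<gamma>m i(1) g2 by (intro mult_right_mono power_mono) auto
    moreover have "q i \<le> (\<Sum>k=1..N. q k)" using i q0 by (intro member_le_sum) auto
    ultimately have q: "\<gamma>m ^ 3 * (?g * (?g - 1)) \<le> (\<Sum>k=1..N. q k)" by linarith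
    have b: "\<bar>?t k * \<psi> ?t x k * (u k \<bullet> x)\<bar> \<le> \<gamma>s * norm x" if k: "k \<in> ?I" for k
    proof -
      have "\<bar>u k \<bullet> x\<bar> \<le> norm x" using Cauchy_Schwarz_ineq2[of "u k" x] unit[OF k] by simp
      then show ?thesis unfolding abs_mult[of "?t k * \<psi> ?t x k"] using t\<psi>[OF t k] \<gamma>spos by (intro mult_mono) auto
    qed
    have "V w x \<bullet> x = (\<Sum>k=1..N. ?t k * \<psi> ?t x k * (u k \<bullet> x)) + (\<Sum>k=1..N. q k)"
      unfolding V_def inner_sum_left sum.distrib[symmetric]
      by (intro sum.cong) (auto simp: \<alpha>_def q_def algebra_simps)
    moreover have "- (\<Sum>k=1..N. ?t k * \<psi> ?t x k * (u k \<bullet> x)) \<le> (\<Sum>k=1..N. \<gamma>s * norm x)"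
      unfolding sum_negf[symmetric]
    proof (intro sum_mono)
      fix k assume "k \<in> ?I"
      from b[OF this] show "- (?t k * \<psi> ?t x k * (u k \<bullet> x)) \<le> \<gamma>s * norm x" by linarith
    qed
    moreover have "(\<Sum>k=1..N. \<gamma>s * norm x) \<le> real N * \<gamma>s * (C * \<gamma>s) * ?g"
    proof -
      have "real N * \<gamma>s * norm x \<le> real N * \<gamma>s * ((C * \<gamma>s) * ?g)" using nx \<gamma>spos by (intro mult_left_mono) auto
      then show ?thesis by (simp add: mult_ac)
    qed
    moreover have "real N * \<gamma>s * (C * \<gamma>s) * ?g < \<gamma>m ^ 3 * (?g * (?g - 1))"
    proof -
      have p: "0 < \<gamma>m ^ 3" using \<gamma>m(1) by simp
      have "real N * \<gamma>s * (C * \<gamma>s) / \<gamma>m ^ 3 < ?g - 1" using gbig by linarith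
      then have "real N * \<gamma>s * (C * \<gamma>s) < (?g - 1) * \<gamma>m ^ 3" using p by (simp add: divide_less_eq)
      then have "real N * \<gamma>s * (C * \<gamma>s) * ?g < (?g - 1) * \<gamma>m ^ 3 * ?g" using g2 by (intro mult_strict_right_mono) auto
      then show ?thesis by (simp add: mult_ac)
    qed
    ultimately show ?thesis using q by linarith
  qed
  have "\<exists>w x. w \<in> \<Delta> \<and> (\<forall>j<M. G w x j \<le> 0) \<and> V w x = 0"
  proof (rule simplex_ball_equilibrium[OF M R, of G V, folded \<Delta>_def])
    fix W :: "nat \<Rightarrow> nat \<Rightarrow> real" and X :: "nat \<Rightarrow> 'a" and w x j
    assume W: "\<And>i. W i \<in> \<Delta>" "w \<in> \<Delta>" "\<And>j. j < M \<Longrightarrow> (\<lambda>i. W i j) \<longlonglongrightarrow> w j" "X \<longlonglongrightarrow> x"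
    show "(\<lambda>i. G (W i) (X i) j) \<longlonglongrightarrow> G w x j"
      unfolding G_def by (intro tendsto_intros \<psi>lim W)
  next
    fix W :: "nat \<Rightarrow> nat \<Rightarrow> real" and X :: "nat \<Rightarrow> 'a" and w x
    assume W: "\<And>i. W i \<in> \<Delta>" "w \<in> \<Delta>" "\<And>j. j < M \<Longrightarrow> (\<lambda>i. W i j) \<longlonglongrightarrow> w j" "X \<longlonglongrightarrow> x"
    show "(\<lambda>i. V (W i) (X i)) \<longlonglongrightarrow> V w x"
      unfolding V_def \<alpha>_def a_def by (intro tendsto_intros \<psi>lim twlim W)
  next
    fix w and x :: 'a assume w: "w \<in> \<Delta>"
    have "(\<Sum>j<M. w j * G w x j) = (\<Sum>k=1..N. \<psi> (tw w) x k * tw w k)"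
      unfolding G_def tw_def[of w] sum_distrib_left by (subst sum.swap) (simp add: mult_ac)
    then show "(\<Sum>j<M. w j * G w x j) = 0" using \<psi>bal[OF tw[OF w]] by simp
  next
    fix w and x :: 'a assume "w \<in> \<Delta>" "R \<le> norm x"
    then show "0 < V w x \<bullet> x" by (rule out)
  qed
  then obtain w x where w: "w \<in> \<Delta>" and G: "\<And>j. j < M \<Longrightarrow> G w x j \<le> 0" and V: "V w x = 0"
    by blast
  let ?t = "tw w"
  let ?\<psi> = "\<psi> ?t x" and ?\<alpha> = "\<alpha> ?t x"
  note t = tw[OF w]
  \<comment> \<open>The inequality for the generators extends to all balanced weights.\<close>
  have VI: "(\<Sum>k=1..N. ?\<psi> k * t' k) \<le> 0" if t': "balanced N u t'" for t'
  proof -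
    obtain v where v: "\<forall>j<M. 0 \<le> v j" "\<forall>k\<in>?I. t' k = (\<Sum>j<M. v j * \<tau> j k)"
      using gen[OF t'] by blast
    have "(\<Sum>k=1..N. ?\<psi> k * t' k) = (\<Sum>k=1..N. \<Sum>j<M. v j * (?\<psi> k * \<tau> j k))"
      using v(2) by (intro sum.cong) (auto simp: sum_distrib_left mult_ac)
    also have "\<dots> = (\<Sum>j<M. v j * G w x j)"
      unfolding G_def sum_distrib_left by (subst sum.swap) simp
    also have "\<dots> \<le> 0" using v(1) G by (intro sum_nonpos) (auto intro: mult_nonneg_nonpos)
    finally show ?thesis .
  qed
  have \<psi>\<alpha>: "(?\<psi> k)\<^sup>2 \<le> ?\<psi> k * ?\<alpha> k" for k
  proof -
    have "?\<psi> k * ?\<alpha> k = (?\<psi> k)\<^sup>2 + ?\<psi> k * max 0 (?\<psi> k) * a ?t x k"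
      by (simp add: \<alpha>_def power2_eq_square algebra_simps)
    moreover have "0 \<le> ?\<psi> k * max 0 (?\<psi> k) * a ?t x k"
    proof (rule mult_nonneg_nonneg)
      show "0 \<le> ?\<psi> k * max 0 (?\<psi> k)" by (simp add: max_def)
    qed (simp add: a_def)
    ultimately show ?thesis by linarith
  qed
  have zero_on: "?\<psi> k = 0" if k: "k \<in> ?I" "?t k \<noteq> 0" for k
  proof -
    \<comment> \<open>Small enough for the perturbed weights to remain nonnegative.\<close>
    define \<epsilon> where "\<epsilon> = 1 / (1 + (\<Sum>k=1..N. \<bar>?\<alpha> k\<bar>))"
    have s0: "0 \<le> (\<Sum>k=1..N. \<bar>?\<alpha> k\<bar>)" by (intro sum_nonneg) auto
    have \<epsilon>: "0 < \<epsilon>" unfolding \<epsilon>_def using s0 by (intro divide_pos_pos) (simp, linarith)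
    have f: "0 < 1 + \<epsilon> * ?\<alpha> k" if "k \<in> ?I" for k
    proof -
      have "\<bar>?\<alpha> k\<bar> \<le> (\<Sum>k=1..N. \<bar>?\<alpha> k\<bar>)" using that by (intro member_le_sum) auto
      then have "\<epsilon> * \<bar>?\<alpha> k\<bar> < 1" using s0 by (simp add: \<epsilon>_def divide_less_eq)
      moreover have "- (\<epsilon> * \<bar>?\<alpha> k\<bar>) \<le> \<epsilon> * ?\<alpha> k"
        using \<epsilon> mult_left_mono[of "- \<bar>?\<alpha> k\<bar>" "?\<alpha> k" \<epsilon>] by simp
      ultimately show ?thesis by linarith
    qed
    define t' where "t' k = ?t k * (1 + \<epsilon> * ?\<alpha> k)" for k
    have t'0: "0 \<le> t' k" if "k \<in> ?I" for k
      using f[OF that] balancedD(1)[OF t that] by (simp add: t'_def)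
    have "(\<Sum>k=1..N. t' k *\<^sub>R u k) = (\<Sum>k=1..N. ?t k *\<^sub>R u k) + \<epsilon> *\<^sub>R V w x"
      unfolding V_def scaleR_sum_right sum.distrib[symmetric]
      by (intro sum.cong) (auto simp: t'_def algebra_simps)
    then have t'u: "(\<Sum>k=1..N. t' k *\<^sub>R u k) = 0" using V balancedD(2)[OF t] by simp
    have "0 < t' k" using f[OF k(1)] balancedD(1)[OF t k(1)] k(2) by (simp add: t'_def)
    also have "t' k \<le> (\<Sum>k=1..N. t' k)" using k(1) t'0 by (intro member_le_sum) auto
    finally have s: "0 < (\<Sum>k=1..N. t' k)" .
    have "(\<Sum>k=1..N. ?\<psi> k * (t' k / (\<Sum>k=1..N. t' k))) \<le> 0"
      by (rule VI[OF balanced_normalize[OF t'0 t'u s]])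
    then have "(\<Sum>k=1..N. ?\<psi> k * t' k) / (\<Sum>k=1..N. t' k) \<le> 0"
      by (simp add: sum_divide_distrib)
    then have "(\<Sum>k=1..N. ?\<psi> k * t' k) \<le> 0" using s by (simp add: divide_le_0_iff)
    moreover have "(\<Sum>k=1..N. ?\<psi> k * t' k) = (\<Sum>k=1..N. ?\<psi> k * ?t k) + \<epsilon> * (\<Sum>k=1..N. ?t k * (?\<psi> k * ?\<alpha> k))"
      unfolding sum_distrib_left sum.distrib[symmetric]
      by (intro sum.cong) (auto simp: t'_def algebra_simps)
    ultimately have "\<epsilon> * (\<Sum>k=1..N. ?t k * (?\<psi> k * ?\<alpha> k)) \<le> 0" using \<psi>bal[OF t] by simp
    then have "(\<Sum>k=1..N. ?t k * (?\<psi> k * ?\<alpha> k)) \<le> 0" using \<epsilon> by (simp add: mult_le_0_iff)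
    moreover have "(\<Sum>k=1..N. ?t k * (?\<psi> k)\<^sup>2) \<le> (\<Sum>k=1..N. ?t k * (?\<psi> k * ?\<alpha> k))"
      using \<psi>\<alpha> balancedD(1)[OF t] by (intro sum_mono mult_left_mono) auto
    moreover have "?t k * (?\<psi> k)\<^sup>2 \<le> (\<Sum>k=1..N. ?t k * (?\<psi> k)\<^sup>2)"
      using k(1) balancedD(1)[OF t] by (intro member_le_sum) auto
    ultimately have "?t k * (?\<psi> k)\<^sup>2 \<le> 0" by linarith
    moreover have "0 < ?t k" using k balancedD(1)[OF t k(1)] by simp
    ultimately show ?thesis by (simp add: mult_le_0_iff)
  qed
  have off: "?\<psi> k = \<gamma> k" if "k \<in> ?I" "?t k = 0" for k
    using c_off[OF fsb[OF t] that(1)] that(2) by (simp add: \<psi>_def d_def)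
  have \<psi>nn: "0 \<le> ?\<psi> k" if "k \<in> ?I" for k
    using zero_on[OF that] off[OF that] \<gamma>[OF that] by (cases "?t k = 0") auto
  have \<psi>0: "?\<psi> k = 0" if k: "k \<in> ?I" for k
  proof -
    have "?\<psi> k * t0 k \<le> (\<Sum>k=1..N. ?\<psi> k * t0 k)"
      using k \<psi>nn strict(2) by (intro member_le_sum) (auto intro!: mult_nonneg_nonneg intro: less_imp_le)
    also have "\<dots> \<le> 0" by (rule VI[OF strict(1)])
    finally have "?\<psi> k * t0 k \<le> 0" .
    then show ?thesis using \<psi>nn[OF k] strict(2)[OF k] by (auto simp: mult_le_0_iff)
  qed
  show ?thesis
  proof (intro exI conjI ballI)
    show "feasible N u \<gamma> ?t (xh ?t x)" by (rule fsb[OF t])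
    show "0 < lam ?t x" by (rule lampos[OF t])
    fix k assume "k \<in> ?I"
    from \<psi>0[OF this] show "lam ?t x * c ?t (xh ?t x) k = \<gamma> k" by (simp add: \<psi>_def d_def)
  qed
qed

section \<open>The affine dual curvature measure of a polytope\<close>

lemma borel_measurable_completion_AE:
  fixes f g :: "'a \<Rightarrow> real"
  assumes g: "g \<in> borel_measurable M" and ae: "AE x in M. f x = g x"
  shows "f \<in> borel_measurable (completion M)"
proof (rule measurableI)
  fix B :: "real set" assume B: "B \<in> sets borel"
  have gB: "{x \<in> space M. g x \<in> B} \<in> sets (completion M)"
    using measurable_sets[OF g B] by (intro sets_completionI_sets) (simp add: vimage_def Int_def conj_commute)
  have "Measurable.pred (completion M) (\<lambda>x. f x \<in> B \<and> g x \<notin> B)" "Measurable.pred (completion M) (\<lambda>x. g x \<in> B \<and> f x \<notin> B)"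
    using ae by (auto intro!: sets_completion_AE elim: eventually_mono)
  then have "{x \<in> space M. f x \<in> B \<and> g x \<notin> B} \<in> sets (completion M)" "{x \<in> space M. g x \<in> B \<and> f x \<notin> B} \<in> sets (completion M)"
    by (auto simp: pred_def)
  with gB have "({x \<in> space M. g x \<in> B} - {x \<in> space M. g x \<in> B \<and> f x \<notin> B}) \<union> {x \<in> space M. f x \<in> B \<and> g x \<notin> B} \<in> sets (completion M)"
    by (intro sets.Un sets.Diff)
  also have "({x \<in> space M. g x \<in> B} - {x \<in> space M. g x \<in> B \<and> f x \<notin> B}) \<union> {x \<in> space M. f x \<in> B \<and> g x \<notin> B}
      = f -` B \<inter> space (completion M)" by auto
  finally show "f -` B \<inter> space (completion M) \<in> sets (completion M)" .
qed simp

text \<open>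
  The ray meets the boundary in a point \<open>y\<close> on the \<open>k\<close>-th bounding hyperplane only. So every direction \<open>d\<close> with
  \<open>u k \<bullet> d \<le> 0\<close> leads from \<open>y\<close> into the polytope, and \<open>u k\<close> is the only unit outer normal at \<open>y\<close>.
\<close>

lemma reverse_gauss_image_generic:
  fixes u :: "nat \<Rightarrow> real^'n"
  assumes ad: "admissible N u \<rho> s t" and unit: "\<forall>k\<in>{1..N}. norm (u k) = 1"
    and pi: "pairwise_indep N u" and s: "\<forall>k\<in>{1..N}. 0 < s k"
    and g: "generic_dir N u s t v" and k: "k \<in> {1..N}" "v \<in> facet_cone N u s t k" and \<eta>: "\<eta> \<subseteq> sphere 0 1"
  shows "v \<in> reverse_radial_gauss_image (halfspace_poly N u s t) \<eta> \<longleftrightarrow> u k \<in> \<eta>"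
    "\<And>i. i \<in> {1..N} \<Longrightarrow> v \<in> facet_cone N u s t i \<Longrightarrow> i = k"
proof -
  let ?P = "halfspace_poly N u s t"
  let ?r = "radial_fn ?P v"
  note B = admissible_body[OF ad]
  have v: "norm v = 1" using g by (simp add: generic_dir_def)
  note R = radial_fn_props[OF B(1-4) v]
  have tk: "t k * (?r * (u k \<bullet> v)) = s k" using k(2) by (simp add: facet_cone_def)
  have r: "0 < ?r" using tk bspec[OF s k(1)] R(1) by (cases "?r = 0") auto
  have tpos: "0 < t k" using tk bspec[OF s k(1)] ad k(1) by (cases "t k = 0") (auto simp: admissible_def order.strict_iff_order)
  have strict: "t i * (?r * (u i \<bullet> v)) < s i" if "i \<in> {1..N}" "i \<noteq> k" for i
    by (rule generic_unique_tight[OF ad g pi r that(1) k(1) that(2) tk])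
  show "i = k" if "i \<in> {1..N}" "v \<in> facet_cone N u s t i" for i
    using strict[of i] that by (cases "i = k") (auto simp: facet_cone_def)
  let ?y = "?r *\<^sub>R v"
  have bdd: "bdd_above ((\<lambda>x. x \<bullet> w) ` ?P)" for w
    using B(1) by (intro bounded_imp_bdd_above compact_imp_bounded compact_continuous_image continuous_intros)
  have le: "x \<bullet> u k \<le> ?y \<bullet> u k" if "x \<in> ?P" for x
  proof -
    have "t k * (u k \<bullet> x) \<le> s k" using that k(1) by (auto simp: halfspace_poly_def)
    also have "s k = t k * (u k \<bullet> ?y)" using tk by simp
    finally show ?thesis using tpos by (simp add: inner_commute)
  qed
  have sup: "?y \<bullet> w = support_fn ?P w \<longleftrightarrow> (\<forall>x\<in>?P. x \<bullet> w \<le> ?y \<bullet> w)" for w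
  proof
    assume "?y \<bullet> w = support_fn ?P w"
    then show "\<forall>x\<in>?P. x \<bullet> w \<le> ?y \<bullet> w" unfolding support_fn_def using bdd by (auto intro: cSUP_upper)
  next
    assume a: "\<forall>x\<in>?P. x \<bullet> w \<le> ?y \<bullet> w"
    show "?y \<bullet> w = support_fn ?P w"
      unfolding support_fn_def using a R(3) bdd[of w] B(3)
      by (intro antisym cSUP_upper cSUP_least) auto
  qed
  have normal: "w = u k" if w: "norm w = 1" "\<forall>x\<in>?P. x \<bullet> w \<le> ?y \<bullet> w" for w
  proof -
    \<comment> \<open>The directions into the polytope; below this is applied to -u k and to the component of w
      orthogonal to u k.\<close>
    have dir: "d \<bullet> w \<le> 0" if d: "u k \<bullet> d \<le> 0" for d
    proof -
      have "\<forall>\<^sub>F e in at_right 0. t i * (u i \<bullet> (?y + e *\<^sub>R d)) \<le> s i" if i: "i \<in> {1..N}" for i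
      proof (cases "i = k")
        case True
        have "\<forall>\<^sub>F e in at_right (0::real). 0 < e" by (rule eventually_at_right_less)
        then show ?thesis
        proof eventually_elim
          case (elim e)
          have "t k * (e * (u k \<bullet> d)) \<le> 0" using elim tpos d by (intro mult_nonneg_nonpos) auto
          then show ?case using True tk by (simp add: inner_add_right distrib_left)
        qed
      next
        case False
        have l: "((\<lambda>e. t i * (u i \<bullet> (?y + e *\<^sub>R d))) \<longlongrightarrow> t i * (u i \<bullet> (?y + 0 *\<^sub>R d))) (at_right 0)"
          by (intro tendsto_intros)
        have "t i * (u i \<bullet> (?y + 0 *\<^sub>R d)) < s i" using strict[OF i False] by simp
        from order_tendstoD(2)[OF l this] show ?thesis by (rule eventually_mono) simp
      qed
      then have "\<forall>\<^sub>F e in at_right 0. \<forall>i\<in>{1..N}. t i * (u i \<bullet> (?y + e *\<^sub>R d)) \<le> s i"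
        by (intro eventually_ball_finite) auto
      moreover have "\<forall>\<^sub>F e in at_right (0::real). 0 < e" by (rule eventually_at_right_less)
      ultimately have "\<forall>\<^sub>F e in at_right (0::real). ?y + e *\<^sub>R d \<in> ?P \<and> 0 < e"
        by eventually_elim (simp add: halfspace_poly_def)
      then obtain e :: real where e: "?y + e *\<^sub>R d \<in> ?P" "0 < e" using eventually_happens[of _ "at_right (0::real)"] by auto
      have "(?y + e *\<^sub>R d) \<bullet> w \<le> ?y \<bullet> w" using w(2) e(1) by blast
      then have "e * (d \<bullet> w) \<le> 0" by (simp add: inner_add_left)
      then show ?thesis using e(2) by (simp add: mult_le_0_iff)
    qed
    have uk: "u k \<bullet> u k = 1" using bspec[OF unit k(1)] by (simp add: norm_eq_1)
    have ww: "w \<bullet> w = 1" using w(1) by (simp add: norm_eq_1)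
    define c where "c = w \<bullet> u k"
    have "u k \<bullet> (- u k) \<le> 0" using uk by simp
    from dir[OF this] have c0: "0 \<le> c" by (simp add: c_def inner_commute)
    have "u k \<bullet> (w - c *\<^sub>R u k) \<le> 0" using uk by (simp add: inner_diff_right c_def inner_commute)
    from dir[OF this] have "(w - c *\<^sub>R u k) \<bullet> w \<le> 0" .
    moreover have "(w - c *\<^sub>R u k) \<bullet> w = 1 - c * c"
      using ww by (simp add: inner_diff_left c_def inner_commute[of "u k" w])
    ultimately have "1 - c * c \<le> 0" by simp
    then have "1 \<le> c" using mult_le_one[of c c] c0 mult_strict_mono[of c 1 c 1] by (cases "c < 1") auto
    then have "(w - u k) \<bullet> (w - u k) \<le> 0"
      using uk ww by (simp add: inner_diff_left inner_diff_right c_def inner_commute)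
    then have "(w - u k) \<bullet> (w - u k) = 0" using inner_ge_zero[of "w - u k"] by linarith
    then show ?thesis by simp
  qed
  show "v \<in> reverse_radial_gauss_image ?P \<eta> \<longleftrightarrow> u k \<in> \<eta>"
  proof
    assume "v \<in> reverse_radial_gauss_image ?P \<eta>"
    then obtain w where w: "w \<in> \<eta>" "?y \<bullet> w = support_fn ?P w" by (auto simp: reverse_radial_gauss_image_def)
    then show "u k \<in> \<eta>" using normal[of w] sup[of w] \<eta> by auto
  next
    assume "u k \<in> \<eta>"
    then show "v \<in> reverse_radial_gauss_image ?P \<eta>"
      using sup[of "u k"] le v by (auto simp: reverse_radial_gauss_image_def)
  qed
qed

text \<open>
  Almost everywhere the indicator of the reverse radial Gauss image is a sum of indicators of facet cones;
  this also makes it measurable for the completed measure.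
\<close>

lemma affine_dual_curvature_halfspace_poly:
  fixes u :: "nat \<Rightarrow> real^'n"
  assumes ad: "admissible N u \<rho> s t" and unit: "\<forall>k\<in>{1..N}. norm (u k) = 1"
    and pi: "pairwise_indep N u" and s: "\<forall>k\<in>{1..N}. 0 < s k"
    and m: "0 < m" "m \<le> CARD('n)" and \<eta>: "\<eta> \<subseteq> sphere 0 1"
  shows "affine_dual_curvature m (halfspace_poly N u s t) \<eta> = (\<Sum>k=1..N. indicator \<eta> (u k) * facet_mass m N u s t k)"
proof -
  let ?P = "halfspace_poly N u s t" and ?A = "reverse_radial_gauss_image (halfspace_poly N u s t) \<eta>"
  let ?f = "\<lambda>v. indicat_real ?A v * curv_density m ?P v"
  let ?g = "\<lambda>v. \<Sum>k=1..N. indicat_real \<eta> (u k) * (indicat_real (facet_cone N u s t k) v * curv_density m ?P v)"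
  have int: "integrable sphere_measure (\<lambda>v. indicat_real (facet_cone N u s t k) v * curv_density m ?P v)" for k
    by (rule facet_integrand_integrable[OF ad m facet_cone_measurable[OF ad]])
  then have gm: "?g \<in> borel_measurable sphere_measure"
    by (intro borel_measurable_sum borel_measurable_times borel_measurable_const borel_measurable_integrable)
  have ae0: "AE v in sphere_measure. generic_dir N u s t v" by (rule AE_generic_dir) (rule unit)
  have ae: "AE v in sphere_measure. ?f v = ?g v"
    using ae0
  proof eventually_elim
    case (elim v)
    then have v: "norm v = 1" by (simp add: generic_dir_def)
    obtain k where k: "k \<in> {1..N}" "t k * (radial_fn ?P v * (u k \<bullet> v)) = s k"
      using admissible_tight[OF ad v] by metis
    then have vk: "v \<in> facet_cone N u s t k" using v by (simp add: facet_cone_def)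
    note rg = reverse_gauss_image_generic[OF ad unit pi s elim k(1) vk \<eta>]
    have "?g v = (\<Sum>i=1..N. if i = k then indicat_real \<eta> (u k) * curv_density m ?P v else 0)"
    proof (rule sum.cong)
      fix i assume i: "i \<in> {1..N}"
      show "indicat_real \<eta> (u i) * (indicat_real (facet_cone N u s t i) v * curv_density m ?P v)
         = (if i = k then indicat_real \<eta> (u k) * curv_density m ?P v else 0)"
        using rg(2)[OF i] vk by (cases "v \<in> facet_cone N u s t i") auto
    qed simp
    also have "\<dots> = indicat_real \<eta> (u k) * curv_density m ?P v" using k(1) by simp
    also have "\<dots> = ?f v" using rg(1) by (simp add: indicator_def)
    finally show ?case ..
  qed
  have fm: "?f \<in> borel_measurable (completion sphere_measure)" by (rule borel_measurable_completion_AE[OF gm ae])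
  have "affine_dual_curvature m ?P \<eta> = (LINT v|completion sphere_measure. ?f v)"
    using ad unfolding affine_dual_curvature_def admissible_def set_lebesgue_integral_def curv_density_def radon_vol_def by simp
  also have "\<dots> = (LINT v|completion sphere_measure. ?g v)"
    by (rule integral_cong_AE[OF fm measurable_completion[OF gm] AE_completion[OF ae]])
  also have "\<dots> = (LINT v|sphere_measure. ?g v)" by (rule integral_completion[OF gm])
  also have "\<dots> = (\<Sum>k=1..N. indicator \<eta> (u k) * facet_mass m N u s t k)"
    unfolding facet_mass_def by (subst Bochner_Integration.integral_sum) (auto intro: int)
  finally show ?thesis .
qed

section \<open>Normals in general position\<close>

text \<open>
  A balanced vector with at most \<open>n\<close> nonzero entries would be a linear relation between independent
  vectors. So its support has more than \<open>n\<close> elements and contains a basis.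
\<close>

lemma general_position_facts:
  fixes u :: "nat \<Rightarrow> real^'n"
  assumes gp: "general_position N u" and n: "2 \<le> CARD('n)" "CARD('n) \<le> N"
  shows "inj_on u {1..N}" "pairwise_indep N u" "supports_span N u"
    "\<And>v. v \<noteq> 0 \<Longrightarrow> \<exists>k\<in>{1..N}. u k \<bullet> v < 0"
proof -
  have ind: "inj_on u I \<and> independent (u ` I)" if I: "I \<subseteq> {1..N}" "card I \<le> CARD('n)" for I
  proof -
    obtain I' where I': "I \<subseteq> I'" "I' \<subseteq> {1..N}" "card I' = CARD('n)"
    proof -
      have "\<exists>I'. I \<subseteq> I' \<and> I' \<subseteq> {1..N} \<and> card I' = CARD('n)"
        by (rule exists_subset_between) (use I n in auto)
      then show thesis using that by blast
    qed
    then have "inj_on u I'" "independent (u ` I')" using gp by (auto simp: general_position_def)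
    then show ?thesis using I'(1) by (meson image_mono independent_mono inj_on_subset)
  qed
  have pair: "u i \<noteq> u k \<and> independent {u i, u k}" if "i \<in> {1..N}" "k \<in> {1..N}" "i \<noteq> k" for i k
    using ind[of "{i, k}"] that n by (auto simp: inj_on_def)
  show "inj_on u {1..N}" unfolding inj_on_def using pair by blast
  show "pairwise_indep N u"
    unfolding pairwise_indep_def
  proof (intro ballI impI allI)
    fix i k and a b :: real assume ik: "i \<in> {1..N}" "k \<in> {1..N}" "i \<noteq> k" and eq: "a *\<^sub>R u i = b *\<^sub>R u k"
    show "b = 0"
    proof (rule ccontr)
      assume b: "b \<noteq> 0"
      have "u k = (1 / b) *\<^sub>R (b *\<^sub>R u k)" using b by simp
      also have "\<dots> = (a / b) *\<^sub>R u i" by (simp add: eq[symmetric])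
      also have "\<dots> \<in> span {u i}" by (intro span_scale span_base) simp
      finally have "u k \<in> span {u i}" .
      moreover have "{u i, u k} - {u k} = {u i}" using pair[OF ik] by auto
      ultimately show False using pair[OF ik] unfolding dependent_def by auto
    qed
  qed
  show "supports_span N u"
    unfolding supports_span_def
  proof (intro allI impI)
    fix t :: "nat \<Rightarrow> real" and x assume t: "balanced N u t" and orth: "\<forall>k\<in>{1..N}. t k \<noteq> 0 \<longrightarrow> u k \<bullet> x = 0"
    let ?J = "{k \<in> {1..N}. t k \<noteq> 0}"
    have "\<not> card ?J \<le> CARD('n)"
    proof
      assume "card ?J \<le> CARD('n)"
      then have J: "inj_on u ?J" "independent (u ` ?J)" using ind[OF Collect_restrict, of "\<lambda>k. t k \<noteq> 0"] by simp_all
      have "(\<Sum>v\<in>u ` ?J. t (inv_into ?J u v) *\<^sub>R v) = (\<Sum>k\<in>?J. t k *\<^sub>R u k)"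
        using J(1) by (subst sum.reindex) (auto intro!: sum.cong simp: inv_into_f_f)
      also have "\<dots> = (\<Sum>k=1..N. t k *\<^sub>R u k)" by (intro sum.mono_neutral_left) auto
      finally have z: "(\<Sum>v\<in>u ` ?J. t (inv_into ?J u v) *\<^sub>R v) = 0" using balancedD(2)[OF t] by simp
      have "t k = 0" if "k \<in> ?J" for k
        using real_vector.independentD[OF J(2) _ subset_refl z, of "u k"] J(1) that by (simp add: inv_into_f_f)
      then have "\<forall>k\<in>{1..N}. t k = 0" by blast
      then show False using balancedD(3)[OF t] by simp
    qed
    then have "CARD('n) \<le> card ?J" by linarith
    from obtain_subset_with_card_n[OF this] obtain I where I: "I \<subseteq> ?J" "card I = CARD('n)" by metis
    have uI: "inj_on u I" "independent (u ` I)" using ind[OF subset_trans[OF I(1) Collect_restrict]] I(2) by simp_all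
    then have "card (u ` I) = DIM(real^'n)" using I(2) card_image[OF uI(1)] by simp
    then have "span (u ` I) = UNIV"
      using card_ge_dim_independent[of "u ` I" UNIV] uI(2) dim_UNIV by (metis dual_order.refl subset_UNIV top.extremum_uniqueI)
    then have "x \<in> span (u ` I)" by simp
    moreover have "orthogonal x y" if "y \<in> u ` I" for y
    proof -
      obtain k where k: "y = u k" "k \<in> I" using \<open>y \<in> u ` I\<close> by blast
      then have "k \<in> {1..N}" "t k \<noteq> 0" using I(1) by blast+
      then show ?thesis using orth k(1) by (simp add: orthogonal_def inner_commute)
    qed
    ultimately have "orthogonal x x" by (rule orthogonal_to_span)
    then show "x = 0" by (simp add: orthogonal_self)
  qed
  fix v :: "real^'n" assume v: "v \<noteq> 0"
  show "\<exists>k\<in>{1..N}. u k \<bullet> v < 0"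
  proof (rule ccontr)
    assume "\<not> ?thesis"
    then have "\<forall>k\<in>{1..N}. 0 \<le> u k \<bullet> (v /\<^sub>R norm v)" using v by (auto simp: not_less)
    moreover have "v /\<^sub>R norm v \<in> sphere 0 1" using v by simp
    ultimately show False using gp unfolding general_position_def by blast
  qed
qed

lemma polytope_halfspace_poly:
  assumes "bounded (halfspace_poly N u s t)"
  shows "polytope (halfspace_poly N u s t)"
proof -
  have "halfspace_poly N u s t = \<Inter> ((\<lambda>k. {x. (t k *\<^sub>R u k) \<bullet> x \<le> s k}) ` {1..N})" by (auto simp: halfspace_poly_def)
  moreover have "polyhedron (\<Inter> ((\<lambda>k. {x. (t k *\<^sub>R u k) \<bullet> x \<le> s k}) ` {1..N}))"
    by (rule polyhedron_Inter) (blast intro: polyhedron_halfspace_le finite_imageI)+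
  ultimately have "polyhedron (halfspace_poly N u s t)" by metis
  then show ?thesis using assms polytope_eq_bounded_polyhedron by blast
qed

text \<open>
  If \<open>y\<close> is in the translate by \<open>-x\<close>, then \<open>x\<close> and \<open>x + y\<close> are in the original polytope, which is bounded
  independently of \<open>t\<close>. As \<open>t k \<le> 1\<close>, the original polytope contains the ball about the origin
  whose radius is the least \<open>\<gamma> k\<close>.
\<close>

lemma feasible_admissible:
  fixes u :: "nat \<Rightarrow> 'a::euclidean_space"
  assumes unit: "\<forall>k\<in>{1..N}. norm (u k) = 1" and \<gamma>: "\<forall>k\<in>{1..N}. 0 < \<gamma> k"
    and sp: "supports_span N u"
  shows "\<exists>\<rho>. \<forall>t x. feasible N u \<gamma> t x \<longrightarrow> admissible N u \<rho> (\<lambda>k. \<gamma> k - t k * (u k \<bullet> x)) t"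
proof -
  obtain C where C: "0 < C"
    "\<And>t x g. balanced N u t \<Longrightarrow> 0 \<le> g \<Longrightarrow> (\<forall>k\<in>{1..N}. t k * (u k \<bullet> x) \<le> g) \<Longrightarrow> norm x \<le> C * g"
    using balanced_uniform_bound[OF sp] by blast
  define G where "G = (\<Sum>k=1..N. \<gamma> k)"
  have G: "\<And>k. k \<in> {1..N} \<Longrightarrow> \<gamma> k \<le> G" unfolding G_def using \<gamma> by (intro member_le_sum) (auto intro: less_imp_le)
  have G0: "0 \<le> G" unfolding G_def using \<gamma> by (intro sum_nonneg) (auto intro: less_imp_le)
  have "admissible N u (2 * (C * G)) (\<lambda>k. \<gamma> k - t k * (u k \<bullet> x)) t" if f: "feasible N u \<gamma> t x" for t x
  proof -
    let ?P = "halfspace_poly N u (\<lambda>k. \<gamma> k - t k * (u k \<bullet> x)) t"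
    have t: "balanced N u t" and le: "\<And>k. k \<in> {1..N} \<Longrightarrow> t k * (u k \<bullet> x) \<le> \<gamma> k" using f by (auto simp: feasible_def)
    have bd: "norm z \<le> C * G" if "\<forall>k\<in>{1..N}. t k * (u k \<bullet> z) \<le> \<gamma> k" for z
      using that G by (intro C(2)[OF t G0]) (auto intro: order_trans)
    have "?P \<subseteq> cball 0 (2 * (C * G))"
    proof
      fix y assume y: "y \<in> ?P"
      have "norm (x + y) \<le> C * G"
        using y by (intro bd) (auto simp: halfspace_poly_def inner_add_right distrib_left algebra_simps)
      moreover have "norm x \<le> C * G" using le by (intro bd) auto
      ultimately have "norm y \<le> 2 * (C * G)" using norm_triangle_ineq4[of "x + y" x] by simp
      then show "y \<in> cball 0 (2 * (C * G))" by simp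
    qed
    moreover have "interior ?P \<noteq> {}"
    proof -
      have ne: "{1..N} \<noteq> {}" using balancedD(3)[OF t] by (cases "{1..N} = {}") auto
      define g where "g = Min (\<gamma> ` {1..N})"
      have g: "0 < g" "\<And>k. k \<in> {1..N} \<Longrightarrow> g \<le> \<gamma> k" using ne \<gamma> by (auto simp: g_def)
      have "ball (- x) g \<subseteq> ?P"
      proof
        fix z assume "z \<in> ball (- x) g"
        then have z: "norm (x + z) < g" by (simp add: dist_norm norm_minus_commute add.commute)
        show "z \<in> ?P"
          unfolding halfspace_poly_def mem_Collect_eq
        proof
          fix k assume k: "k \<in> {1..N}"
          have t01: "0 \<le> t k" "t k \<le> 1"
            using balancedD(1)[OF t k] member_le_sum[of k "{1..N}" t] balancedD(1,3)[OF t] k by auto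
          have "u k \<bullet> (x + z) \<le> norm (x + z)" using norm_cauchy_schwarz[of "u k" "x + z"] bspec[OF unit k] by simp
          then have "t k * (u k \<bullet> (x + z)) \<le> t k * g" using z t01 by (intro mult_left_mono) auto
          also have "\<dots> \<le> 1 * g" using t01 g(1) by (intro mult_right_mono) auto
          also have "\<dots> \<le> \<gamma> k" using g(2)[OF k] by simp
          finally show "t k * (u k \<bullet> z) \<le> \<gamma> k - t k * (u k \<bullet> x)"
            by (simp add: inner_add_right distrib_left)
        qed
      qed
      then show ?thesis using g(1) by (metis centre_in_ball empty_iff interior_maximal open_ball subsetD)
    qed
    ultimately show ?thesis using balancedD(1)[OF t] le \<gamma> by (auto simp: admissible_def)
  qed
  then show ?thesis by blast
qed

theorem theorem1p4:
  fixes N m :: nat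
    and \<gamma> :: "nat \<Rightarrow> real"
    and u :: "nat \<Rightarrow> real ^ 'n::finite"
  assumes "CARD('n) \<ge> 3"
    and "N \<ge> CARD('n) + 1"
    and "m \<in> {2..CARD('n) - 1}"
    and "\<And>k. k \<in> {1..N} \<Longrightarrow> \<gamma> k > 0"
    and "\<And>k. k \<in> {1..N} \<Longrightarrow> u k \<in> sphere 0 1"
    and "general_position N u"
  shows "\<exists>P :: (real ^ 'n) set.
           polytope P \<and> convex_body_o_rel_interior P \<and>
           (\<forall>\<eta>. \<eta> \<in> sets borel \<and> \<eta> \<subseteq> sphere 0 1 \<longrightarrow>
              affine_dual_curvature m P \<eta> =
                (\<Sum>k = 1..N. \<gamma> k * measure (return borel (u k)) \<eta>))"
proof -
  have unit: "\<forall>k\<in>{1..N}. norm (u k) = 1" using assms(5) by simp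
  have \<gamma>': "\<forall>k\<in>{1..N}. 0 < \<gamma> k" using assms(4) by simp
  have m: "0 < m" "m \<le> CARD('n)" using assms(1,3) by auto
  have n2: "2 \<le> CARD('n)" "CARD('n) \<le> N" using assms(1,2) by auto
  note \<gamma> = assms(4)
  note gp = general_position_facts[OF assms(6) n2]
  obtain t0 where t0: "balanced N u t0" "\<forall>k\<in>{1..N}. 0 < t0 k"
    by (rule exists_strictly_balanced[OF _ gp(1)]) (use gp(4) in blast)+
  obtain \<rho> where ad: "\<And>t x. feasible N u \<gamma> t x \<Longrightarrow> admissible N u \<rho> (\<lambda>k. \<gamma> k - t k * (u k \<bullet> x)) t"
    using feasible_admissible[OF unit \<gamma>' gp(3)] by blast
  define c where "c t x k = facet_mass m N u (\<lambda>k. \<gamma> k - t k * (u k \<bullet> x)) t k" for t x k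
  have "\<exists>t x \<mu>. feasible N u \<gamma> t x \<and> 0 < \<mu> \<and> (\<forall>k\<in>{1..N}. \<mu> * c t x k = \<gamma> k)"
  proof (rule balanced_equilibrium[OF unit \<gamma>' gp(3) t0, of c])
    fix T :: "nat \<Rightarrow> nat \<Rightarrow> real" and X :: "nat \<Rightarrow> real^'n" and t x k
    assume F: "\<And>i. feasible N u \<gamma> (T i) (X i)" "feasible N u \<gamma> t x"
      and lim: "\<And>k. k \<in> {1..N} \<Longrightarrow> (\<lambda>i. T i k) \<longlonglongrightarrow> t k" "X \<longlonglongrightarrow> x" and k: "k \<in> {1..N}"
    show "(\<lambda>i. c (T i) (X i) k) \<longlonglongrightarrow> c t x k"
      unfolding c_def
      by (rule facet_mass_tendsto[OF ad[OF F(2)] ad[OF F(1)] _ lim(1) unit gp(2) m k])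
         (auto intro!: tendsto_intros lim)
  next
    fix t x k assume F: "feasible N u \<gamma> t x" and k: "k \<in> {1..N}"
    show "0 \<le> c t x k" unfolding c_def by (rule facet_mass_nonneg[OF ad[OF F] m])
    assume "t k = 0 \<or> t k * (u k \<bullet> x) = \<gamma> k"
    then show "c t x k = 0" unfolding c_def by (intro facet_mass_zero[OF ad[OF F] unit k m(1)]) auto
  next
    fix t x assume F: "feasible N u \<gamma> t x"
    show "\<exists>k\<in>{1..N}. 0 < c t x k" unfolding c_def by (rule facet_mass_exists_pos[OF ad[OF F] m n2(1)])
  qed
  then obtain t x \<mu> where f: "feasible N u \<gamma> t x" and \<mu>: "0 < \<mu>"
    and eq: "\<And>k. k \<in> {1..N} \<Longrightarrow> \<mu> * c t x k = \<gamma> k" by blast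
  define s where "s k = \<gamma> k - t k * (u k \<bullet> x)" for k
  have ads: "admissible N u \<rho> s t" using ad[OF f] unfolding s_def .
  have cs: "c t x k = facet_mass m N u s t k" for k unfolding c_def s_def ..
  have spos: "0 < s k" if k: "k \<in> {1..N}" for k
  proof -
    have "c t x k \<noteq> 0" using eq[OF k] \<gamma>[OF k] by auto
    then have "s k \<noteq> 0" using facet_mass_zero[OF ads unit k m(1)] unfolding cs by blast
    moreover have "0 \<le> s k" using ads k by (auto simp: admissible_def)
    ultimately show ?thesis by simp
  qed
  have mn: "0 < m * CARD('n)" using m by simp
  \<comment> \<open>Dilation by l multiplies all masses by \<open>\<mu>\<close>.\<close>
  define l where "l = root (m * CARD('n)) \<mu>"
  have l: "0 < l" "l ^ (m * CARD('n)) = \<mu>" using \<mu> mn by (auto simp: l_def)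
  define P where "P = halfspace_poly N u (\<lambda>k. l * s k) t"
  have scaled: "P = (\<lambda>x. l *\<^sub>R x) ` halfspace_poly N u s t" unfolding P_def by (rule halfspace_poly_scale[OF l(1)])
  have int: "0 \<in> interior P"
  proof (rule interiorI[of "\<Inter>k\<in>{1..N}. {x. (t k *\<^sub>R u k) \<bullet> x < l * s k}"])
    show "open (\<Inter>k\<in>{1..N}. {x. (t k *\<^sub>R u k) \<bullet> x < l * s k})" by (intro open_INT ballI open_halfspace_lt) auto
    show "0 \<in> (\<Inter>k\<in>{1..N}. {x. (t k *\<^sub>R u k) \<bullet> x < l * s k})" using l spos by simp
    show "(\<Inter>k\<in>{1..N}. {x. (t k *\<^sub>R u k) \<bullet> x < l * s k}) \<subseteq> P"
      by (auto simp: P_def halfspace_poly_def intro: less_imp_le)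
  qed
  have adl: "admissible N u (l * \<rho>) (\<lambda>k. l * s k) t"
    unfolding admissible_def
  proof (intro conjI)
    show "\<forall>k\<in>{1..N}. 0 \<le> t k \<and> 0 \<le> l * s k \<and> (t k = 0 \<longrightarrow> 0 < l * s k)"
      using ads l spos by (auto simp: admissible_def)
    show "halfspace_poly N u (\<lambda>k. l * s k) t \<subseteq> cball 0 (l * \<rho>)"
      using admissible_body(4)[OF ads] l unfolding P_def[symmetric] scaled by (auto intro!: mult_left_mono)
    show "interior (halfspace_poly N u (\<lambda>k. l * s k) t) \<noteq> {}" using int unfolding P_def by blast
  qed
  note body = admissible_body[OF adl, folded P_def]
  have "polytope P" unfolding P_def by (rule polytope_halfspace_poly) (use body in \<open>simp add: P_def compact_imp_bounded\<close>)
  moreover have "convex_body_o_rel_interior P"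
    using body int interior_subset_rel_interior[of P] by (auto simp: convex_body_o_rel_interior_def convex_body_def)
  moreover have "affine_dual_curvature m P \<eta> = (\<Sum>k = 1..N. \<gamma> k * measure (return borel (u k)) \<eta>)"
    if \<eta>: "\<eta> \<in> sets borel" "\<eta> \<subseteq> sphere 0 1" for \<eta>
  proof -
    have "affine_dual_curvature m P \<eta> = (\<Sum>k=1..N. indicator \<eta> (u k) * facet_mass m N u (\<lambda>k. l * s k) t k)"
      unfolding P_def using spos l(1) by (intro affine_dual_curvature_halfspace_poly[OF adl unit gp(2) _ m \<eta>(2)]) auto
    also have "\<dots> = (\<Sum>k = 1..N. \<gamma> k * measure (return borel (u k)) \<eta>)"
    proof (rule sum.cong)
      fix k assume k: "k \<in> {1..N}"
      have "facet_mass m N u (\<lambda>k. l * s k) t k = \<gamma> k"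
        using facet_mass_scale[OF ads m l(1), of k] eq[OF k] unfolding l(2) cs by simp
      then show "indicator \<eta> (u k) * facet_mass m N u (\<lambda>k. l * s k) t k = \<gamma> k * measure (return borel (u k)) \<eta>"
        using \<eta>(1) by (simp add: measure_return)
    qed simp
    finally show ?thesis .
  qed
  ultimately show ?thesis by blast
qed

end
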